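(* Let $n\geq 3$ be an odd integer and let $f\in\mathbb{C}\{x,y\}$ be a product $f=f_1g$ where $f_1$ is regular (multiplicity 1), $g$ is irreducible of multiplicity 2 with value semigroup $\langle 2,n\rangle$, and $f_1=0$, $g=0$ have the same tangent line and $I(f_1,g)=n$. Then, up to an analytic change of coordinates (and multiplication by a unit), one of the following holds: (i) $f=y(y^2-x^n)$; in this case $\{ny\,dx-2x\,dy,\ df\}$ is a Saito basis for $S(f)$ and $\tau(f)=\mu(f)=3n-2$. (ii) $f=y\big(y^2-2x^{\frac{n+2m-1}{2}}y-x^n+x^{n+2m-1}\big)$ for some integer $1\leq m\leq\frac{n-3}{2}$; in this case $\{\eta_1,\eta_2\}$ is a Saito basis for $S(f)$, where $$\eta_1=2\Big((2m-1)y-nx^{\frac{n-2m+1}{2}}+nx^{\frac{n+2m-1}{2}}\Big)dy+\Big(n^2x^{\frac{n-2m-1}{2}}-(n+2m-1)^2x^{\frac{n+2m-3}{2}}\Big)y\,dx,$$ $$\eta_2=2xy\,dy-y\Big(ny+(2m-1)x^{\frac{n+2m-1}{2}}\Big)dx,$$ and $\tau(f)=\frac{5n+2m-3}{2}$.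
   Context: $\Omega^1=\mathbb{C}\{x,y\}dx+\mathbb{C}\{x,y\}dy$; for reduced non-unit $f$, $F(f)=\{p\,df+f\eta:\ p\in\mathbb{C}\{x,y\},\eta\in\Omega^1\}$ and the Saito module is $S(f)=\{\omega\in\Omega^1:\ g\omega\in F(f)\text{ for some }g\in\mathbb{C}\{x,y\}\text{ with }\gcd(g,f)=1\}$; equivalently $\omega\wedge df\in f\,\mathbb{C}\{x,y\}\,dx\wedge dy$. It is free of rank 2 over $\mathbb{C}\{x,y\}$; a Saito basis is a basis $\{\omega_1,\omega_2\}$ (Saito's criterion: $\omega_1,\omega_2\in S(f)$ form a basis iff $\omega_1\wedge\omega_2=uf\,dx\wedge dy$ with $u$ a unit). $\tau(f)=\dim_{\mathbb{C}}\mathbb{C}\{x,y\}/\langle f,f_x,f_y\rangle$ and $\mu(f)=\dim_{\mathbb{C}}\mathbb{C}\{x,y\}/\langle f_x,f_y\rangle$ are the Tjurina and Milnor numbers; $I(p,q)=\dim_{\mathbb{C}}\mathbb{C}\{x,y\}/\langle p,q\rangle$. The value semigroup of an irreducible $g$ is the set of orders in $t$ of $h(x(t),y(t))$, $h\in\mathbb{C}\{x,y\}\setminus\langle g\rangle$, for a primitive parametrization $(x(t),y(t))$ of $g=0$. *)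

theory Defs
  imports "HOL-Analysis.Analysis"
begin

unbundle no vec_syntax
unbundle fps_syntax

section \<open>The ring of convergent power series in two variables\<close>

text \<open>
  A formal power series in two variables is a \<^typ>\<open>complex fps fps\<close>; the outer series is in y, the
  inner ones are in x, so the coefficient of x^i y^j in F is \<open>F $ j $ i\<close>.
\<close>

definition convergent2 :: "complex fps fps \<Rightarrow> bool" where
  "convergent2 F \<longleftrightarrow> (\<exists>r>0. (\<lambda>(i, j). norm (F $ j $ i) * r ^ (i + j)) summable_on UNIV)"

text \<open>Convergence amounts to a Cauchy estimate for the coefficients.\<close>

lemma convergent2_imp_bound:
  assumes "convergent2 F"
  obtains M C where "M \<ge> 0" "C > 0" "\<And>i j. norm (F $ j $ i) \<le> M * C ^ (i + j)"
proof -
  obtain r :: real where r: "r > 0"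
    and s: "(\<lambda>(i, j). norm (F $ j $ i) * r ^ (i + j)) summable_on UNIV"
    using assms unfolding convergent2_def by blast
  let ?M = "infsum (\<lambda>(i, j). norm (F $ j $ i) * r ^ (i + j)) UNIV"
  have le: "norm (F $ j $ i) * r ^ (i + j) \<le> ?M" for i j
    using finite_sum_le_infsum[OF s, of "{(i, j)}"] r by auto
  have "norm (F $ j $ i) \<le> ?M * (inverse r) ^ (i + j)" for i j
    using le[of j i] r by (simp add: field_simps)
  moreover have "?M \<ge> 0"
    using r by (auto intro!: infsum_nonneg)
  ultimately show ?thesis
    using that[of ?M "inverse r"] r by auto
qed

lemma bound_imp_convergent2:
  assumes "\<And>i j. norm (F $ j $ i) \<le> M * C ^ (i + j)"
  shows "convergent2 F"
proof -
  have M: "M \<ge> 0" using order_trans[OF norm_ge_zero assms[of 0 0]] by simp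
  define E where "E = max \<bar>C\<bar> 1"
  have E: "E > 0" by (simp add: E_def)
  have absD: "norm (F $ j $ i) \<le> M * E ^ (i + j)" for i j
  proof -
    have "norm (F $ j $ i) \<le> M * C ^ (i + j)" by (rule assms)
    also have "\<dots> \<le> M * \<bar>C\<bar> ^ (i + j)"
      using M by (intro mult_left_mono) (metis abs_ge_self power_abs, simp)
    also have "\<dots> \<le> M * E ^ (i + j)"
      using M by (intro mult_left_mono power_mono) (auto simp: E_def)
    finally show ?thesis .
  qed
  define r where "r = 1 / (2 * E)"
  have r: "r > 0" using E by (simp add: r_def)
  have Er: "E * r = 1 / 2" using E by (simp add: r_def)
  have geo: "(\<lambda>i. (1 / 2 :: real) ^ i) summable_on UNIV"
    by (rule norm_summable_imp_summable_on) (simp add: summable_geometric)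
  have hs: "((\<lambda>i. (1 / 2 :: real) ^ i) has_sum infsum (\<lambda>i. (1 / 2 :: real) ^ i) UNIV) UNIV"
    using geo by (rule has_sum_infsum)
  have double: "(\<lambda>(i, j). (1 / 2 :: real) ^ i * (1 / 2) ^ j) summable_on UNIV \<times> UNIV"
  proof (rule summable_on_SigmaI)
    fix i :: nat
    show "((\<lambda>j. case (i, j) of (i, j) \<Rightarrow> (1 / 2 :: real) ^ i * (1 / 2) ^ j)
        has_sum (1 / 2) ^ i * infsum (\<lambda>i. (1 / 2 :: real) ^ i) UNIV) UNIV"
      unfolding prod.case by (rule has_sum_cmult_right[OF hs])
    show "(\<lambda>i. (1 / 2) ^ i * infsum (\<lambda>i. (1 / 2 :: real) ^ i) UNIV) summable_on UNIV"
      by (rule summable_on_cmult_left[OF geo])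
  qed simp
  have dom: "(\<lambda>p. M * (case p of (i, j) \<Rightarrow> (1 / 2 :: real) ^ i * (1 / 2) ^ j)) summable_on UNIV"
    using double unfolding UNIV_Times_UNIV by (rule summable_on_cmult_right)
  have "(\<lambda>(i, j). norm (F $ j $ i) * r ^ (i + j)) summable_on UNIV"
  proof (rule summable_on_comparison_test[OF dom])
    fix p :: "nat \<times> nat"
    obtain i j where p: "p = (i, j)" by (cases p)
    have "norm (F $ j $ i) * r ^ (i + j) \<le> M * E ^ (i + j) * r ^ (i + j)"
      using absD[of j i] r by (intro mult_right_mono) auto
    also have "\<dots> = M * (E * r) ^ (i + j)"
      by (simp only: power_mult_distrib mult.assoc)
    also have "\<dots> = M * ((1 / 2) ^ i * (1 / 2) ^ j)"
      by (simp only: Er power_add)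
    finally show "(case p of (i, j) \<Rightarrow> norm (F $ j $ i) * r ^ (i + j))
        \<le> M * (case p of (i, j) \<Rightarrow> (1 / 2) ^ i * (1 / 2) ^ j)"
      by (simp add: p)
    show "0 \<le> (case p of (i, j) \<Rightarrow> norm (F $ j $ i) * r ^ (i + j))"
      using r by (simp add: p)
  qed
  then show ?thesis
    using r unfolding convergent2_def by blast
qed

lemma convergent2_two_bounds:
  assumes "convergent2 F" "convergent2 G"
  obtains M C where "M \<ge> 0" "C \<ge> 1" "\<And>i j. norm (F $ j $ i) \<le> M * C ^ (i + j)"
    "\<And>i j. norm (G $ j $ i) \<le> M * C ^ (i + j)"
proof -
  obtain M1 C1 where 1: "M1 \<ge> 0" "C1 > 0" "\<And>i j. norm (F $ j $ i) \<le> M1 * C1 ^ (i + j)"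
    using convergent2_imp_bound[OF assms(1)] by metis
  obtain M2 C2 where 2: "M2 \<ge> 0" "C2 > 0" "\<And>i j. norm (G $ j $ i) \<le> M2 * C2 ^ (i + j)"
    using convergent2_imp_bound[OF assms(2)] by metis
  let ?M = "max M1 M2" and ?C = "max 1 (max C1 C2)"
  have "norm (F $ j $ i) \<le> ?M * ?C ^ (i + j)" for i j
    by (rule order_trans[OF 1(3)]) (use 1 in \<open>auto intro!: mult_mono power_mono\<close>)
  moreover have "norm (G $ j $ i) \<le> ?M * ?C ^ (i + j)" for i j
    by (rule order_trans[OF 2(3)]) (use 2 in \<open>auto intro!: mult_mono power_mono\<close>)
  ultimately show ?thesis
    using that[of ?M ?C] 1 by auto
qed

lemma convergent2_const: "convergent2 (fps_const (fps_const c))"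
  by (rule bound_imp_convergent2[where M = "norm c" and C = 1]) auto

lemma convergent2_add:
  assumes "convergent2 F" "convergent2 G"
  shows "convergent2 (F + G)"
proof -
  obtain M C where b: "M \<ge> 0" "C \<ge> 1" "\<And>i j. norm (F $ j $ i) \<le> M * C ^ (i + j)"
    "\<And>i j. norm (G $ j $ i) \<le> M * C ^ (i + j)"
    using convergent2_two_bounds[OF assms] by metis
  have "norm ((F + G) $ j $ i) \<le> (2 * M) * C ^ (i + j)" for i j
    using norm_triangle_ineq[of "F $ j $ i" "G $ j $ i"] b(3)[of j i] b(4)[of j i] by simp
  then show ?thesis by (rule bound_imp_convergent2)
qed

lemma convergent2_uminus: "convergent2 F \<Longrightarrow> convergent2 (- F)"
  unfolding convergent2_def by simp

lemma Suc_le_two_power: "real (Suc n) \<le> 2 ^ n"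
  by (induction n) auto

lemma convergent2_mult:
  assumes "convergent2 F" "convergent2 G"
  shows "convergent2 (F * G)"
proof -
  obtain M C where b: "M \<ge> 0" "C \<ge> 1" "\<And>i j. norm (F $ j $ i) \<le> M * C ^ (i + j)"
    "\<And>i j. norm (G $ j $ i) \<le> M * C ^ (i + j)"
    using convergent2_two_bounds[OF assms] by metis
  have "norm ((F * G) $ j $ i) \<le> M\<^sup>2 * (2 * C) ^ (i + j)" for i j
  proof -
    have "(F * G) $ j $ i = (\<Sum>l=0..j. \<Sum>k=0..i. F $ l $ k * G $ (j - l) $ (i - k))"
      by (simp add: fps_mult_nth fps_sum_nth)
    also have "norm \<dots> \<le> (\<Sum>l=0..j. \<Sum>k=0..i. M\<^sup>2 * C ^ (i + j))"
    proof (intro sum_norm_le)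
      fix l k assume lk: "l \<in> {0..j}" "k \<in> {0..i}"
      have "norm (F $ l $ k * G $ (j - l) $ (i - k))
          \<le> (M * C ^ (k + l)) * (M * C ^ (i - k + (j - l)))"
        unfolding norm_mult by (intro mult_mono b) (use b in auto)
      also have "\<dots> = M\<^sup>2 * C ^ (k + l + (i - k + (j - l)))"
        by (simp add: power_add power2_eq_square)
      also have "k + l + (i - k + (j - l)) = i + j" using lk by auto
      finally show "norm (F $ l $ k * G $ (j - l) $ (i - k)) \<le> M\<^sup>2 * C ^ (i + j)" .
    qed
    also have "\<dots> = M\<^sup>2 * C ^ (i + j) * (real (Suc i) * real (Suc j))"
      by simp
    also have "\<dots> \<le> M\<^sup>2 * C ^ (i + j) * (2 ^ i * 2 ^ j)"
      using b by (intro mult_left_mono mult_mono Suc_le_two_power) auto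
    also have "\<dots> = M\<^sup>2 * (2 * C) ^ (i + j)"
      by (simp add: power_mult_distrib power_add)
    finally show ?thesis .
  qed
  then show ?thesis by (rule bound_imp_convergent2)
qed

typedef conv_ps = "{F :: complex fps fps. convergent2 F}"
  using convergent2_const[of 0] by blast

setup_lifting type_definition_conv_ps

lift_definition ps_coeff :: "conv_ps \<Rightarrow> nat \<Rightarrow> nat \<Rightarrow> complex" is "\<lambda>F i j. F $ j $ i" .

lemma conv_ps_eqI: "(\<And>i j. ps_coeff f i j = ps_coeff g i j) \<Longrightarrow> f = g"
  by transfer (auto simp: fps_eq_iff)

instantiation conv_ps :: idom
begin

lift_definition zero_conv_ps :: conv_ps is 0
  using convergent2_const[of 0] by simp

lift_definition one_conv_ps :: conv_ps is 1
  using convergent2_const[of 1] by simp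

lift_definition plus_conv_ps :: "conv_ps \<Rightarrow> conv_ps \<Rightarrow> conv_ps" is "(+)"
  by (rule convergent2_add)

lift_definition uminus_conv_ps :: "conv_ps \<Rightarrow> conv_ps" is uminus
  by (rule convergent2_uminus)

lift_definition minus_conv_ps :: "conv_ps \<Rightarrow> conv_ps \<Rightarrow> conv_ps" is "(-)"
  by (metis convergent2_add convergent2_uminus diff_conv_add_uminus)

lift_definition times_conv_ps :: "conv_ps \<Rightarrow> conv_ps \<Rightarrow> conv_ps" is "(*)"
  by (rule convergent2_mult)

instance
  by standard (transfer; simp add: algebra_simps)+

end

text \<open>Division, which makes \<^const>\<open>coprime\<close> available, is exact division with junk values.\<close>

instantiation conv_ps :: idom_divide
begin

definition divide_conv_ps :: "conv_ps \<Rightarrow> conv_ps \<Rightarrow> conv_ps" where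
  "divide_conv_ps f g = (if g = 0 then 0 else SOME h. f = h * g)"

instance
proof
  fix f g :: conv_ps
  assume "g \<noteq> 0"
  then have "(SOME h. f * g = h * g) = f" by auto
  then show "f * g div g = f" using \<open>g \<noteq> 0\<close> by (simp add: divide_conv_ps_def)
qed (simp add: divide_conv_ps_def)

end

instance conv_ps :: algebraic_semidom ..

lift_definition ps_const :: "complex \<Rightarrow> conv_ps" is "\<lambda>c. fps_const (fps_const c)"
  by (rule convergent2_const)

lift_definition var_x :: conv_ps  ("\<^bold>x") is "fps_const fps_X"
  by (rule bound_imp_convergent2[where M = 1 and C = 1]) (auto simp: fps_X_def)

lift_definition var_y :: conv_ps  ("\<^bold>y") is "fps_X"
  by (rule bound_imp_convergent2[where M = 1 and C = 1]) (auto simp: fps_X_def)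

lemma convergent2_deriv_aux:
  assumes "convergent2 F"
    and "\<And>i j. norm (G $ j $ i) \<le> real (Suc (i + j)) * norm (F $ (b + j) $ (a + i))"
  shows "convergent2 G"
proof -
  obtain M C where b: "M \<ge> 0" "C > 0" "\<And>i j. norm (F $ j $ i) \<le> M * C ^ (i + j)"
    using convergent2_imp_bound[OF assms(1)] by metis
  have "norm (G $ j $ i) \<le> (M * C ^ (a + b)) * (2 * C) ^ (i + j)" for i j
  proof -
    have "norm (G $ j $ i) \<le> 2 ^ (i + j) * (M * C ^ ((a + i) + (b + j)))"
      by (rule order_trans[OF assms(2)]) (intro mult_mono Suc_le_two_power b(3); simp)
    then show ?thesis by (simp add: power_add power_mult_distrib algebra_simps)
  qed
  then show ?thesis by (rule bound_imp_convergent2)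
qed

lift_definition deriv_x :: "conv_ps \<Rightarrow> conv_ps" is "\<lambda>F. Abs_fps (\<lambda>j. fps_deriv (F $ j))"
  by (erule convergent2_deriv_aux[where a = 1 and b = 0])
     (auto simp: norm_mult simp del: of_nat_Suc intro!: mult_right_mono)

lift_definition deriv_y :: "conv_ps \<Rightarrow> conv_ps" is fps_deriv
proof -
  fix F :: "complex fps fps"
  assume F: "convergent2 F"
  have eq: "fps_deriv F $ j $ i = of_nat (Suc j) * F $ Suc j $ i" for i j
  proof -
    have "fps_deriv F $ j = fps_const (of_nat (Suc j)) * F $ Suc j"
      by (simp only: fps_deriv_nth fps_of_nat Suc_eq_plus1)
    then show ?thesis by (simp only: fps_mult_left_const_nth)
  qed
  show "convergent2 (fps_deriv F)"
  proof (rule convergent2_deriv_aux[where a = 0 and b = 1, OF F])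
    fix i j
    have "norm (fps_deriv F $ j $ i) = real (Suc j) * norm (F $ (1 + j) $ (0 + i))"
      unfolding eq norm_mult norm_of_nat by simp
    also have "\<dots> \<le> real (Suc (i + j)) * norm (F $ (1 + j) $ (0 + i))"
      by (rule mult_right_mono) auto
    finally show "norm (fps_deriv F $ j $ i) \<le> real (Suc (i + j)) * norm (F $ (1 + j) $ (0 + i))" .
  qed
qed


section \<open>Substitution and changes of coordinates\<close>

text \<open>
  If P and Q have no constant term then only the finitely many terms \<open>F\<^sub>i\<^sub>j P^i Q^j\<close> with
  \<open>i + j \<le> k + l\<close> contribute to the coefficient of x^k y^l in F(P, Q).
\<close>

definition subst2 :: "complex fps fps \<Rightarrow> complex fps fps \<Rightarrow> complex fps fps \<Rightarrow> complex fps fps" where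
  "subst2 F P Q = Abs_fps (\<lambda>l. Abs_fps (\<lambda>k.
     \<Sum>i\<le>k+l. \<Sum>j\<le>k+l. F $ j $ i * (P ^ i * Q ^ j) $ l $ k))"

definition pnorm1 :: "real \<Rightarrow> nat \<Rightarrow> complex fps \<Rightarrow> real" where
  "pnorm1 r K s = (\<Sum>k\<le>K. norm (s $ k) * r ^ k)"

definition pnorm2 :: "real \<Rightarrow> nat \<Rightarrow> complex fps fps \<Rightarrow> real" where
  "pnorm2 r K F = (\<Sum>l\<le>K. pnorm1 r K (F $ l) * r ^ l)"

lemma cauchy_product_le:
  fixes u v :: "nat \<Rightarrow> real"
  assumes "\<And>i. u i \<ge> 0" "\<And>i. v i \<ge> 0"
  shows "(\<Sum>k\<le>K. \<Sum>a=0..k. u a * v (k - a)) \<le> (\<Sum>a\<le>K. u a) * (\<Sum>b\<le>K. v b)"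
proof -
  have "(\<Sum>k\<le>K. \<Sum>a=0..k. u a * v (k - a)) = (\<Sum>(a, b)\<in>{(a, b). a + b \<le> K}. u a * v b)"
    unfolding atLeast0AtMost
    by (rule sum.triangle_reindex_eq[of "\<lambda>a b. u a * v b", symmetric])
  also have "\<dots> \<le> (\<Sum>(a, b) \<in> {..K} \<times> {..K}. u a * v b)"
  proof (rule sum_mono2)
    show "{(a, b). a + b \<le> K} \<subseteq> {..K} \<times> {..K}" by auto
    show "0 \<le> (case p of (a, b) \<Rightarrow> u a * v b)" for p
      using assms by (cases p) simp
  qed simp
  also have "\<dots> = (\<Sum>a\<le>K. u a) * (\<Sum>b\<le>K. v b)"
    unfolding sum_product by (rule sum.cartesian_product[symmetric])
  finally show ?thesis .
qed

lemma pnorm1_nonneg: "r \<ge> 0 \<Longrightarrow> pnorm1 r K s \<ge> 0"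
  unfolding pnorm1_def by (intro sum_nonneg) auto

lemma pnorm2_nonneg: "r \<ge> 0 \<Longrightarrow> pnorm2 r K F \<ge> 0"
  unfolding pnorm2_def by (intro sum_nonneg mult_nonneg_nonneg pnorm1_nonneg) auto

lemma pnorm1_sum:
  assumes "r \<ge> 0"
  shows "pnorm1 r K (sum f A) \<le> (\<Sum>x\<in>A. pnorm1 r K (f x))"
proof -
  have "pnorm1 r K (sum f A) \<le> (\<Sum>k\<le>K. \<Sum>x\<in>A. norm (f x $ k) * r ^ k)"
    unfolding pnorm1_def fps_sum_nth sum_distrib_right[symmetric]
    by (intro sum_mono mult_right_mono norm_sum) (use assms in auto)
  also have "\<dots> = (\<Sum>x\<in>A. pnorm1 r K (f x))"
    unfolding pnorm1_def by (rule sum.swap)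
  finally show ?thesis .
qed

lemma pnorm1_mult:
  assumes "r \<ge> 0"
  shows "pnorm1 r K (s * t) \<le> pnorm1 r K s * pnorm1 r K t"
proof -
  have "pnorm1 r K (s * t) \<le>
      (\<Sum>k\<le>K. \<Sum>a=0..k. (norm (s $ a) * r ^ a) * (norm (t $ (k - a)) * r ^ (k - a)))"
    unfolding pnorm1_def
  proof (rule sum_mono)
    fix k
    have "norm ((s * t) $ k) * r ^ k \<le> (\<Sum>a=0..k. norm (s $ a) * norm (t $ (k - a))) * r ^ k"
      unfolding fps_mult_nth
      by (intro mult_right_mono sum_norm_le) (use assms in \<open>auto simp: norm_mult\<close>)
    also have "\<dots> = (\<Sum>a=0..k. (norm (s $ a) * r ^ a) * (norm (t $ (k - a)) * r ^ (k - a)))"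
      unfolding sum_distrib_right
    proof (rule sum.cong)
      fix a assume "a \<in> {0..k}"
      then have "r ^ k = r ^ a * r ^ (k - a)" by (simp flip: power_add)
      then show "norm (s $ a) * norm (t $ (k - a)) * r ^ k =
          (norm (s $ a) * r ^ a) * (norm (t $ (k - a)) * r ^ (k - a))" by simp
    qed simp
    finally show "norm ((s * t) $ k) * r ^ k \<le> \<dots>" .
  qed
  also have "\<dots> \<le> pnorm1 r K s * pnorm1 r K t"
    unfolding pnorm1_def by (rule cauchy_product_le) (use assms in auto)
  finally show ?thesis .
qed

lemma pnorm2_mult:
  assumes "r \<ge> 0"
  shows "pnorm2 r K (F * G) \<le> pnorm2 r K F * pnorm2 r K G"
proof -
  have "pnorm2 r K (F * G) \<le>
      (\<Sum>k\<le>K. \<Sum>a=0..k. (pnorm1 r K (F $ a) * r ^ a) * (pnorm1 r K (G $ (k - a)) * r ^ (k - a)))"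
    unfolding pnorm2_def
  proof (rule sum_mono)
    fix k
    have "pnorm1 r K ((F * G) $ k) * r ^ k
        \<le> (\<Sum>a=0..k. pnorm1 r K (F $ a) * pnorm1 r K (G $ (k - a))) * r ^ k"
      unfolding fps_mult_nth
      by (intro mult_right_mono order_trans[OF pnorm1_sum] sum_mono pnorm1_mult)
         (use assms in auto)
    also have "\<dots> = (\<Sum>a=0..k. (pnorm1 r K (F $ a) * r ^ a) *
        (pnorm1 r K (G $ (k - a)) * r ^ (k - a)))"
      unfolding sum_distrib_right
    proof (rule sum.cong)
      fix a assume "a \<in> {0..k}"
      then have "r ^ k = r ^ a * r ^ (k - a)" by (simp flip: power_add)
      then show "pnorm1 r K (F $ a) * pnorm1 r K (G $ (k - a)) * r ^ k =
          (pnorm1 r K (F $ a) * r ^ a) * (pnorm1 r K (G $ (k - a)) * r ^ (k - a))" by simp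
    qed simp
    finally show "pnorm1 r K ((F * G) $ k) * r ^ k \<le> \<dots>" .
  qed
  also have "\<dots> \<le> pnorm2 r K F * pnorm2 r K G"
    unfolding pnorm2_def
    by (rule cauchy_product_le) (use assms in \<open>auto intro!: mult_nonneg_nonneg pnorm1_nonneg\<close>)
  finally show ?thesis .
qed

lemma pnorm2_one: "pnorm2 r K 1 = 1"
proof -
  have "pnorm1 r K 1 = 1" "pnorm1 r K 0 = 0"
    unfolding pnorm1_def by (auto simp: if_distrib if_distribR cong: if_cong)
  then show ?thesis
    unfolding pnorm2_def by (simp add: if_distrib if_distribR cong: if_cong)
qed

lemma pnorm2_power:
  assumes "r \<ge> 0"
  shows "pnorm2 r K (F ^ n) \<le> pnorm2 r K F ^ n"
proof (induction n)
  case (Suc n)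
  have "pnorm2 r K (F ^ Suc n) \<le> pnorm2 r K F * pnorm2 r K (F ^ n)"
    using pnorm2_mult[OF assms] by simp
  also have "\<dots> \<le> pnorm2 r K F * pnorm2 r K F ^ n"
    by (intro mult_left_mono Suc pnorm2_nonneg assms)
  finally show ?case by simp
qed (simp add: pnorm2_one)

lemma pnorm2_altdef: "pnorm2 r K F = (\<Sum>l\<le>K. \<Sum>k\<le>K. norm (F $ l $ k) * r ^ (k + l))"
  unfolding pnorm2_def pnorm1_def by (simp only: sum_distrib_right power_add mult.assoc)

lemma pnorm2_coeff:
  assumes "r \<ge> 0" "k \<le> K" "l \<le> K"
  shows "norm (F $ l $ k) * r ^ (k + l) \<le> pnorm2 r K F"
proof -
  have "norm (F $ l $ k) * r ^ (k + l) \<le> (\<Sum>k\<le>K. norm (F $ l $ k) * r ^ (k + l))"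
    by (rule member_le_sum[where f = "\<lambda>k. norm (F $ l $ k) * r ^ (k + l)"]) (use assms in auto)
  also have "\<dots> \<le> pnorm2 r K F"
    unfolding pnorm2_altdef
    by (rule member_le_sum[where f = "\<lambda>l. \<Sum>k\<le>K. norm (F $ l $ k) * r ^ (k + l)"])
       (use assms in \<open>auto intro!: sum_nonneg\<close>)
  finally show ?thesis .
qed

lemma pnorm2_bounded:
  assumes "convergent2 F"
  obtains r B where "r > 0" "B \<ge> 0" "\<And>K. pnorm2 r K F \<le> B"
proof -
  obtain r :: real where r: "r > 0"
    and s: "(\<lambda>(i, j). norm (F $ j $ i) * r ^ (i + j)) summable_on UNIV"
    using assms unfolding convergent2_def by blast
  let ?M = "infsum (\<lambda>(i, j). norm (F $ j $ i) * r ^ (i + j)) UNIV"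
  have "pnorm2 r K F \<le> ?M" for K
  proof -
    have "pnorm2 r K F = (\<Sum>k\<le>K. \<Sum>l\<le>K. norm (F $ l $ k) * r ^ (k + l))"
      unfolding pnorm2_altdef by (rule sum.swap)
    also have "\<dots> = (\<Sum>(k, l) \<in> {..K} \<times> {..K}. norm (F $ l $ k) * r ^ (k + l))"
      by (rule sum.cartesian_product)
    also have "\<dots> \<le> ?M"
      by (rule finite_sum_le_infsum[OF s]) (use r in auto)
    finally show ?thesis .
  qed
  moreover have "?M \<ge> 0" using r by (auto intro!: infsum_nonneg)
  ultimately show ?thesis using that r by blast
qed

lemma pnorm2_small:
  assumes "F $ 0 $ 0 = 0" "0 \<le> t" "t \<le> 1" "r \<ge> 0"
  shows "pnorm2 (t * r) K F \<le> t * pnorm2 r K F"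
  unfolding pnorm2_altdef sum_distrib_left
proof (intro sum_mono)
  fix l k
  show "norm (F $ l $ k) * (t * r) ^ (k + l) \<le> t * (norm (F $ l $ k) * r ^ (k + l))"
  proof (cases "k + l = 0")
    case True
    then show ?thesis using assms by simp
  next
    case False
    then have "t ^ (k + l) \<le> t ^ 1"
      using assms by (intro power_decreasing) auto
    then have "norm (F $ l $ k) * r ^ (k + l) * t ^ (k + l) \<le> norm (F $ l $ k) * r ^ (k + l) * t"
      using assms by (intro mult_left_mono) auto
    then show ?thesis by (simp add: power_mult_distrib mult_ac)
  qed
qed

lemma pnorm2_mono: "0 \<le> r \<Longrightarrow> r \<le> s \<Longrightarrow> pnorm2 r K F \<le> pnorm2 s K F"
  unfolding pnorm2_altdef by (intro sum_mono mult_left_mono power_mono) auto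

lemma convergent2_subst2:
  assumes "convergent2 F" "convergent2 P" "convergent2 Q" "P $ 0 $ 0 = 0" "Q $ 0 $ 0 = 0"
  shows "convergent2 (subst2 F P Q)"
proof -
  obtain M C where F: "M \<ge> 0" "C > 0" "\<And>i j. norm (F $ j $ i) \<le> M * C ^ (i + j)"
    using convergent2_imp_bound[OF assms(1)] by metis
  obtain r1 B1 where P: "r1 > 0" "B1 \<ge> 0" "\<And>K. pnorm2 r1 K P \<le> B1"
    using pnorm2_bounded[OF assms(2)] by metis
  obtain r2 B2 where Q: "r2 > 0" "B2 \<ge> 0" "\<And>K. pnorm2 r2 K Q \<le> B2"
    using pnorm2_bounded[OF assms(3)] by metis
  define r where "r = min r1 r2"
  define B where "B = 1 + max B1 B2"
  define t where "t = min 1 (1 / (2 * C * B))"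
  have r: "r > 0" "r \<le> r1" "r \<le> r2" and B: "B > 0" "B1 \<le> B" "B2 \<le> B"
    using P Q by (auto simp: r_def B_def)
  have t: "t > 0" "t \<le> 1" using F B by (auto simp: t_def)
  have tB: "t * B \<le> 1 / (2 * C)"
  proof -
    have "t * B \<le> 1 / (2 * C * B) * B"
      using B by (intro mult_right_mono) (auto simp: t_def)
    also have "\<dots> = 1 / (2 * C)" using B by simp
    finally show ?thesis .
  qed
  have small: "pnorm2 (t * r) K G \<le> 1 / (2 * C)"
    if "G $ 0 $ 0 = 0" "\<And>K. pnorm2 r' K G \<le> B'" "r \<le> r'" "B' \<le> B" for G r' B' K
  proof -
    have "pnorm2 (t * r) K G \<le> t * pnorm2 r K G"
      by (rule pnorm2_small) (use that t r in auto)
    also have "pnorm2 r K G \<le> pnorm2 r' K G"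
      using r that by (intro pnorm2_mono) auto
    also have "pnorm2 r' K G \<le> B" using that(2)[of K] that(4) by linarith
    finally show ?thesis using tB t by (simp add: mult_left_mono)
  qed
  define \<rho> where "\<rho> = t * r"
  have \<rho>: "\<rho> > 0" using t r by (simp add: \<rho>_def)
  have geo: "(\<Sum>i\<le>N. (1 / 2 :: real) ^ i) \<le> 2" for N
  proof -
    have "(\<Sum>i\<le>N. (1 / 2 :: real) ^ i) = 2 - (1 / 2) ^ N"
      by (induction N) auto
    then show ?thesis by simp
  qed
  have bnd: "norm (subst2 F P Q $ l $ k) \<le> (4 * M) * (inverse \<rho>) ^ (k + l)" for k l
  proof -
    define K where "K = k + l"
    have tm: "norm (F $ j $ i * (P ^ i * Q ^ j) $ l $ k) * \<rho> ^ (k + l)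
        \<le> M * ((1 / 2) ^ i * (1 / 2) ^ j)" for i j
    proof -
      have "norm ((P ^ i * Q ^ j) $ l $ k) * \<rho> ^ (k + l) \<le> pnorm2 \<rho> K (P ^ i * Q ^ j)"
        using \<rho> by (intro pnorm2_coeff) (simp_all add: K_def)
      also have "\<dots> \<le> pnorm2 \<rho> K (P ^ i) * pnorm2 \<rho> K (Q ^ j)"
        using \<rho> by (intro pnorm2_mult) auto
      also have "\<dots> \<le> pnorm2 \<rho> K P ^ i * pnorm2 \<rho> K Q ^ j"
        using \<rho> by (intro mult_mono pnorm2_power pnorm2_nonneg zero_le_power) auto
      also have "\<dots> \<le> (1 / (2 * C)) ^ i * (1 / (2 * C)) ^ j"
        unfolding \<rho>_def
        by (intro mult_mono power_mono small[OF assms(4) P(3)] small[OF assms(5) Q(3)]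
              pnorm2_nonneg zero_le_power) (use r B t F in auto)
      finally have 1: "norm ((P ^ i * Q ^ j) $ l $ k) * \<rho> ^ (k + l)
          \<le> (1 / (2 * C)) ^ i * (1 / (2 * C)) ^ j" .
      have "norm (F $ j $ i * (P ^ i * Q ^ j) $ l $ k) * \<rho> ^ (k + l)
          = norm (F $ j $ i) * (norm ((P ^ i * Q ^ j) $ l $ k) * \<rho> ^ (k + l))"
        by (simp add: norm_mult)
      also have "\<dots> \<le> (M * C ^ (i + j)) * ((1 / (2 * C)) ^ i * (1 / (2 * C)) ^ j)"
        by (rule mult_mono[OF F(3) 1]) (use F \<rho> in auto)
      also have "\<dots> = M * ((1 / 2) ^ i * (1 / 2) ^ j)"
        using F by (simp add: power_add power_divide power_mult_distrib)
      finally show ?thesis .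
    qed
    have "norm (subst2 F P Q $ l $ k) * \<rho> ^ (k + l)
        \<le> (\<Sum>i\<le>k+l. \<Sum>j\<le>k+l. norm (F $ j $ i * (P ^ i * Q ^ j) $ l $ k)) * \<rho> ^ (k + l)"
      unfolding subst2_def fps_nth_Abs_fps
    proof (rule mult_right_mono)
      show "norm (\<Sum>i\<le>k+l. \<Sum>j\<le>k+l. F $ j $ i * (P ^ i * Q ^ j) $ l $ k)
          \<le> (\<Sum>i\<le>k+l. \<Sum>j\<le>k+l. norm (F $ j $ i * (P ^ i * Q ^ j) $ l $ k))"
        by (intro sum_norm_le order_refl)
    qed (use \<rho> in simp)
    also have "\<dots> \<le> (\<Sum>i\<le>k+l. \<Sum>j\<le>k+l. M * ((1 / 2) ^ i * (1 / 2) ^ j))"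
      unfolding sum_distrib_right by (intro sum_mono tm)
    also have "\<dots> = M * ((\<Sum>i\<le>k+l. (1 / 2) ^ i) * (\<Sum>j\<le>k+l. (1 / 2) ^ j))"
      unfolding sum_product by (subst sum_distrib_left, subst sum_distrib_left) (rule refl)
    also have "\<dots> \<le> M * (2 * 2)"
      using F by (intro mult_left_mono mult_mono geo sum_nonneg) auto
    finally show ?thesis using \<rho> by (simp add: field_simps)
  qed
  then show ?thesis by (rule bound_imp_convergent2)
qed

text \<open>The substitution f(p, q), for p and q without constant term; otherwise the value is junk.\<close>

lift_definition subst :: "conv_ps \<Rightarrow> conv_ps \<Rightarrow> conv_ps \<Rightarrow> conv_ps" is
  "\<lambda>F P Q. if P $ 0 $ 0 = 0 \<and> Q $ 0 $ 0 = 0 then subst2 F P Q else 0"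
  using convergent2_subst2 convergent2_const[of 0] by auto

definition coord_change :: "conv_ps \<Rightarrow> conv_ps \<Rightarrow> bool" where
  "coord_change p q \<longleftrightarrow> ps_coeff p 0 0 = 0 \<and> ps_coeff q 0 0 = 0 \<and>
     (\<exists>p' q'. ps_coeff p' 0 0 = 0 \<and> ps_coeff q' 0 0 = 0 \<and>
        subst p p' q' = \<^bold>x \<and> subst q p' q' = \<^bold>y \<and> subst p' p q = \<^bold>x \<and> subst q' p q = \<^bold>y)"

definition analytically_equivalent :: "conv_ps \<Rightarrow> conv_ps \<Rightarrow> bool" where
  "analytically_equivalent f f' \<longleftrightarrow>
     (\<exists>p q u. coord_change p q \<and> u dvd 1 \<and> f' = u * subst f p q)"


section \<open>Multiplicity, tangent cone, parametrizations, value semigroup\<close>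

definition multiplicity0 :: "conv_ps \<Rightarrow> enat" where
  "multiplicity0 f = Inf {enat (i + j) | i j. ps_coeff f i j \<noteq> 0}"

text \<open>The zero set of the initial form; it is the tangent line if f is irreducible.\<close>

definition tangent_cone :: "conv_ps \<Rightarrow> (complex \<times> complex) set" where
  "tangent_cone f = {(a, b).
     (\<Sum>(i, j) | enat (i + j) = multiplicity0 f. ps_coeff f i j * a ^ i * b ^ j) = 0}"

text \<open>
  The pullback f(a(t), b(t)), for a and b without constant term; as in \<^const>\<open>subst2\<close>, only finitely
  many terms contribute to each coefficient.
\<close>

definition pullback :: "conv_ps \<Rightarrow> complex fps \<Rightarrow> complex fps \<Rightarrow> complex fps" where
  "pullback f a b = Abs_fps (\<lambda>k. \<Sum>i\<le>k. \<Sum>j\<le>k. ps_coeff f i j * (a ^ i * b ^ j) $ k)"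

abbreviation convergent1 :: "complex fps \<Rightarrow> bool" where
  "convergent1 a \<equiv> fps_conv_radius a > 0"

text \<open>Primitive: not obtained from another parametrization by a substitution of order at least 2.\<close>

definition primitive_parametrization :: "conv_ps \<Rightarrow> complex fps \<Rightarrow> complex fps \<Rightarrow> bool" where
  "primitive_parametrization g a b \<longleftrightarrow>
     convergent1 a \<and> convergent1 b \<and> a $ 0 = 0 \<and> b $ 0 = 0 \<and> (a, b) \<noteq> (0, 0) \<and>
     pullback g a b = 0 \<and>
     \<not> (\<exists>a' b' s. convergent1 a' \<and> convergent1 b' \<and> convergent1 s \<and> subdegree s \<ge> 2 \<and>
          a = a' oo s \<and> b = b' oo s)"

text \<open>
  For irreducible g the primitive parametrization is unique up to reparametrization, so the union
  over all of them is the set of orders along any one.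
\<close>

definition value_semigroup :: "conv_ps \<Rightarrow> nat set" where
  "value_semigroup g =
     {subdegree (pullback h a b) | h a b. primitive_parametrization g a b \<and> \<not> g dvd h}"


section \<open>Ideals and their codimension\<close>

text \<open>
  The module locale is not interpreted for multiplication, as this would add
  \<open>a * (b * c) = (a * b) * c\<close> to the simpset.
\<close>

lemma module_conv_ps: "module ((*) :: conv_ps \<Rightarrow> conv_ps \<Rightarrow> conv_ps)"
  by unfold_locales (simp_all add: algebra_simps)

definition ideal_generated :: "conv_ps set \<Rightarrow> conv_ps set" where
  "ideal_generated A = module.span (*) A"

text \<open>The classes of the elements of B form a (finite) basis of the complex vector space C{x,y}/J.\<close>

definition quotient_basis :: "conv_ps set \<Rightarrow> conv_ps set \<Rightarrow> bool" where
  "quotient_basis J B \<longleftrightarrow> finite B \<and>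
     (\<forall>h. \<exists>!c. c \<in> B \<rightarrow>\<^sub>E UNIV \<and> h - (\<Sum>b\<in>B. ps_const (c b) * b) \<in> J)"

definition codim :: "conv_ps set \<Rightarrow> enat" where
  "codim J = (if \<exists>B. quotient_basis J B then enat (card (SOME B. quotient_basis J B)) else \<infinity>)"

definition intersection_mult :: "conv_ps \<Rightarrow> conv_ps \<Rightarrow> enat" where
  "intersection_mult p q = codim (ideal_generated {p, q})"

definition tjurina :: "conv_ps \<Rightarrow> enat" where
  "tjurina f = codim (ideal_generated {f, deriv_x f, deriv_y f})"

definition milnor :: "conv_ps \<Rightarrow> enat" where
  "milnor f = codim (ideal_generated {deriv_x f, deriv_y f})"


section \<open>Differential forms and the Saito module\<close>

text \<open>The pair (a, b) represents the form a dx + b dy.\<close>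

type_synonym form = "conv_ps \<times> conv_ps"

definition form_scale :: "conv_ps \<Rightarrow> form \<Rightarrow> form" where
  "form_scale g \<omega> = (g * fst \<omega>, g * snd \<omega>)"

global_interpretation forms: module form_scale
  by unfold_locales (simp_all add: form_scale_def prod_eq_iff distrib_left distrib_right mult.assoc)

definition dform :: "conv_ps \<Rightarrow> form" where
  "dform f = (deriv_x f, deriv_y f)"

definition F_module :: "conv_ps \<Rightarrow> form set" where
  "F_module f = {form_scale p (dform f) + form_scale f \<eta> | p \<eta>. True}"

definition saito_module :: "conv_ps \<Rightarrow> form set" where
  "saito_module f = {\<omega>. \<exists>g. coprime g f \<and> form_scale g \<omega> \<in> F_module f}"

definition saito_basis :: "conv_ps \<Rightarrow> form \<Rightarrow> form \<Rightarrow> bool" where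
  "saito_basis f \<omega>\<^sub>1 \<omega>\<^sub>2 \<longleftrightarrow> \<omega>\<^sub>1 \<noteq> \<omega>\<^sub>2 \<and> forms.independent {\<omega>\<^sub>1, \<omega>\<^sub>2} \<and>
     forms.span {\<omega>\<^sub>1, \<omega>\<^sub>2} = saito_module f"

end

(*
  Straightening the smooth branch to y = 0 and the double branch to (y - \<alpha>(x))^2 = \<delta>(x) uses only
  the inverse function theorem: the critical point of g in y is an implicit function, and a square
  root of a unit turns g into y^2 + g_0(x) (Morse lemma with parameter x). Irreducibility makes
  ord \<delta> odd, and the intersection number is ord(\<alpha>^2 - \<delta>); as it is the odd number n, ord \<delta> = n and
  \<alpha> = 0 or k = ord \<alpha> > n/2. Rescaling x and y by units in x alone normalizes \<alpha> to x^k and \<delta> to x^n. The term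
  x^k can be removed for k >= n - 1, by explicit coordinate changes; with k = (n + 2m - 1)/2 the
  others give (ii).

  A form \<omega> belongs to the Saito module of f = yG iff f divides \<omega> \<and> df, since y and G are prime;
  this gives Saito's criterion by Cramer's rule. For the Tjurina and Milnor numbers, f_y is
  up to a unit a Weierstrass polynomial of degree 2 in y, and the ideals are described by
  conditions on the remainders of the division by it.
*)

theory Submission
  imports Defs
begin

section \<open>Coefficients and the order of a series\<close>

text \<open>Apart from simple coefficient bounds, convergence is estimated in the proof only for the
  inverse function theorem. Inverses and roots of units, implicit functions and division by a
  quadratic polynomial then come from substitution into known series; identities between
  substitutions are checked on monomials and extended by density. The parameter s of the cusp x =
  s^2, y = s^n is the variable x of the same ring, so restriction to a branch is an ordinary
  substitution and primality of the branch equation follows from that of 0. For the curve F with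
  \<alpha> = x^k, Euler's relation with weights 2 and n has an error term, a nonzero constant times
  x^k y (y - x^k). It explains the second form of the Saito basis, and it replaces F as a generator
  of the Tjurina ideal. That ideal is not cut out by divisibility of the two coefficients of the
  remainder alone: one linear relation between leading coefficients remains, which is the last
  summand in (n - 1) + (n + k - 1) + 1 = 2n + k - 1.\<close>

lemma ps_coeff_zero [simp]: "ps_coeff 0 i j = 0"
  by transfer simp

lemma ps_coeff_one: "ps_coeff 1 i j = (if i = 0 \<and> j = 0 then 1 else 0)"
  by transfer simp

lemma ps_coeff_add [simp]: "ps_coeff (f + g) i j = ps_coeff f i j + ps_coeff g i j"
  by transfer simp

lemma ps_coeff_diff [simp]: "ps_coeff (f - g) i j = ps_coeff f i j - ps_coeff g i j"
  by transfer simp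

lemma ps_coeff_uminus [simp]: "ps_coeff (- f) i j = - ps_coeff f i j"
  by transfer simp

lemma ps_coeff_sum [simp]: "ps_coeff (sum F A) i j = (\<Sum>a\<in>A. ps_coeff (F a) i j)"
  by (induction A rule: infinite_finite_induct) auto

lemma ps_coeff_mult:
  "ps_coeff (f * g) i j = (\<Sum>l=0..j. \<Sum>k=0..i. ps_coeff f k l * ps_coeff g (i - k) (j - l))"
  by transfer (simp add: fps_mult_nth fps_sum_nth)

lemma ps_coeff_const: "ps_coeff (ps_const c) i j = (if i = 0 \<and> j = 0 then c else 0)"
  by transfer simp

lemma ps_coeff_x: "ps_coeff \<^bold>x i j = (if i = 1 \<and> j = 0 then 1 else 0)"
  by transfer (simp add: fps_X_def)

lemma ps_coeff_y: "ps_coeff \<^bold>y i j = (if i = 0 \<and> j = 1 then 1 else 0)"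
  by transfer (simp add: fps_X_def)

lemma ps_coeff_const_mult [simp]: "ps_coeff (ps_const c * f) i j = c * ps_coeff f i j"
  by transfer simp

lemma ps_coeff_x_mult: "ps_coeff (\<^bold>x * f) i j = (if i = 0 then 0 else ps_coeff f (i - 1) j)"
  by transfer simp

lemma ps_coeff_y_mult: "ps_coeff (\<^bold>y * f) i j = (if j = 0 then 0 else ps_coeff f i (j - 1))"
  by transfer simp

lemma ps_coeff_x_power_mult:
  "ps_coeff (\<^bold>x ^ n * f) i j = (if i < n then 0 else ps_coeff f (i - n) j)"
  by (induction n arbitrary: i) (auto simp: ps_coeff_x_mult mult.assoc)

lemma ps_coeff_y_power_mult:
  "ps_coeff (\<^bold>y ^ n * f) i j = (if j < n then 0 else ps_coeff f i (j - n))"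
  by (induction n arbitrary: j) (auto simp: ps_coeff_y_mult mult.assoc)

lemma ps_coeff_x_power: "ps_coeff (\<^bold>x ^ n) i j = (if i = n \<and> j = 0 then 1 else 0)"
  using ps_coeff_x_power_mult[of n 1 i j] by (auto simp: ps_coeff_one)

lemma ps_coeff_mult_0_0 [simp]: "ps_coeff (f * g) 0 0 = ps_coeff f 0 0 * ps_coeff g 0 0"
  by (simp add: ps_coeff_mult)

lemma ps_coeff_power_0_0 [simp]: "ps_coeff (f ^ n) 0 0 = ps_coeff f 0 0 ^ n"
  by (induction n) (simp_all add: ps_coeff_one)

lemma ps_const_add: "ps_const (a + b) = ps_const a + ps_const b"
  by (rule conv_ps_eqI) (simp add: ps_coeff_const)

lemma ps_const_mult: "ps_const (a * b) = ps_const a * ps_const b"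
  by (rule conv_ps_eqI) (simp add: ps_coeff_const)

lemma ps_const_0 [simp]: "ps_const 0 = 0"
  by (rule conv_ps_eqI) (simp add: ps_coeff_const)

lemma ps_const_1 [simp]: "ps_const 1 = 1"
  by (rule conv_ps_eqI) (simp add: ps_coeff_const ps_coeff_one)

lemma ps_const_uminus: "ps_const (- a) = - ps_const a"
  by (rule conv_ps_eqI) (simp add: ps_coeff_const)

lemma ps_const_diff: "ps_const (a - b) = ps_const a - ps_const b"
  by (rule conv_ps_eqI) (simp add: ps_coeff_const)

lemma ps_const_of_nat: "ps_const (of_nat n) = of_nat n"
  by (induction n) (simp_all add: ps_const_add)

lemma ps_const_numeral: "ps_const (numeral n) = numeral n"
  using ps_const_of_nat[of "numeral n"] by simp

lemma ps_coeff_of_nat: "ps_coeff (of_nat n) i j = (if i = 0 \<and> j = 0 then of_nat n else 0)"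
  by (simp flip: ps_const_of_nat add: ps_coeff_const)

lemma ps_coeff_numeral: "ps_coeff (numeral n) i j = (if i = 0 \<and> j = 0 then numeral n else 0)"
  by (simp flip: ps_const_numeral add: ps_coeff_const)

lemma ps_coeff_of_nat_mult [simp]: "ps_coeff (of_nat n * f) i j = of_nat n * ps_coeff f i j"
  by (simp flip: ps_const_of_nat)

lemma ps_coeff_numeral_mult [simp]: "ps_coeff (numeral n * f) i j = numeral n * ps_coeff f i j"
  by (simp flip: ps_const_numeral)

lemma ps_coeff_monomial:
  "ps_coeff (ps_const c * \<^bold>x ^ a * \<^bold>y ^ b) i j = (if i = a \<and> j = b then c else 0)"
proof -
  have "ps_const c * \<^bold>x ^ a * \<^bold>y ^ b = ps_const c * (\<^bold>x ^ a * (\<^bold>y ^ b * 1))"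
    by (simp add: mult.assoc)
  then show ?thesis
    by (auto simp only: ps_coeff_const_mult ps_coeff_x_power_mult ps_coeff_y_power_mult ps_coeff_one)
       auto
qed

section \<open>Division by a variable and restriction to y = 0\<close>

lift_definition shift_x :: "conv_ps \<Rightarrow> conv_ps" is "\<lambda>F. Abs_fps (\<lambda>j. fps_shift 1 (F $ j))"
  by (erule convergent2_deriv_aux[where a = 1 and b = 0]) (simp add: mult_le_cancel_right1)

lift_definition shift_y :: "conv_ps \<Rightarrow> conv_ps" is "fps_shift 1"
  by (erule convergent2_deriv_aux[where a = 0 and b = 1]) (simp add: mult_le_cancel_right1)

lift_definition restrict_x :: "conv_ps \<Rightarrow> conv_ps" is "\<lambda>F. fps_const (F $ 0)"
  by (erule convergent2_deriv_aux[where a = 0 and b = 0]) (simp add: mult_le_cancel_right1)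

lemma ps_coeff_shift_x [simp]: "ps_coeff (shift_x f) i j = ps_coeff f (Suc i) j"
  by transfer simp

lemma ps_coeff_shift_y [simp]: "ps_coeff (shift_y f) i j = ps_coeff f i (Suc j)"
  by transfer simp

lemma ps_coeff_restrict_x [simp]: "ps_coeff (restrict_x f) i j = (if j = 0 then ps_coeff f i 0 else 0)"
  by transfer simp

lemma restrict_x_plus_shift_y: "f = restrict_x f + \<^bold>y * shift_y f"
  by (rule conv_ps_eqI) (auto simp: ps_coeff_y_mult)

lemma y_dvd_iff: "\<^bold>y dvd f \<longleftrightarrow> (\<forall>i. ps_coeff f i 0 = 0)"
proof
  assume "\<forall>i. ps_coeff f i 0 = 0"
  then have "f = \<^bold>y * shift_y f"
    by (intro conv_ps_eqI) (auto simp: ps_coeff_y_mult)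
  then show "\<^bold>y dvd f" by (rule dvdI)
qed (auto simp: dvd_def ps_coeff_y_mult)

lemma x_power_dvd_iff: "\<^bold>x ^ n dvd f \<longleftrightarrow> (\<forall>i j. i < n \<longrightarrow> ps_coeff f i j = 0)"
proof
  assume "\<forall>i j. i < n \<longrightarrow> ps_coeff f i j = 0"
  then show "\<^bold>x ^ n dvd f"
  proof (induction n arbitrary: f)
    case (Suc n)
    have "f = \<^bold>x * shift_x f"
      using Suc.prems by (intro conv_ps_eqI) (auto simp: ps_coeff_x_mult)
    moreover have "\<^bold>x ^ n dvd shift_x f"
      using Suc.prems by (intro Suc.IH) auto
    ultimately show ?case
      by (metis mult_dvd_mono dvd_refl power_Suc)
  qed simp
qed (auto simp: dvd_def ps_coeff_x_power_mult)

lemma x_neq_0 [simp]: "\<^bold>x \<noteq> 0"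
  by (metis ps_coeff_x ps_coeff_zero zero_neq_one)

lemma y_neq_0 [simp]: "\<^bold>y \<noteq> 0"
  by (metis ps_coeff_y ps_coeff_zero zero_neq_one)

text \<open>Membership in the N-th power of the maximal ideal. The inequality form lets the zero
  series have every order, and makes continuity statements a matter of vanishing
  coefficients.\<close>

definition ord_ge :: "nat \<Rightarrow> conv_ps \<Rightarrow> bool" where
  "ord_ge N f \<longleftrightarrow> (\<forall>i j. i + j < N \<longrightarrow> ps_coeff f i j = 0)"

lemma if_mult_zero: "(if P then c else 0) * d = (if P then c * d else (0 :: 'a :: mult_zero))"
  "d * (if P then c else 0) = (if P then d * c else (0 :: 'a :: mult_zero))"
  by simp_all

lemma ord_ge_0 [simp]: "ord_ge 0 f"
  by (simp add: ord_ge_def)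

lemma ord_ge_1_iff: "ord_ge 1 f \<longleftrightarrow> ps_coeff f 0 0 = 0"
  by (simp add: ord_ge_def)

lemma ord_ge_zero [simp]: "ord_ge N 0"
  by (simp add: ord_ge_def)

lemma ord_ge_mono: "ord_ge N f \<Longrightarrow> M \<le> N \<Longrightarrow> ord_ge M f"
  by (auto simp: ord_ge_def)

lemma ord_ge_add: "ord_ge N f \<Longrightarrow> ord_ge N g \<Longrightarrow> ord_ge N (f + g)"
  by (simp add: ord_ge_def)

lemma ord_ge_uminus: "ord_ge N f \<Longrightarrow> ord_ge N (- f)"
  by (simp add: ord_ge_def)

lemma ord_ge_diff: "ord_ge N f \<Longrightarrow> ord_ge N g \<Longrightarrow> ord_ge N (f - g)"
  by (simp add: ord_ge_def)

lemma ord_ge_mult: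
  assumes "ord_ge N f" "ord_ge M g"
  shows "ord_ge (N + M) (f * g)"
  unfolding ord_ge_def
proof (intro allI impI)
  fix i j assume ij: "i + j < N + M"
  show "ps_coeff (f * g) i j = 0"
    unfolding ps_coeff_mult
  proof (intro sum.neutral ballI)
    fix l k assume "l \<in> {0..j}" "k \<in> {0..i}"
    then have "k + l < N \<or> (i - k) + (j - l) < M" using ij by auto
    then show "ps_coeff f k l * ps_coeff g (i - k) (j - l) = 0"
      using assms unfolding ord_ge_def by auto
  qed
qed

lemma ord_ge_mult_left: "ord_ge N f \<Longrightarrow> ord_ge N (g * f)"
  using ord_ge_mult[of 0 g N f] by simp

lemma ord_ge_power:
  assumes "ord_ge 1 f"
  shows "ord_ge n (f ^ n)"
proof (induction n)
  case (Suc n)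
  then show ?case using ord_ge_mult[OF assms Suc.IH] by simp
qed simp

lemma ord_ge_imp_zero: "(\<And>N. ord_ge N f) \<Longrightarrow> f = 0"
  unfolding ord_ge_def by (intro conv_ps_eqI) (metis lessI ps_coeff_zero)

lemma eq_polynomial_plus_ord_ge:
  obtains r where "f = (\<Sum>i<N. \<Sum>j<N. ps_const (ps_coeff f i j) * \<^bold>x ^ i * \<^bold>y ^ j) + r" "ord_ge N r"
proof
  define s where "s = (\<Sum>i<N. \<Sum>j<N. ps_const (ps_coeff f i j) * \<^bold>x ^ i * \<^bold>y ^ j)"
  show "f = s + (f - s)" by simp
  have "ps_coeff s i j = (\<Sum>a<N. if i = a then (\<Sum>b<N. if j = b then ps_coeff f a b else 0) else 0)" for i j
    unfolding s_def ps_coeff_sum ps_coeff_monomial by (intro sum.cong) auto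
  then have "ps_coeff s i j = (if i < N \<and> j < N then ps_coeff f i j else 0)" for i j
    by simp
  then show "ord_ge N (f - s)" by (simp add: ord_ge_def)
qed

text \<open>Polynomials are dense for the topology of the maximal ideal.\<close>

lemma additive_eq_zeroI:
  fixes D :: "conv_ps \<Rightarrow> conv_ps"
  assumes add: "\<And>f g. D (f + g) = D f + D g"
    and mono: "\<And>c i j. D (ps_const c * \<^bold>x ^ i * \<^bold>y ^ j) = 0"
    and cont: "\<And>N f. ord_ge (2 * N + 1) f \<Longrightarrow> ord_ge N (D f)"
  shows "D f = 0"
proof (rule ord_ge_imp_zero)
  fix N
  have D0: "D 0 = 0" using add[of 0 0] by (metis add.right_neutral add_left_cancel)
  have Dsum: "D (sum F A) = (\<Sum>a\<in>A. D (F a))" for F :: "nat \<Rightarrow> conv_ps" and A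
    by (induction A rule: infinite_finite_induct) (auto simp: D0 add)
  obtain r where "f = (\<Sum>i<2*N+1. \<Sum>j<2*N+1. ps_const (ps_coeff f i j) * \<^bold>x ^ i * \<^bold>y ^ j) + r" "ord_ge (2 * N + 1) r"
    by (rule eq_polynomial_plus_ord_ge)
  then have "D f = D r"
    by (metis (no_types, lifting) Dsum add add_0 mono sum.neutral)
  with cont[OF \<open>ord_ge (2 * N + 1) r\<close>] show "ord_ge N (D f)" by simp
qed

section \<open>Substitution\<close>

lemma ps_coeff_subst:
  assumes "ps_coeff p 0 0 = 0" "ps_coeff q 0 0 = 0"
  shows "ps_coeff (subst f p q) k l = (\<Sum>i\<le>k+l. \<Sum>j\<le>k+l. ps_coeff f i j * ps_coeff (p ^ i * q ^ j) k l)"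
proof -
  have pw: "Rep_conv_ps (p ^ i) = Rep_conv_ps p ^ i" for p i
    by (induction i) (simp_all add: one_conv_ps.rep_eq times_conv_ps.rep_eq)
  show ?thesis
    using assms by (simp add: ps_coeff.rep_eq subst.rep_eq subst2_def times_conv_ps.rep_eq pw)
qed

lemma ps_coeff_power_power_eq_0:
  assumes "ps_coeff p 0 0 = 0" "ps_coeff q 0 0 = 0" "k + l < i + j"
  shows "ps_coeff (p ^ i * q ^ j) k l = 0"
  using ord_ge_mult[OF ord_ge_power[of p i] ord_ge_power[of q j]] assms
  unfolding ord_ge_1_iff by (auto simp: ord_ge_def)

context
  fixes p q :: conv_ps
  assumes p0: "ps_coeff p 0 0 = 0" and q0: "ps_coeff q 0 0 = 0"
begin

lemma subst_add: "subst (f + g) p q = subst f p q + subst g p q"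
  by (rule conv_ps_eqI) (simp add: ps_coeff_subst p0 q0 sum.distrib distrib_right)

lemma subst_uminus: "subst (- f) p q = - subst f p q"
  by (rule conv_ps_eqI) (simp add: ps_coeff_subst p0 q0 sum_negf)

lemma subst_diff: "subst (f - g) p q = subst f p q - subst g p q"
  by (metis (no_types, lifting) add_diff_cancel_right' diff_add_cancel subst_add)

lemma subst_monomial: "subst (ps_const c * \<^bold>x ^ a * \<^bold>y ^ b) p q = ps_const c * p ^ a * q ^ b"
proof (rule conv_ps_eqI)
  fix k l
  have "ps_coeff (subst (ps_const c * \<^bold>x ^ a * \<^bold>y ^ b) p q) k l =
      (\<Sum>i\<le>k+l. if i = a then (\<Sum>j\<le>k+l. if j = b then c * ps_coeff (p ^ i * q ^ j) k l else 0) else 0)"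
    unfolding ps_coeff_subst[OF p0 q0] ps_coeff_monomial by (intro sum.cong refl) (auto simp: if_mult_zero)
  also have "\<dots> = (if a \<le> k + l \<and> b \<le> k + l then c * ps_coeff (p ^ a * q ^ b) k l else 0)"
    by simp
  \<comment> \<open>Exponents beyond the cut-off k + l contribute nothing anyway, because p^a q^b
    has order at least a + b.\<close>
  also have "\<dots> = c * ps_coeff (p ^ a * q ^ b) k l"
    using ps_coeff_power_power_eq_0[OF p0 q0, of k l a b] by auto
  finally show "ps_coeff (subst (ps_const c * \<^bold>x ^ a * \<^bold>y ^ b) p q) k l = ps_coeff (ps_const c * p ^ a * q ^ b) k l"
    by (simp add: mult.assoc)
qed

lemma ord_ge_subst:
  assumes "ord_ge N f"
  shows "ord_ge N (subst f p q)"
  unfolding ord_ge_def ps_coeff_subst[OF p0 q0]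
proof (intro allI impI sum.neutral ballI)
  fix k l i j assume "k + l < N"
  show "ps_coeff f i j * ps_coeff (p ^ i * q ^ j) k l = 0"
  proof (cases "i + j < N")
    case True
    then show ?thesis using assms by (simp add: ord_ge_def)
  next
    case False
    then show ?thesis using ps_coeff_power_power_eq_0[OF p0 q0, of k l i j] \<open>k + l < N\<close> by simp
  qed
qed

lemma subst_const [simp]: "subst (ps_const c) p q = ps_const c"
  using subst_monomial[of c 0 0] by simp

lemma subst_0 [simp]: "subst 0 p q = 0"
  using subst_const[of 0] by simp

lemma subst_1 [simp]: "subst 1 p q = 1"
  using subst_const[of 1] by simp

lemma subst_x [simp]: "subst \<^bold>x p q = p"
  using subst_monomial[of 1 1 0] by simp

lemma subst_y [simp]: "subst \<^bold>y p q = q"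
  using subst_monomial[of 1 0 1] by simp

lemma subst_mult: "subst (f * g) p q = subst f p q * subst g p q"
proof -
  \<comment> \<open>The defect of multiplicativity is biadditive, so density is used twice: here in
    f against a fixed monomial, afterwards in g.\<close>
  have 1: "subst (f * (ps_const c * \<^bold>x ^ a * \<^bold>y ^ b)) p q - subst f p q * subst (ps_const c * \<^bold>x ^ a * \<^bold>y ^ b) p q = 0"
    for f c a b
  proof (rule additive_eq_zeroI[of "\<lambda>f. subst (f * (ps_const c * \<^bold>x ^ a * \<^bold>y ^ b)) p q
        - subst f p q * subst (ps_const c * \<^bold>x ^ a * \<^bold>y ^ b) p q"], goal_cases)
    case (2 d i j)
    have "ps_const d * \<^bold>x ^ i * \<^bold>y ^ j * (ps_const c * \<^bold>x ^ a * \<^bold>y ^ b) =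
        ps_const (d * c) * \<^bold>x ^ (i + a) * \<^bold>y ^ (j + b)"
      by (simp add: ps_const_mult power_add algebra_simps)
    then show ?case
      by (simp only: subst_monomial) (simp add: ps_const_mult power_add algebra_simps)
  next
    case (3 N f)
    then have "ord_ge N f" by (rule ord_ge_mono) simp
    then show ?case
      by (metis mult.commute ord_ge_diff ord_ge_mult_left ord_ge_subst)
  qed (simp add: subst_add distrib_right)
  have "subst (f * g) p q - subst f p q * subst g p q = 0"
  proof (rule additive_eq_zeroI[of "\<lambda>g. subst (f * g) p q - subst f p q * subst g p q"], goal_cases)
    case (3 N f)
    then have "ord_ge N f" by (rule ord_ge_mono) simp
    then show ?case
      by (intro ord_ge_diff ord_ge_mult_left ord_ge_subst)
  qed (simp_all add: subst_add distrib_left 1)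
  then show ?thesis by simp
qed

lemma subst_power [simp]: "subst (f ^ n) p q = subst f p q ^ n"
  by (induction n) (simp_all add: subst_mult)

lemma subst_of_nat [simp]: "subst (of_nat n) p q = of_nat n"
  using subst_const[of "of_nat n"] by (simp only: ps_const_of_nat)

lemma subst_numeral [simp]: "subst (numeral n) p q = numeral n"
  using subst_const[of "numeral n"] by (simp only: ps_const_numeral)

lemma ps_coeff_subst_0_0 [simp]: "ps_coeff (subst f p q) 0 0 = ps_coeff f 0 0"
  by (simp add: ps_coeff_subst p0 q0 ps_coeff_one)

lemma subst_dvd: "f dvd g \<Longrightarrow> subst f p q dvd subst g p q"
  by (auto simp: dvd_def subst_mult)

lemmas subst_hom = subst_add subst_uminus subst_diff subst_mult

end

lemma subst_id [simp]: "subst f \<^bold>x \<^bold>y = f"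
proof -
  have [simp]: "ps_coeff \<^bold>x 0 0 = 0" "ps_coeff \<^bold>y 0 0 = 0"
    by (simp_all add: ps_coeff_x ps_coeff_y)
  have "subst f \<^bold>x \<^bold>y - f = 0"
  proof (rule additive_eq_zeroI[of "\<lambda>f. subst f \<^bold>x \<^bold>y - f"], goal_cases)
    case (3 N f)
    then have "ord_ge N f" by (rule ord_ge_mono) simp
    then show ?case by (intro ord_ge_diff ord_ge_subst) auto
  qed (simp_all add: subst_add subst_monomial)
  then show ?thesis by simp
qed

lemma subst_subst:
  assumes "ps_coeff p 0 0 = 0" "ps_coeff q 0 0 = 0" "ps_coeff p' 0 0 = 0" "ps_coeff q' 0 0 = 0"
  shows "subst (subst f p q) p' q' = subst f (subst p p' q') (subst q p' q')"
proof -
  have [simp]: "ps_coeff (subst p p' q') 0 0 = 0" "ps_coeff (subst q p' q') 0 0 = 0"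
    using assms by simp_all
  have "subst (subst f p q) p' q' - subst f (subst p p' q') (subst q p' q') = 0"
  proof (rule additive_eq_zeroI[of "\<lambda>f. subst (subst f p q) p' q' - subst f (subst p p' q') (subst q p' q')"], goal_cases)
    case (3 N f)
    then have "ord_ge N f" by (rule ord_ge_mono) simp
    then show ?case using assms by (intro ord_ge_diff ord_ge_subst) auto
  qed (simp_all add: subst_hom subst_monomial assms)
  then show ?thesis by simp
qed

lemma ps_coeff_xy_0 [simp]: "ps_coeff \<^bold>x 0 0 = 0" "ps_coeff \<^bold>y 0 0 = 0"
  by (simp_all add: ps_coeff_x ps_coeff_y)

text \<open>Seen as a substitution, setting y = 0 inherits the homomorphism and composition rules of
  \<open>subst\<close>.\<close>

lemma restrict_x_eq_subst: "restrict_x f = subst f \<^bold>x 0"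
proof (rule conv_ps_eqI)
  fix k l
  have c: "ps_coeff (\<^bold>x ^ i * 0 ^ j) k l = (if i = k \<and> j = 0 \<and> l = 0 then 1 else 0)" for i j
    by (cases j) (auto simp: ps_coeff_x_power)
  have "ps_coeff (subst f \<^bold>x 0) k l =
     (\<Sum>i\<le>k+l. if i = k then (\<Sum>j\<le>k+l. if j = 0 then if l = 0 then ps_coeff f i j else 0 else 0) else 0)"
    unfolding ps_coeff_subst[OF ps_coeff_xy_0(1) ps_coeff_zero] c
    by (intro sum.cong refl) (auto simp: if_mult_zero)
  then show "ps_coeff (restrict_x f) k l = ps_coeff (subst f \<^bold>x 0) k l"
    by simp
qed

section \<open>The inverse function theorem\<close>

text \<open>Hadamard's lemma: the terms without y are divisible by x, the others by y, and the
  cofactors lose just one order. It makes induction on the order possible for statements about f(p,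
  q).\<close>

lemma eq_x_y_combination:
  assumes "ord_ge (Suc N) f"
  obtains a b where "f = \<^bold>x * a + \<^bold>y * b" "ord_ge N a" "ord_ge N b"
proof
  show "f = \<^bold>x * shift_x (restrict_x f) + \<^bold>y * shift_y f"
  proof (rule conv_ps_eqI)
    fix i j
    show "ps_coeff f i j = ps_coeff (\<^bold>x * shift_x (restrict_x f) + \<^bold>y * shift_y f) i j"
      using assms by (cases i; cases j) (auto simp: ps_coeff_x_mult ps_coeff_y_mult ord_ge_def)
  qed
qed (use assms in \<open>auto simp: ord_ge_def\<close>)

text \<open>Write f = f(0, 0) + x a + y b. In the difference of the two values, either p - p' or q -
  q' is a factor, or the induction hypothesis for a or b is multiplied by a series without constant
  term.\<close>

lemma ord_ge_subst_diff:
  assumes p: "ord_ge 1 p" "ord_ge 1 q" "ord_ge 1 p'" "ord_ge 1 q'"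
    and d: "ord_ge N (p - p')" "ord_ge N (q - q')"
  shows "ord_ge N (subst f p q - subst f p' q')"
proof -
  have [simp]: "ps_coeff p 0 0 = 0" "ps_coeff q 0 0 = 0" "ps_coeff p' 0 0 = 0" "ps_coeff q' 0 0 = 0"
    using p unfolding ord_ge_1_iff by auto
  have "ord_ge M (subst f p q - subst f p' q')" if "M \<le> N" for M
    using that
  proof (induction M arbitrary: f)
    case (Suc M)
    have "ord_ge (Suc 0) (f - ps_const (ps_coeff f 0 0))"
      by (auto simp: ord_ge_def ps_coeff_const)
    then obtain a b where "f - ps_const (ps_coeff f 0 0) = \<^bold>x * a + \<^bold>y * b"
      by (rule eq_x_y_combination)
    then have f: "f = ps_const (ps_coeff f 0 0) + (\<^bold>x * a + \<^bold>y * b)"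
      by (simp add: algebra_simps)
    have "subst f p q - subst f p' q' =
        ((p - p') * subst a p q + p' * (subst a p q - subst a p' q')) +
        ((q - q') * subst b p q + q' * (subst b p q - subst b p' q'))"
      by (subst (1 2) f) (simp add: subst_hom algebra_simps)
    moreover have "ord_ge (Suc M) ((p - p') * subst a p q)" "ord_ge (Suc M) ((q - q') * subst b p q)"
      using ord_ge_mono[OF d(1) Suc.prems] ord_ge_mono[OF d(2) Suc.prems]
      by (metis mult.commute ord_ge_mult_left)+
    moreover have "ord_ge (Suc M) (p' * (subst a p q - subst a p' q'))"
        "ord_ge (Suc M) (q' * (subst b p q - subst b p' q'))"
      using ord_ge_mult[OF p(3) Suc.IH] ord_ge_mult[OF p(4) Suc.IH] Suc.prems by auto
    ultimately show ?case by (simp add: ord_ge_add)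
  qed simp
  then show ?thesis by simp
qed

text \<open>The cofactors of x and y now vanish at the origin themselves, so every summand gains one
  order. This is the contraction property of the iteration that inverts a map tangent to the
  identity.\<close>

lemma ord_ge_subst_diff_Suc:
  assumes p: "ord_ge 1 p" "ord_ge 1 q" "ord_ge 1 p'" "ord_ge 1 q'"
    and d: "ord_ge N (p - p')" "ord_ge N (q - q')" and f: "ord_ge 2 f"
  shows "ord_ge (Suc N) (subst f p q - subst f p' q')"
proof -
  have [simp]: "ps_coeff p 0 0 = 0" "ps_coeff q 0 0 = 0" "ps_coeff p' 0 0 = 0" "ps_coeff q' 0 0 = 0"
    using p unfolding ord_ge_1_iff by auto
  obtain a b where ab: "f = \<^bold>x * a + \<^bold>y * b" "ord_ge 1 a" "ord_ge 1 b"
    using eq_x_y_combination[of 1 f] f by (auto simp: numeral_2_eq_2)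
  have "subst f p q - subst f p' q' =
        ((p - p') * subst a p q + p' * (subst a p q - subst a p' q')) +
        ((q - q') * subst b p q + q' * (subst b p q - subst b p' q'))"
    by (simp add: ab(1) subst_hom algebra_simps)
  moreover have "ord_ge (N + 1) ((p - p') * subst a p q)" "ord_ge (N + 1) ((q - q') * subst b p q)"
    by (intro ord_ge_mult d ord_ge_subst ab(2,3); simp)+
  moreover have "ord_ge (1 + N) (p' * (subst a p q - subst a p' q'))"
      "ord_ge (1 + N) (q' * (subst b p q - subst b p' q'))"
    by (intro ord_ge_mult p ord_ge_subst_diff d)+
  ultimately show ?thesis by (simp add: ord_ge_add)
qed

section \<open>Truncated norms on polydiscs and majorants\<close>

abbreviation pnorm :: "real \<Rightarrow> nat \<Rightarrow> conv_ps \<Rightarrow> real" where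
  "pnorm r K f \<equiv> pnorm2 r K (Rep_conv_ps f)"

lemma pnorm_def: "pnorm r K f = (\<Sum>(l, k)\<in>{..K} \<times> {..K}. norm (ps_coeff f k l) * r ^ (k + l))"
  by (simp add: pnorm2_altdef ps_coeff.rep_eq sum.cartesian_product)

lemma pnorm_diff:
  assumes "r \<ge> 0"
  shows "pnorm r K (f - g) \<le> pnorm r K f + pnorm r K g"
  unfolding pnorm_def sum.distrib[symmetric]
proof (rule sum_mono, clarify)
  fix l k
  show "norm (ps_coeff (f - g) k l) * r ^ (k + l)
      \<le> norm (ps_coeff f k l) * r ^ (k + l) + norm (ps_coeff g k l) * r ^ (k + l)"
    using norm_triangle_ineq4[of "ps_coeff f k l" "ps_coeff g k l"] assms
    by (simp add: mult_right_mono flip: distrib_right)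
qed

lemma pnorm_coeff: "r \<ge> 0 \<Longrightarrow> norm (ps_coeff f i j) * r ^ (i + j) \<le> pnorm r (i + j) f"
  using pnorm2_coeff[of r i "i + j" j "Rep_conv_ps f"] by (simp add: ps_coeff.rep_eq)

lemma pnorm_monomial_le:
  assumes "r \<ge> 0" "pnorm r K p \<le> s" "pnorm r K q \<le> s"
  shows "pnorm r K (p ^ i * q ^ j) \<le> s ^ (i + j)"
proof -
  have pw: "Rep_conv_ps (p ^ i) = Rep_conv_ps p ^ i" for p i
    by (induction i) (simp_all add: one_conv_ps.rep_eq times_conv_ps.rep_eq)
  have "pnorm r K (p ^ i * q ^ j) \<le> pnorm r K p ^ i * pnorm r K q ^ j"
    unfolding times_conv_ps.rep_eq pw
    by (rule order_trans[OF pnorm2_mult]) (auto intro!: mult_mono pnorm2_power pnorm2_nonneg zero_le_power assms)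
  also have "\<dots> \<le> s ^ i * s ^ j"
    using assms order_trans[OF pnorm2_nonneg[OF assms(1)] assms(2)]
    by (intro mult_mono power_mono) (auto intro!: pnorm2_nonneg zero_le_power)
  finally show ?thesis by (simp add: power_add)
qed

text \<open>Cauchy's majorant: monomials in p and q are bounded by powers of s because the truncated
  norm is submultiplicative. The range 2 * K is needed since the coefficient of x^k y^l with k, l
  \<le> K involves exponents up to k + l.\<close>

lemma pnorm_subst_le:
  assumes "ps_coeff p 0 0 = 0" "ps_coeff q 0 0 = 0" "r \<ge> 0" "pnorm r K p \<le> s" "pnorm r K q \<le> s"
  shows "pnorm r K (subst f p q) \<le> (\<Sum>(i, j)\<in>{..2*K} \<times> {..2*K}. norm (ps_coeff f i j) * s ^ (i + j))"
proof -
  have "pnorm r K (subst f p q) \<le> (\<Sum>(l, k)\<in>{..K} \<times> {..K}. \<Sum>(i, j)\<in>{..2*K} \<times> {..2*K}.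
      norm (ps_coeff f i j) * (norm (ps_coeff (p ^ i * q ^ j) k l) * r ^ (k + l)))"
    unfolding pnorm_def
  proof (rule sum_mono, clarify)
    fix l k assume lk: "l \<le> K" "k \<le> K"
    have "norm (ps_coeff (subst f p q) k l) =
        norm (\<Sum>(i, j)\<in>{..k+l} \<times> {..k+l}. ps_coeff f i j * ps_coeff (p ^ i * q ^ j) k l)"
      by (simp add: ps_coeff_subst assms sum.cartesian_product)
    also have "\<dots> \<le> (\<Sum>(i, j)\<in>{..k+l} \<times> {..k+l}. norm (ps_coeff f i j) * norm (ps_coeff (p ^ i * q ^ j) k l))"
      by (intro sum_norm_le) (auto simp: norm_mult)
    also have "\<dots> \<le> (\<Sum>(i, j)\<in>{..2*K} \<times> {..2*K}. norm (ps_coeff f i j) * norm (ps_coeff (p ^ i * q ^ j) k l))"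
      by (rule sum_mono2) (use lk in auto)
    finally have "norm (ps_coeff (subst f p q) k l) * r ^ (k + l) \<le>
       (\<Sum>(i, j)\<in>{..2*K} \<times> {..2*K}. norm (ps_coeff f i j) * norm (ps_coeff (p ^ i * q ^ j) k l)) * r ^ (k + l)"
      using assms by (intro mult_right_mono) auto
    then show "norm (ps_coeff (subst f p q) k l) * r ^ (k + l) \<le> (\<Sum>(i, j)\<in>{..2*K} \<times> {..2*K}.
      norm (ps_coeff f i j) * (norm (ps_coeff (p ^ i * q ^ j) k l) * r ^ (k + l)))"
      by (simp add: sum_distrib_right case_prod_unfold mult.assoc)
  qed
  also have "\<dots> = (\<Sum>(i, j)\<in>{..2*K} \<times> {..2*K}. norm (ps_coeff f i j) * pnorm r K (p ^ i * q ^ j))"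
    unfolding pnorm_def sum_distrib_left case_prod_unfold by (rule sum.swap)
  also have "\<dots> \<le> (\<Sum>(i, j)\<in>{..2*K} \<times> {..2*K}. norm (ps_coeff f i j) * s ^ (i + j))"
    by (rule sum_mono) (auto intro!: mult_left_mono pnorm_monomial_le assms)
  finally show ?thesis .
qed

text \<open>Without constant and linear terms the majorant is O(r^2), hence below r for small r. The
  argument 2 * r is the radius of the ball that the iteration must not leave.\<close>

lemma ord_ge_2_majorant:
  assumes "ord_ge 2 f"
  shows "\<exists>r0>0. \<forall>r K. 0 < r \<longrightarrow> r \<le> r0 \<longrightarrow>
    (\<Sum>(i, j)\<in>{..K} \<times> {..K}. norm (ps_coeff f i j) * (2 * r) ^ (i + j)) \<le> r"
proof -
  have "convergent2 (Rep_conv_ps f)" using Rep_conv_ps by simp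
  then obtain M C where "M \<ge> 0" "C > 0" "\<And>i j. norm (ps_coeff f i j) \<le> M * C ^ (i + j)"
    unfolding ps_coeff.rep_eq using convergent2_imp_bound by metis
  then have b': "M \<ge> 0" "C > 0" "norm (ps_coeff f i j) \<le> M * C ^ (i + j)" for i j by auto
  have b: "M + 1 > 0" "C > 0" "norm (ps_coeff f i j) \<le> (M + 1) * C ^ (i + j)" for i j
    using b'(1,2) b'(3)[of i j] by (simp_all add: distrib_right add_increasing2)
  \<comment> \<open>With t = 2 C r this ensures t \<le> 1/2, so that a geometric series remains once
    t^2 is taken out, and 64 (M + 1) C^2 r \<le> 1, which absorbs the resulting constant. M + 1
    replaces M to have a positive factor.\<close>
  define r0 where "r0 = 1 / (64 * (M + 1) * C\<^sup>2 + 4 * C)"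
  have den: "64 * (M + 1) * C\<^sup>2 + 4 * C > 0" using b(1,2) by (metis add_pos_pos mult_pos_pos zero_less_numeral zero_less_power)
  show ?thesis
  proof (intro exI[of _ r0] conjI allI impI)
    show "r0 > 0" unfolding r0_def using den by simp
    fix r K assume r: "0 < r" "r \<le> r0"
    define t where "t = 2 * C * r"
    have r1: "r * (64 * (M + 1) * C\<^sup>2 + 4 * C) \<le> 1"
      using r(2) den unfolding r0_def by (simp add: field_simps)
    have "r * (64 * (M + 1) * C\<^sup>2) \<ge> 0" "r * (4 * C) \<ge> 0" using r b by auto
    then have r2: "r * (64 * (M + 1) * C\<^sup>2) \<le> 1" and r3: "r * (4 * C) \<le> 1"
      using r1 unfolding distrib_left by linarith+
    have t: "0 \<le> t" "t \<le> 1 / 2"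
      using r3 r b(1,2) unfolding t_def by (simp_all add: mult_ac)
    have geo: "(\<Sum>i\<le>K. (1 / 2 :: real) ^ i) \<le> 2"
    proof -
      have "(\<Sum>i\<le>K. (1 / 2 :: real) ^ i) = 2 - (1 / 2) ^ K"
        by (induction K) auto
      then show ?thesis by simp
    qed
    have "(\<Sum>(i, j)\<in>{..K} \<times> {..K}. norm (ps_coeff f i j) * (2 * r) ^ (i + j)) \<le>
        (\<Sum>(i, j)\<in>{..K} \<times> {..K}. 4 * (M + 1) * t\<^sup>2 * ((1 / 2) ^ i * (1 / 2) ^ j))"
    proof (rule sum_mono, clarify)
      fix i j :: nat
      show "norm (ps_coeff f i j) * (2 * r) ^ (i + j) \<le> 4 * (M + 1) * t\<^sup>2 * ((1 / 2) ^ i * (1 / 2) ^ j)"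
      proof (cases "i + j < 2")
        case True
        then have "ps_coeff f i j = 0" using assms by (auto simp: ord_ge_def)
        then show ?thesis using b by simp
      next
        case False
        then obtain e where e: "i + j = 2 + e" using le_Suc_ex not_less by metis
        have "norm (ps_coeff f i j) * (2 * r) ^ (i + j) \<le> (M + 1) * C ^ (i + j) * (2 * r) ^ (i + j)"
          by (rule mult_right_mono[OF b(3)]) (use r in auto)
        also have "\<dots> = (M + 1) * t ^ (i + j)"
          unfolding t_def by (simp add: power_mult_distrib)
        also have "\<dots> = (M + 1) * t\<^sup>2 * t ^ e"
          unfolding e power_add by simp
        also have "\<dots> \<le> (M + 1) * t\<^sup>2 * (1 / 2) ^ e"
          using t b by (intro mult_left_mono power_mono) auto
        also have "\<dots> = 4 * (M + 1) * t\<^sup>2 * (1 / 2) ^ (i + j)"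
          unfolding e power_add by (simp add: power2_eq_square)
        finally show ?thesis by (simp add: power_add)
      qed
    qed
    also have "\<dots> = 4 * (M + 1) * t\<^sup>2 * ((\<Sum>i\<le>K. (1 / 2) ^ i) * (\<Sum>j\<le>K. (1 / 2) ^ j))"
      unfolding sum_product sum.cartesian_product by (simp only: sum_distrib_left case_prod_unfold)
    also have "\<dots> \<le> 4 * (M + 1) * t\<^sup>2 * (2 * 2)"
      using b by (intro mult_left_mono mult_mono geo sum_nonneg) auto
    also have "\<dots> = r * (64 * (M + 1) * C\<^sup>2) * r"
      unfolding t_def by (simp add: power2_eq_square)
    also have "\<dots> \<le> 1 * r"
      using r2 r by (intro mult_right_mono) auto
    finally show "(\<Sum>(i, j)\<in>{..K} \<times> {..K}. norm (ps_coeff f i j) * (2 * r) ^ (i + j)) \<le> r" by simp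
  qed
qed

text \<open>The coefficient at (i, j) no longer changes from step i + j on, so the limit is read off
  diagonally; the uniform Cauchy bound passes to it and makes it convergent.\<close>

lemma conv_ps_limit:
  assumes step: "\<And>d. ord_ge (Suc d) (u (Suc d) - u d)"
    and bound: "\<And>d i j. norm (ps_coeff (u d) i j) \<le> M * C ^ (i + j)"
  obtains v where "\<And>d. ord_ge (Suc d) (v - u d)"
proof -
  have mono: "ord_ge (Suc d) (u (d + e) - u d)" for d e
  proof (induction e)
    case (Suc e)
    have "ord_ge (Suc d) (u (Suc (d + e)) - u (d + e))"
      by (rule ord_ge_mono[OF step]) simp
    from ord_ge_add[OF this Suc] show ?case by simp
  qed simp
  define F where "F = Abs_fps (\<lambda>j. Abs_fps (\<lambda>i. ps_coeff (u (i + j)) i j))"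
  have "convergent2 F"
    by (rule bound_imp_convergent2[of F M C]) (simp add: F_def bound)
  then have c: "ps_coeff (Abs_conv_ps F) i j = ps_coeff (u (i + j)) i j" for i j
    by (simp add: ps_coeff.rep_eq Abs_conv_ps_inverse F_def)
  show ?thesis
  proof (rule that[of "Abs_conv_ps F"])
    fix d
    show "ord_ge (Suc d) (Abs_conv_ps F - u d)"
      unfolding ord_ge_def ps_coeff_diff c
    proof (intro allI impI)
      fix i j assume "i + j < Suc d"
      then obtain e where d: "d = i + j + e" using le_Suc_ex by (metis less_Suc_eq_le)
      have "ps_coeff (u (i + j + e) - u (i + j)) i j = 0"
        using mono[of "i + j" e] unfolding ord_ge_def by blast
      then show "ps_coeff (u (i + j)) i j - ps_coeff (u d) i j = 0" by (simp add: d)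
    qed
  qed
qed

text \<open>The inverse is the fixed point of u = x - P(u, v), v = y - Q(u, v). The iterates
  converge coefficientwise by contraction of orders, and the limit is a convergent series because
  all of them stay in one ball of a polydisc norm.\<close>

lemma right_inverse_tangent_to_id:
  assumes "ord_ge 2 P" "ord_ge 2 Q"
  obtains u v where "ord_ge 2 (u - \<^bold>x)" "ord_ge 2 (v - \<^bold>y)"
    "subst (\<^bold>x + P) u v = \<^bold>x" "subst (\<^bold>y + Q) u v = \<^bold>y"
proof -
  obtain r1 where r1: "r1 > 0"
    "\<And>r K. 0 < r \<Longrightarrow> r \<le> r1 \<Longrightarrow> (\<Sum>(i, j)\<in>{..K} \<times> {..K}. norm (ps_coeff P i j) * (2 * r) ^ (i + j)) \<le> r"
    using ord_ge_2_majorant[OF assms(1)] by blast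
  obtain r2 where r2: "r2 > 0"
    "\<And>r K. 0 < r \<Longrightarrow> r \<le> r2 \<Longrightarrow> (\<Sum>(i, j)\<in>{..K} \<times> {..K}. norm (ps_coeff Q i j) * (2 * r) ^ (i + j)) \<le> r"
    using ord_ge_2_majorant[OF assms(2)] by blast
  define r where "r = min r1 r2"
  have r: "r > 0" "r \<le> r1" "r \<le> r2" using r1(1) r2(1) by (auto simp: r_def)
  \<comment> \<open>Both components are iterated at once as a pair, starting from (0, 0).\<close>
  define W where "W = rec_nat (0 :: conv_ps, 0 :: conv_ps)
    (\<lambda>_ (a, b). (\<^bold>x - subst P a b, \<^bold>y - subst Q a b))"
  define U V where "U = (\<lambda>d. fst (W d))" and "V = (\<lambda>d. snd (W d))"
  have U0: "U 0 = 0" "V 0 = 0" by (simp_all add: U_def V_def W_def)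
  have US: "U (Suc d) = \<^bold>x - subst P (U d) (V d)" "V (Suc d) = \<^bold>y - subst Q (U d) (V d)" for d
    by (simp_all add: U_def V_def W_def case_prod_unfold)
  have PQ1: "ord_ge 1 P" "ord_ge 1 Q"
    using assms by (auto intro: ord_ge_mono)
  have xy1: "ord_ge 1 \<^bold>x" "ord_ge 1 \<^bold>y" by (simp_all only: ord_ge_1_iff ps_coeff_xy_0)
  have o1: "ord_ge 1 (U d) \<and> ord_ge 1 (V d)" for d
  proof (induction d)
    case (Suc d)
    then show ?case
      unfolding US by (intro conjI ord_ge_diff ord_ge_subst xy1 PQ1) (auto simp: ord_ge_1_iff[unfolded One_nat_def])
  qed (simp add: U0)
  then have z[simp]: "ps_coeff (U d) 0 0 = 0" "ps_coeff (V d) 0 0 = 0" for d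
    by (auto simp: ord_ge_1_iff[unfolded One_nat_def])
  have xn: "pnorm r K \<^bold>x \<le> r" "pnorm r K \<^bold>y \<le> r" for K
  proof -
    have "pnorm r K \<^bold>x = (\<Sum>p\<in>{..K}\<times>{..K}. if p = (0, 1) then r else 0)"
      unfolding pnorm_def by (rule sum.cong) (auto simp: ps_coeff_x split: if_splits)
    then show "pnorm r K \<^bold>x \<le> r" using r by simp
    have "pnorm r K \<^bold>y = (\<Sum>p\<in>{..K}\<times>{..K}. if p = (1, 0) then r else 0)"
      unfolding pnorm_def by (rule sum.cong) (auto simp: ps_coeff_y split: if_splits)
    then show "pnorm r K \<^bold>y \<le> r" using r by simp
  qed
  \<comment> \<open>The ball of radius 2 r is invariant: x and y have norm at most r, and by the
    choice of r so do P and Q evaluated on this ball.\<close>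
  have bnd: "pnorm r K (U d) \<le> 2 * r \<and> pnorm r K (V d) \<le> 2 * r" for d K
  proof (induction d)
    case 0
    have "pnorm r K 0 = 0" by (simp add: pnorm_def case_prod_unfold)
    then show ?case using r by (simp add: U0)
  next
    case (Suc d)
    have "pnorm r K (subst P (U d) (V d)) \<le> r" "pnorm r K (subst Q (U d) (V d)) \<le> r"
      by (rule order_trans[OF pnorm_subst_le[where s = "2 * r"]]; use Suc r r1(2) r2(2) in auto)+
    then show ?case
      unfolding US using xn[of K] r pnorm_diff[of r K "\<^bold>x" "subst P (U d) (V d)"]
        pnorm_diff[of r K "\<^bold>y" "subst Q (U d) (V d)"] by linarith
  qed
  have cb: "norm (ps_coeff f i j) \<le> 2 * r * (1 / r) ^ (i + j)" if "\<And>K. pnorm r K f \<le> 2 * r" for f i j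
    using order_trans[OF pnorm_coeff[of r f i j] that[of "i + j"]] r by (simp add: field_simps)
  have step: "ord_ge (Suc d) (U (Suc d) - U d) \<and> ord_ge (Suc d) (V (Suc d) - V d)" for d
  proof (induction d)
    case 0
    show ?case using o1[of 1] by (simp add: U0)
  next
    case (Suc d)
    have "ord_ge (Suc (Suc d)) (subst P (U d) (V d) - subst P (U (Suc d)) (V (Suc d)))"
      "ord_ge (Suc (Suc d)) (subst Q (U d) (V d) - subst Q (U (Suc d)) (V (Suc d)))"
      using Suc ord_ge_uminus[of "Suc d" "U (Suc d) - U d"] ord_ge_uminus[of "Suc d" "V (Suc d) - V d"]
      by (auto intro!: ord_ge_subst_diff_Suc o1[THEN conjunct1] o1[THEN conjunct2] assms simp del: One_nat_def)
    then show ?case by (simp add: US(1)[of "Suc d"] US(2)[of "Suc d"] US(1)[of d] US(2)[of d])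
  qed
  obtain u where u: "\<And>d. ord_ge (Suc d) (u - U d)"
  proof (rule conv_ps_limit[of U "2 * r" "1 / r"])
    show "norm (ps_coeff (U d) i j) \<le> 2 * r * (1 / r) ^ (i + j)" for d i j
      by (rule cb) (use bnd in blast)
  qed (use step in blast)+
  obtain v where v: "\<And>d. ord_ge (Suc d) (v - V d)"
  proof (rule conv_ps_limit[of V "2 * r" "1 / r"])
    show "norm (ps_coeff (V d) i j) \<le> 2 * r * (1 / r) ^ (i + j)" for d i j
      by (rule cb) (use bnd in blast)
  qed (use step in blast)+
  have uv1: "ord_ge 1 u" "ord_ge 1 v"
    using u[of 0] v[of 0] by (simp_all add: U0)
  then have [simp]: "ps_coeff u 0 0 = 0" "ps_coeff v 0 0 = 0"
    by (simp_all only: ord_ge_1_iff)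
  have eq: "u - \<^bold>x + subst P u v = 0" "v - \<^bold>y + subst Q u v = 0"
  proof -
    have "ord_ge (Suc d) ((u - U (Suc d)) + (subst P u v - subst P (U d) (V d)))"
      "ord_ge (Suc d) ((v - V (Suc d)) + (subst Q u v - subst Q (U d) (V d)))" for d
      using ord_ge_mono[OF u[of "Suc d"], of "Suc d"] ord_ge_mono[OF v[of "Suc d"], of "Suc d"]
      by (auto intro!: ord_ge_add ord_ge_subst_diff uv1 u v simp: o1 simp del: One_nat_def)
    then have "ord_ge (Suc d) (u - \<^bold>x + subst P u v)" "ord_ge (Suc d) (v - \<^bold>y + subst Q u v)" for d
      by (simp_all add: US algebra_simps)
    then have "ord_ge d (u - \<^bold>x + subst P u v)" "ord_ge d (v - \<^bold>y + subst Q u v)" for d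
      by (meson le_SucI ord_ge_mono order_refl)+
    then show "u - \<^bold>x + subst P u v = 0" "v - \<^bold>y + subst Q u v = 0"
      using ord_ge_imp_zero by blast+
  qed
  show ?thesis
  proof
    have "u - \<^bold>x = - subst P u v" "v - \<^bold>y = - subst Q u v"
      using eq by (simp_all add: add_eq_0_iff2)
    then show "ord_ge 2 (u - \<^bold>x)" "ord_ge 2 (v - \<^bold>y)"
      using assms by (auto intro!: ord_ge_uminus ord_ge_subst)
    show "subst (\<^bold>x + P) u v = \<^bold>x" "subst (\<^bold>y + Q) u v = \<^bold>y"
      using eq by (simp_all add: subst_hom algebra_simps)
  qed
qed

text \<open>As in a group: the right inverse (u, v) is again tangent to the identity, so it has a
  right inverse (s, t), and associativity of substitution gives (s, t) = (p, q). Thus (u, v) is a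
  two-sided inverse.\<close>

lemma inverse_tangent_to_id:
  assumes "ord_ge 2 (p - \<^bold>x)" "ord_ge 2 (q - \<^bold>y)"
  obtains u v where "ps_coeff u 0 0 = 0" "ps_coeff v 0 0 = 0" "subst p u v = \<^bold>x" "subst q u v = \<^bold>y"
    "subst u p q = \<^bold>x" "subst v p q = \<^bold>y"
proof -
  have xy1: "ord_ge 1 \<^bold>x" "ord_ge 1 \<^bold>y" by (simp_all only: ord_ge_1_iff ps_coeff_xy_0)
  have c0: "ps_coeff u 0 0 = 0" if "ord_ge 2 (u - w)" "ord_ge 1 w" for u w
    using ord_ge_add[OF ord_ge_mono[OF that(1), of 1] that(2)] by (simp add: ord_ge_1_iff[simplified])
  obtain u v where uv: "ord_ge 2 (u - \<^bold>x)" "ord_ge 2 (v - \<^bold>y)"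
      "subst p u v = \<^bold>x" "subst q u v = \<^bold>y"
    using right_inverse_tangent_to_id[OF assms] by auto
  obtain s t where st: "ord_ge 2 (s - \<^bold>x)" "ord_ge 2 (t - \<^bold>y)"
      "subst u s t = \<^bold>x" "subst v s t = \<^bold>y"
    using right_inverse_tangent_to_id[OF uv(1,2)] by auto
  have [simp]: "ps_coeff u 0 0 = 0" "ps_coeff v 0 0 = 0" "ps_coeff s 0 0 = 0" "ps_coeff t 0 0 = 0"
    using uv(1,2) st(1,2) xy1 c0 by blast+
  have "s = subst (subst p u v) s t" by (simp add: uv(3))
  also have "\<dots> = p" by (simp add: subst_subst st)
  finally have s: "s = p" .
  have "t = subst (subst q u v) s t" by (simp add: uv(4))
  also have "\<dots> = q" by (simp add: subst_subst st)
  finally have t: "t = q" .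
  show ?thesis using that[of u v] uv st by (simp add: s t)
qed

text \<open>Composing (p, q) with the inverse (l1, l2) of its linear part gives a map tangent to the
  identity; its inverse (u, v), composed with (l1, l2), inverts (p, q).\<close>

theorem coord_changeI:
  assumes p0: "ps_coeff p 0 0 = 0" and q0: "ps_coeff q 0 0 = 0"
    and jac: "ps_coeff p 1 0 * ps_coeff q 0 1 - ps_coeff p 0 1 * ps_coeff q 1 0 \<noteq> 0"
  shows "coord_change p q"
proof -
  define a b c d where "a = ps_coeff p 1 0" and "b = ps_coeff p 0 1" and "c = ps_coeff q 1 0" and "d = ps_coeff q 0 1"
  have coeffs: "ps_coeff p (Suc 0) 0 = a" "ps_coeff p 0 (Suc 0) = b" "ps_coeff q (Suc 0) 0 = c" "ps_coeff q 0 (Suc 0) = d"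
    by (simp_all add: a_def b_def c_def d_def)
  define D where "D = a * d - b * c"
  have D: "D \<noteq> 0" using jac by (simp add: D_def a_def b_def c_def d_def)
  define l1 l2 where "l1 = ps_const (d / D) * \<^bold>x - ps_const (b / D) * \<^bold>y"
    and "l2 = ps_const (a / D) * \<^bold>y - ps_const (c / D) * \<^bold>x"
  define p1 q1 where "p1 = subst l1 p q" and "q1 = subst l2 p q"
  have l0[simp]: "ps_coeff l1 0 0 = 0" "ps_coeff l2 0 0 = 0"
    by (simp_all add: l1_def l2_def)
  have p1: "p1 = ps_const (d / D) * p - ps_const (b / D) * q"
    and q1: "q1 = ps_const (a / D) * q - ps_const (c / D) * p"
    by (simp_all add: p1_def q1_def l1_def l2_def subst_hom p0 q0)
  have [simp]: "ps_coeff p1 0 0 = 0" "ps_coeff q1 0 0 = 0"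
    by (simp_all add: p1 q1 p0 q0)
  have less2: "i + j < 2 \<longleftrightarrow> (i = 0 \<and> j = 0) \<or> (i = 1 \<and> j = 0) \<or> (i = 0 \<and> j = 1)" for i j :: nat by auto
  have "ord_ge 2 (p1 - \<^bold>x)" "ord_ge 2 (q1 - \<^bold>y)"
    using D by (auto simp: ord_ge_def less2 p1 q1 p0 q0 ps_coeff_x ps_coeff_y coeffs divide_simps)
      (simp_all add: D_def algebra_simps)
  then obtain u v where uv0[simp]: "ps_coeff u 0 0 = 0" "ps_coeff v 0 0 = 0" and
    uv: "subst p1 u v = \<^bold>x" "subst q1 u v = \<^bold>y" "subst u p1 q1 = \<^bold>x" "subst v p1 q1 = \<^bold>y"
    by (rule inverse_tangent_to_id)
  have pq: "p = ps_const a * p1 + ps_const b * q1" "q = ps_const c * p1 + ps_const d * q1"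
  proof -
    have "ps_const a * p1 + ps_const b * q1 = (ps_const a * ps_const (d / D) - ps_const b * ps_const (c / D)) * p
        + (ps_const b * ps_const (a / D) - ps_const a * ps_const (b / D)) * q"
      unfolding p1 q1 by (simp only: algebra_simps)
    also have "\<dots> = ps_const ((a * d - b * c) / D) * p"
      by (simp add: ps_const_mult[symmetric] ps_const_diff[symmetric] diff_divide_distrib)
    also have "(a * d - b * c) / D = 1" using D by (simp add: D_def)
    finally show "p = ps_const a * p1 + ps_const b * q1" by simp
    have "ps_const c * p1 + ps_const d * q1 = (ps_const d * ps_const (a / D) - ps_const c * ps_const (b / D)) * q
        + (ps_const c * ps_const (d / D) - ps_const d * ps_const (c / D)) * p"
      unfolding p1 q1 by (simp only: algebra_simps)
    also have "\<dots> = ps_const ((a * d - b * c) / D) * q"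
      by (simp add: ps_const_mult[symmetric] ps_const_diff[symmetric] diff_divide_distrib mult.commute)
    also have "(a * d - b * c) / D = 1" using D by (simp add: D_def)
    finally show "q = ps_const c * p1 + ps_const d * q1" by simp
  qed
  have lin: "ps_const a * l1 + ps_const b * l2 = \<^bold>x" "ps_const c * l1 + ps_const d * l2 = \<^bold>y"
    using D unfolding l1_def l2_def
    by (auto intro!: conv_ps_eqI simp: ps_coeff_x ps_coeff_y) (simp_all add: field_simps, simp_all add: D_def algebra_simps)
  define u' v' where "u' = subst u l1 l2" and "v' = subst v l1 l2"
  have "subst p u' v' = subst (subst p u v) l1 l2" "subst q u' v' = subst (subst q u v) l1 l2"
    by (simp_all add: u'_def v'_def subst_subst p0 q0)
  moreover have "subst p u v = ps_const a * \<^bold>x + ps_const b * \<^bold>y" "subst q u v = ps_const c * \<^bold>x + ps_const d * \<^bold>y"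
    by (subst pq, simp add: subst_hom uv)+
  ultimately have "subst p u' v' = \<^bold>x" "subst q u' v' = \<^bold>y"
    by (simp_all add: subst_hom lin)
  moreover have "subst u' p q = \<^bold>x" "subst v' p q = \<^bold>y"
    unfolding u'_def v'_def by (simp_all add: subst_subst p0 q0 uv flip: p1_def q1_def)
  moreover have "ps_coeff u' 0 0 = 0" "ps_coeff v' 0 0 = 0" by (simp_all add: u'_def v'_def)
  ultimately show ?thesis unfolding coord_change_def using p0 q0 by blast
qed

section \<open>Changes of coordinates\<close>

lemma coord_changeE:
  assumes "coord_change p q"
  obtains p' q' where "coord_change p' q'" "subst p p' q' = \<^bold>x" "subst q p' q' = \<^bold>y"
    "subst p' p q = \<^bold>x" "subst q' p q = \<^bold>y"
  using assms unfolding coord_change_def by blast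

lemma coord_change_0 [dest]:
  assumes "coord_change p q"
  shows "ps_coeff p 0 0 = 0" "ps_coeff q 0 0 = 0"
  using assms unfolding coord_change_def by auto

lemma coord_change_subst:
  assumes pq: "coord_change p q" and pq': "coord_change p' q'"
  shows "coord_change (subst p p' q') (subst q p' q')"
proof -
  obtain r s where rs: "coord_change r s" "subst p r s = \<^bold>x" "subst q r s = \<^bold>y" "subst r p q = \<^bold>x" "subst s p q = \<^bold>y"
    using pq by (rule coord_changeE)
  obtain r' s' where rs': "coord_change r' s'" "subst p' r' s' = \<^bold>x" "subst q' r' s' = \<^bold>y" "subst r' p' q' = \<^bold>x" "subst s' p' q' = \<^bold>y"
    using pq' by (rule coord_changeE)
  note [simp] = coord_change_0[OF pq] coord_change_0[OF pq'] coord_change_0[OF rs(1)] coord_change_0[OF rs'(1)]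
  have "subst (subst h p' q') (subst r' r s) (subst s' r s) = subst h r s" if "ps_coeff h 0 0 = 0" for h
    by (simp add: subst_subst[symmetric] that) (simp add: subst_subst rs')
  moreover have "subst (subst h r s) (subst p p' q') (subst q p' q') = subst h p' q'" if "ps_coeff h 0 0 = 0" for h
    by (simp add: subst_subst[symmetric] that) (simp add: subst_subst rs)
  ultimately show ?thesis
    unfolding coord_change_def
    by (intro conjI exI[of _ "subst r' r s"] exI[of _ "subst s' r s"]) (simp_all add: rs rs')
qed

text \<open>The geometric series g inverts 1 - x. Substituting z = 1 - f / f(0, 0) for x inverts f
  up to a constant, and convergence is inherited from substitution.\<close>

lemma unit_iff: "f dvd 1 \<longleftrightarrow> ps_coeff f 0 0 \<noteq> 0" for f :: conv_ps
proof
  assume "f dvd 1"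
  then obtain g where "1 = f * g" by (auto simp: dvd_def)
  then have "ps_coeff f 0 0 * ps_coeff g 0 0 = 1"
    by (metis ps_coeff_mult_0_0 ps_coeff_one)
  then show "ps_coeff f 0 0 \<noteq> 0" by auto
next
  assume f: "ps_coeff f 0 0 \<noteq> 0"
  have "convergent2 (fps_const (Abs_fps (\<lambda>_. 1)))"
    by (rule bound_imp_convergent2[of _ 1 1]) auto
  define g where "g = Abs_conv_ps (fps_const (Abs_fps (\<lambda>_. 1)))"
  have "ps_coeff g i j = (if j = 0 then 1 else 0)" for i j
    using \<open>convergent2 _\<close> by (simp add: g_def ps_coeff.rep_eq Abs_conv_ps_inverse)
  then have geo: "g * (1 - \<^bold>x) = 1"
    by (intro conv_ps_eqI) (auto simp: right_diff_distrib mult.commute[of g] ps_coeff_x_mult ps_coeff_one)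
  define z where "z = 1 - ps_const (inverse (ps_coeff f 0 0)) * f"
  have z: "ps_coeff z 0 0 = 0" using f by (simp add: z_def ps_coeff_one ps_coeff_const)
  have "subst g z 0 * (1 - z) = 1"
    using arg_cong[OF geo, of "\<lambda>h. subst h z 0"] z by (simp add: subst_hom)
  then have "f * (ps_const (inverse (ps_coeff f 0 0)) * subst g z 0) = 1"
    by (simp add: z_def mult_ac)
  then show "f dvd 1" by (metis dvdI)
qed

lemma unit_subst:
  assumes "ps_coeff p 0 0 = 0" "ps_coeff q 0 0 = 0"
  shows "subst u p q dvd 1 \<longleftrightarrow> u dvd 1"
  using assms by (simp add: unit_iff)

lemma analytically_equivalentI:
  "coord_change p q \<Longrightarrow> u dvd 1 \<Longrightarrow> f' = u * subst f p q \<Longrightarrow> analytically_equivalent f f'"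
  unfolding analytically_equivalent_def by blast

lemma analytically_equivalent_trans:
  assumes "analytically_equivalent f g" "analytically_equivalent g h"
  shows "analytically_equivalent f h"
proof -
  obtain p q u where 1: "coord_change p q" "u dvd 1" "g = u * subst f p q"
    using assms(1) unfolding analytically_equivalent_def by blast
  obtain p' q' u' where 2: "coord_change p' q'" "u' dvd 1" "h = u' * subst g p' q'"
    using assms(2) unfolding analytically_equivalent_def by blast
  note [simp] = coord_change_0[OF 1(1)] coord_change_0[OF 2(1)]
  show ?thesis
  proof (rule analytically_equivalentI[OF coord_change_subst[OF 1(1) 2(1)]])
    show "h = (u' * subst u p' q') * subst f (subst p p' q') (subst q p' q')"
      unfolding 2(3) 1(3) by (simp add: subst_hom subst_subst mult_ac)
    show "u' * subst u p' q' dvd 1" using 1 2 by (simp add: unit_iff)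
  qed
qed

lemma analytically_equivalent_sym:
  assumes "analytically_equivalent f g"
  shows "analytically_equivalent g f"
proof -
  obtain p q u where 1: "coord_change p q" "u dvd 1" "g = u * subst f p q"
    using assms(1) unfolding analytically_equivalent_def by blast
  obtain r s where rs: "coord_change r s" "subst p r s = \<^bold>x" "subst q r s = \<^bold>y"
    using 1(1) by (rule coord_changeE)
  note [simp] = coord_change_0[OF 1(1)] coord_change_0[OF rs(1)]
  obtain v where v: "1 = u * v" using 1(2) by (auto simp: dvd_def)
  show ?thesis
  proof (rule analytically_equivalentI[OF rs(1)])
    have "subst v r s * subst g r s = subst (u * v) r s * subst (subst f p q) r s"
      unfolding 1(3) by (simp add: subst_hom mult_ac)
    also have "\<dots> = f" unfolding v[symmetric] by (simp add: subst_subst rs)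
    finally show "f = subst v r s * subst g r s" ..
    have "v dvd 1" by (simp add: v)
    then show "subst v r s dvd 1" by (simp add: unit_subst)
  qed
qed

section \<open>Partial derivatives\<close>

lemma ps_coeff_deriv_x [simp]: "ps_coeff (deriv_x f) i j = of_nat (Suc i) * ps_coeff f (Suc i) j"
  by transfer simp

lemma ps_coeff_deriv_y [simp]: "ps_coeff (deriv_y f) i j = of_nat (Suc j) * ps_coeff f i (Suc j)"
proof transfer
  fix F :: "complex fps fps" and i j
  have "fps_deriv F $ j = fps_const (of_nat (Suc j)) * F $ Suc j"
    by (simp only: fps_deriv_nth fps_of_nat Suc_eq_plus1)
  then show "fps_deriv F $ j $ i = of_nat (Suc j) * F $ Suc j $ i"
    by (simp only: fps_mult_left_const_nth)
qed

lemma deriv_x_mult: "deriv_x (f * g) = deriv_x f * g + f * deriv_x g"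
proof transfer
  fix F G :: "complex fps fps"
  show "Abs_fps (\<lambda>j. fps_deriv ((F * G) $ j)) =
    Abs_fps (\<lambda>j. fps_deriv (F $ j)) * G + F * Abs_fps (\<lambda>j. fps_deriv (G $ j))"
    by (rule fps_ext) (simp add: fps_mult_nth fps_deriv_sum sum.distrib add.commute)
qed

lemma deriv_y_mult: "deriv_y (f * g) = deriv_y f * g + f * deriv_y g"
  by transfer simp

lemma deriv_linear [simp]:
  "deriv_x (f + g) = deriv_x f + deriv_x g" "deriv_x (f - g) = deriv_x f - deriv_x g" "deriv_x (- f) = - deriv_x f"
  "deriv_y (f + g) = deriv_y f + deriv_y g" "deriv_y (f - g) = deriv_y f - deriv_y g" "deriv_y (- f) = - deriv_y f"
  by (rule conv_ps_eqI, simp add: algebra_simps)+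

lemma deriv_const [simp]: "deriv_x (ps_const c) = 0" "deriv_y (ps_const c) = 0"
  by (rule conv_ps_eqI, simp add: ps_coeff_const)+

lemma deriv_numerals [simp]:
  "deriv_x 0 = 0" "deriv_x 1 = 0" "deriv_x (numeral k) = 0" "deriv_x (of_nat n) = 0"
  "deriv_y 0 = 0" "deriv_y 1 = 0" "deriv_y (numeral k) = 0" "deriv_y (of_nat n) = 0"
  using deriv_const[of 0] deriv_const[of 1] deriv_const[of "numeral k"] deriv_const[of "of_nat n"]
  by (simp_all add: ps_const_numeral ps_const_of_nat)

lemma deriv_variables [simp]:
  "deriv_x \<^bold>x = 1" "deriv_x \<^bold>y = 0" "deriv_y \<^bold>x = 0" "deriv_y \<^bold>y = 1"
  by (rule conv_ps_eqI, simp add: ps_coeff_x ps_coeff_y ps_coeff_one)+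

lemma deriv_x_power: "deriv_x (f ^ n) = of_nat n * f ^ (n - 1) * deriv_x f"
proof (induction n)
  case (Suc n)
  then show ?case by (cases n) (simp_all add: deriv_x_mult algebra_simps)
qed simp

lemma deriv_y_power: "deriv_y (f ^ n) = of_nat n * f ^ (n - 1) * deriv_y f"
proof (induction n)
  case (Suc n)
  then show ?case by (cases n) (simp_all add: deriv_y_mult algebra_simps)
qed simp

text \<open>The defect D of the chain rule is a derivation along the substitution and vanishes on x,
  y and constants, hence on all monomials. Differentiation costs one order, which the density
  principle tolerates.\<close>

lemma deriv_y_subst:
  assumes [simp]: "ps_coeff p 0 0 = 0" "ps_coeff q 0 0 = 0"
  shows "deriv_y (subst f p q) = subst (deriv_x f) p q * deriv_y p + subst (deriv_y f) p q * deriv_y q"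
proof -
  define D where "D f = deriv_y (subst f p q) - (subst (deriv_x f) p q * deriv_y p + subst (deriv_y f) p q * deriv_y q)" for f
  have D_mult: "D (f * g) = D f * subst g p q + subst f p q * D g" for f g
    by (simp add: D_def subst_hom deriv_x_mult deriv_y_mult algebra_simps)
  have D_power: "D (f ^ n) = 0" if "D f = 0" for f n
  proof (induction n)
    case (Suc n)
    then show ?case using that by (simp add: D_mult)
  qed (simp add: D_def)
  have "D f = 0"
  proof (rule additive_eq_zeroI[of D])
    show "D (f + g) = D f + D g" for f g
      by (simp add: D_def subst_hom algebra_simps)
    have "D \<^bold>x = 0" "D \<^bold>y = 0" "D (ps_const c) = 0" for c
      by (simp_all add: D_def)
    then show "D (ps_const c * \<^bold>x ^ i * \<^bold>y ^ j) = 0" for c i j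
      by (simp add: D_mult D_power)
    fix N f assume f: "ord_ge (2 * N + 1) f"
    have "ord_ge N (deriv_x f)" "ord_ge N (deriv_y f)" "ord_ge (N + 1) (subst f p q)"
      using f ord_ge_mono[OF f, of "N + 1"] ord_ge_subst[of p q "N + 1" f] by (auto simp: ord_ge_def)
    moreover from this(3) have "ord_ge N (deriv_y (subst f p q))"
      by (auto simp: ord_ge_def)
    ultimately show "ord_ge N (D f)"
      unfolding D_def
      by (intro ord_ge_diff ord_ge_add) (auto simp: mult.commute[of "subst _ _ _"] intro!: ord_ge_mult_left ord_ge_subst)
  qed
  then show ?thesis by (simp add: D_def)
qed

section \<open>Roots of units\<close>

lemma ex_complex_root: "m > 0 \<Longrightarrow> \<exists>w. w ^ m = (c :: complex)"
proof -
  assume m: "m > 0"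
  have "\<exists>z. cmod z ^ m = cmod c \<and> z ^ m = c"
  proof (cases "c = 0")
    case False
    have "exp (Ln c / of_nat m) ^ m = c"
      using m False by (simp flip: exp_of_nat_mult)
    then show ?thesis by (metis norm_power)
  qed (use m in \<open>auto intro!: exI[of _ 0]\<close>)
  then show ?thesis by blast
qed

text \<open>With d^m = c = u(0, 0), the series q(y) = (d + y)^m - c has a simple zero at 0, since
  its derivative there is m d^(m - 1). If s inverts q, then d + s evaluated at u - c is a
  root.\<close>

lemma unit_root:
  assumes m: "m > 0" and u: "ps_coeff u 0 0 \<noteq> 0"
  obtains w where "w ^ m = u"
proof -
  define c where "c = ps_coeff u 0 0"
  obtain d where d: "d ^ m = c" using ex_complex_root[OF m] by blast
  have d0: "d \<noteq> 0" using d u m by (auto simp: c_def power_0_left)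
  define q where "q = (ps_const d + \<^bold>y) ^ m - ps_const c"
  have "ps_coeff q 0 1 = ps_coeff (deriv_y q) 0 0"
    by simp
  also have "\<dots> = of_nat m * d ^ (m - 1)"
    by (simp add: q_def deriv_y_power ps_coeff_of_nat ps_coeff_const ps_coeff_one del: ps_coeff_deriv_y)
  finally have "ps_coeff q 0 1 \<noteq> 0" using m d0 by simp
  moreover have q0[simp]: "ps_coeff q 0 0 = 0" by (simp add: q_def ps_coeff_const d)
  ultimately have "coord_change \<^bold>x q"
    by (intro coord_changeI) (simp_all add: ps_coeff_x)
  then obtain r s where rs: "coord_change r s" "subst \<^bold>x r s = \<^bold>x" "subst q r s = \<^bold>y"
    by (rule coord_changeE)
  note [simp] = coord_change_0[OF rs(1)]
  have "\<^bold>y = (ps_const d + s) ^ m - ps_const c"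
    unfolding rs(3)[symmetric] by (simp add: q_def subst_hom)
  moreover define t where "t = u - ps_const c"
  have t0: "ps_coeff t 0 0 = 0" by (simp add: t_def c_def ps_coeff_const)
  ultimately have "subst \<^bold>y 0 t = subst ((ps_const d + s) ^ m - ps_const c) 0 t"
    by simp
  then have "t = (ps_const d + subst s 0 t) ^ m - ps_const c"
    by (simp add: t0 subst_hom)
  then have "(ps_const d + subst s 0 t) ^ m = u"
    by (simp add: t_def)
  then show ?thesis by (metis that)
qed

section \<open>Series in one variable and division by a quadratic polynomial\<close>

text \<open>The ring C{x}, realized as a subring of C{x,y}; \<open>restrict_x\<close> is the
  retraction onto it.\<close>

definition x_series :: "conv_ps \<Rightarrow> bool" where
  "x_series a \<longleftrightarrow> (\<forall>i j. j > 0 \<longrightarrow> ps_coeff a i j = 0)"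

lemma x_series_restrict_x [simp]: "x_series (restrict_x f)"
  by (simp add: x_series_def)

lemma restrict_x_id: "x_series a \<Longrightarrow> restrict_x a = a"
  by (rule conv_ps_eqI) (simp add: x_series_def)

lemma restrict_x_hom [simp]:
  "restrict_x (f + g) = restrict_x f + restrict_x g" "restrict_x (f - g) = restrict_x f - restrict_x g"
  "restrict_x (- f) = - restrict_x f" "restrict_x (f * g) = restrict_x f * restrict_x g"
  "restrict_x (f ^ n) = restrict_x f ^ n" "restrict_x \<^bold>x = \<^bold>x" "restrict_x \<^bold>y = 0"
  "restrict_x (ps_const c) = ps_const c" "restrict_x 0 = 0" "restrict_x 1 = 1"
  "restrict_x (of_nat k) = of_nat k" "restrict_x (numeral l) = numeral l"
  by (simp_all add: restrict_x_eq_subst subst_hom)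

lemma x_series_iff: "x_series a \<longleftrightarrow> restrict_x a = a"
  by (metis restrict_x_id x_series_restrict_x)

lemma x_series_intros [intro, simp]:
  "x_series a \<Longrightarrow> x_series b \<Longrightarrow> x_series (a + b)" "x_series a \<Longrightarrow> x_series b \<Longrightarrow> x_series (a - b)"
  "x_series a \<Longrightarrow> x_series (- a)" "x_series a \<Longrightarrow> x_series b \<Longrightarrow> x_series (a * b)"
  "x_series a \<Longrightarrow> x_series (a ^ n)" "x_series \<^bold>x" "x_series (ps_const c)" "x_series 0" "x_series 1"
  "x_series (of_nat k)" "x_series (numeral l)"
  by (simp_all add: x_series_iff)

lemma subst_x_series:
  assumes "x_series a" "ps_coeff p 0 0 = 0" "ps_coeff q 0 0 = 0"
  shows "subst a p q = subst a p 0"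
proof -
  have "subst (subst a \<^bold>x 0) p q = subst a p 0"
    using assms by (simp add: subst_subst)
  then show ?thesis using assms(1) by (simp add: x_series_iff restrict_x_eq_subst)
qed

lemma subst_x_series_x:
  assumes "x_series a" "ps_coeff q 0 0 = 0"
  shows "subst a \<^bold>x q = a"
  using subst_x_series[of a "\<^bold>x" q] assms by (simp add: x_series_iff restrict_x_eq_subst)

lemma x_series_eqI:
  assumes "x_series a" "x_series b" "\<And>i. ps_coeff a i 0 = ps_coeff b i 0"
  shows "a = b"
  using assms unfolding x_series_def by (intro conv_ps_eqI) (metis neq0_conv)

lemma x_series_split:
  assumes "x_series a" "\<And>i. i < N \<Longrightarrow> ps_coeff a i 0 = 0"
  obtains b where "a = \<^bold>x ^ N * b" "x_series b" "ps_coeff b 0 0 = ps_coeff a N 0"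
proof -
  have "ps_coeff a i j = 0" if "i < N" for i j
    using that assms unfolding x_series_def by (cases "j = 0") auto
  then have "\<^bold>x ^ N dvd a" by (auto simp: x_power_dvd_iff)
  then obtain b where b: "a = \<^bold>x ^ N * b" by blast
  have c: "ps_coeff a (N + i) j = ps_coeff b i j" for i j
    by (simp add: b ps_coeff_x_power_mult)
  have "x_series b" using assms(1) unfolding x_series_def c[symmetric] by blast
  then show ?thesis using that b c[of 0] by simp
qed

lemma x_series_order:
  assumes "x_series a" "a \<noteq> 0"
  obtains N b where "a = \<^bold>x ^ N * b" "x_series b" "ps_coeff b 0 0 \<noteq> 0"
proof -
  have "\<exists>i. ps_coeff a i 0 \<noteq> 0"
    using assms x_series_eqI[of a 0] by auto
  then have *: "ps_coeff a (LEAST i. ps_coeff a i 0 \<noteq> 0) 0 \<noteq> 0" by (rule LeastI_ex)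
  show ?thesis
    by (rule x_series_split[OF assms(1), of "LEAST i. ps_coeff a i 0 \<noteq> 0"])
       (use not_less_Least * that in fastforce)+
qed

text \<open>Setting y = 0 in a root of u preserves the equation and makes the root a series in x.
  The inverse below is obtained in the same way.\<close>

lemma x_series_root:
  assumes "m > 0" "ps_coeff u 0 0 \<noteq> 0" "x_series u"
  obtains w where "w ^ m = u" "x_series w" "ps_coeff w 0 0 \<noteq> 0"
proof -
  obtain w where w: "w ^ m = u" using unit_root[OF assms(1,2)] .
  have "restrict_x w ^ m = u"
    using arg_cong[OF w, of restrict_x] assms(3) by (simp add: restrict_x_id)
  moreover from this have "ps_coeff (restrict_x w) 0 0 \<noteq> 0"
    using assms(1,2) by (metis ps_coeff_power_0_0 power_0_left not_gr_zero)
  ultimately show ?thesis using that[of "restrict_x w"] by simp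
qed

lemma x_series_inverse:
  assumes "ps_coeff u 0 0 \<noteq> 0" "x_series u"
  obtains w where "w * u = 1" "x_series w" "ps_coeff w 0 0 \<noteq> 0"
proof -
  obtain w where w: "1 = u * w" using assms(1) unfolding unit_iff[symmetric] dvd_def by blast
  have "restrict_x w * u = 1"
    using arg_cong[OF w, of restrict_x] assms(2) by (simp add: restrict_x_id mult.commute)
  moreover from this have "ps_coeff (restrict_x w) 0 0 \<noteq> 0"
    by (metis mult_zero_left ps_coeff_mult_0_0 ps_coeff_one zero_neq_one)
  ultimately show ?thesis using that[of "restrict_x w"] by simp
qed

lemma coord_change_shift:
  assumes "x_series b" "ps_coeff b 0 0 = 0"
  shows "coord_change \<^bold>x (\<^bold>y + b)"
  using assms by (intro coord_changeI) (simp_all add: ps_coeff_x ps_coeff_y x_series_def)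

section \<open>Even and odd parts in y; division by quadratic polynomials\<close>

lift_definition even_y :: "conv_ps \<Rightarrow> conv_ps" is "\<lambda>F. Abs_fps (\<lambda>j. F $ (2 * j))"
proof -
  fix F :: "complex fps fps" assume "convergent2 F"
  \<comment> \<open>The bound is taken for F twice for the sake of C \<ge> 1, which allows the
    exponent i + 2j to be enlarged to 2 (i + j).\<close>
  then obtain M C where b: "M \<ge> 0" "C \<ge> 1" "\<And>i j. norm (F $ j $ i) \<le> M * C ^ (i + j)"
    using convergent2_two_bounds[of F F] by metis
  have "norm (F $ (2 * j) $ i) \<le> M * (C\<^sup>2) ^ (i + j)" for i j
    unfolding power_mult[symmetric]
    by (rule order_trans[OF b(3)]) (use b in \<open>auto intro!: mult_left_mono power_increasing\<close>)
  then show "convergent2 (Abs_fps (\<lambda>j. F $ (2 * j)))"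
    by (intro bound_imp_convergent2[of _ M "C\<^sup>2"]) simp
qed

lemma ps_coeff_even_y [simp]: "ps_coeff (even_y f) i j = ps_coeff f i (2 * j)"
  by transfer simp

lemma even_odd_decomposition: "f = subst (even_y f) \<^bold>x (\<^bold>y\<^sup>2) + \<^bold>y * subst (even_y (shift_y f)) \<^bold>x (\<^bold>y\<^sup>2)"
proof -
  have [simp]: "ps_coeff (\<^bold>y\<^sup>2) 0 0 = 0" by simp
  define D where "D f = f - (subst (even_y f) \<^bold>x (\<^bold>y\<^sup>2) + \<^bold>y * subst (even_y (shift_y f)) \<^bold>x (\<^bold>y\<^sup>2))" for f
  have lin: "even_y (f + g) = even_y f + even_y g" "shift_y (f + g) = shift_y f + shift_y g" for f g
    by (rule conv_ps_eqI, simp)+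
  have "D f = 0"
  proof (rule additive_eq_zeroI[of D])
    show "D (f + g) = D f + D g" for f g
      by (simp add: D_def lin subst_hom algebra_simps)
    show "D (ps_const c * \<^bold>x ^ i * \<^bold>y ^ j) = 0" for c i j
    proof (cases "even j")
      case True
      then have "even_y (ps_const c * \<^bold>x ^ i * \<^bold>y ^ j) = ps_const c * \<^bold>x ^ i * \<^bold>y ^ (j div 2)"
          "even_y (shift_y (ps_const c * \<^bold>x ^ i * \<^bold>y ^ j)) = 0"
        by (intro conv_ps_eqI; auto simp: ps_coeff_monomial)+
      then show ?thesis using True by (simp add: D_def subst_monomial flip: power_mult)
    next
      case False
      then have "even_y (ps_const c * \<^bold>x ^ i * \<^bold>y ^ j) = 0"
          "even_y (shift_y (ps_const c * \<^bold>x ^ i * \<^bold>y ^ j)) = ps_const c * \<^bold>x ^ i * \<^bold>y ^ (j div 2)"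
        by (intro conv_ps_eqI; use False in \<open>auto simp: ps_coeff_monomial\<close>)+
      then show ?thesis using False
        by (auto simp: D_def subst_monomial elim!: oddE simp flip: power_mult)
    qed
    \<comment> \<open>\<open>even_y\<close> halves exponents of y and \<open>shift_y\<close> lowers
      them by one. This loss is the reason for the order 2 N + 1 in the density principle.\<close>
    fix N f assume f: "ord_ge (2 * N + 1) f"
    then have "ord_ge N (even_y f)" "ord_ge N (even_y (shift_y f))" "ord_ge N f"
      by (auto simp: ord_ge_def)
    then show "ord_ge N (D f)"
      unfolding D_def by (intro ord_ge_diff ord_ge_add ord_ge_mult_left ord_ge_subst) auto
  qed
  then show ?thesis by (simp add: D_def)
qed

text \<open>An even series is a series in x and z = y^2. Expanded around z = b, it is a multiple of
  z - b plus its value at z = b, which is a series in x. The odd part is y times an even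
  series.\<close>

lemma division_pure_quadratic:
  assumes b: "x_series b" "ps_coeff b 0 0 = 0"
  obtains q r0 r1 where "f = q * (\<^bold>y\<^sup>2 - b) + r0 + r1 * \<^bold>y" "x_series r0" "x_series r1"
proof -
  have [simp]: "ps_coeff (\<^bold>y\<^sup>2) 0 0 = 0" "ps_coeff (\<^bold>y + b) 0 0 = 0" "ps_coeff (\<^bold>y\<^sup>2 - b) 0 0 = 0"
    using b by simp_all
  have half: "\<exists>q r. subst e \<^bold>x (\<^bold>y\<^sup>2) = q * (\<^bold>y\<^sup>2 - b) + r \<and> x_series r" for e
  proof -
    define e' where "e' = subst e \<^bold>x (\<^bold>y + b)"
    have "subst e \<^bold>x (\<^bold>y\<^sup>2) = subst e' \<^bold>x (\<^bold>y\<^sup>2 - b)"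
      using b by (simp add: e'_def subst_subst subst_hom subst_x_series_x)
    also have "\<dots> = subst (restrict_x e' + \<^bold>y * shift_y e') \<^bold>x (\<^bold>y\<^sup>2 - b)"
      by (metis restrict_x_plus_shift_y)
    also have "\<dots> = subst (shift_y e') \<^bold>x (\<^bold>y\<^sup>2 - b) * (\<^bold>y\<^sup>2 - b) + restrict_x e'"
      using b by (simp add: subst_hom subst_x_series_x mult.commute)
    finally show ?thesis by (blast intro: x_series_restrict_x)
  qed
  obtain q0 r0 where 0: "subst (even_y f) \<^bold>x (\<^bold>y\<^sup>2) = q0 * (\<^bold>y\<^sup>2 - b) + r0" "x_series r0"
    using half by blast
  obtain q1 r1 where 1: "subst (even_y (shift_y f)) \<^bold>x (\<^bold>y\<^sup>2) = q1 * (\<^bold>y\<^sup>2 - b) + r1" "x_series r1"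
    using half by blast
  have "f = (q0 * (\<^bold>y\<^sup>2 - b) + r0) + \<^bold>y * (q1 * (\<^bold>y\<^sup>2 - b) + r1)"
    using even_odd_decomposition[of f] unfolding 0 1 .
  then have "f = (q0 + \<^bold>y * q1) * (\<^bold>y\<^sup>2 - b) + r0 + r1 * \<^bold>y"
    by (simp add: algebra_simps)
  then show ?thesis using that 0 1 by blast
qed

text \<open>Completing the square by the shift y + a/2 reduces this to the pure case.\<close>

lemma division_quadratic:
  assumes a: "x_series a" "ps_coeff a 0 0 = 0" and b: "x_series b" "ps_coeff b 0 0 = 0"
  obtains q r0 r1 where "f = q * (\<^bold>y\<^sup>2 - a * \<^bold>y - b) + r0 + r1 * \<^bold>y" "x_series r0" "x_series r1"
proof -
  define h where "h = ps_const (1 / 2) * a"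
  have a2: "a = 2 * h"
    by (rule conv_ps_eqI) (simp add: h_def)
  have h: "x_series h" "ps_coeff h 0 0 = 0" using a by (simp_all add: h_def)
  obtain q r0 r1 where d: "subst f \<^bold>x (\<^bold>y + h) = q * (\<^bold>y\<^sup>2 - (b + h\<^sup>2)) + r0 + r1 * \<^bold>y" "x_series r0" "x_series r1"
    by (rule division_pure_quadratic[of "b + h\<^sup>2"]) (use b h in auto)
  have "f = subst (subst f \<^bold>x (\<^bold>y + h)) \<^bold>x (\<^bold>y - h)"
    using h by (simp add: subst_subst subst_hom subst_x_series_x)
  also have "\<dots> = subst q \<^bold>x (\<^bold>y - h) * ((\<^bold>y - h)\<^sup>2 - (b + h\<^sup>2)) + r0 + r1 * (\<^bold>y - h)"
    unfolding d using h b d by (simp add: subst_hom subst_x_series_x)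
  also have "\<dots> = subst q \<^bold>x (\<^bold>y - h) * (\<^bold>y\<^sup>2 - a * \<^bold>y - b) + (r0 - r1 * h) + r1 * \<^bold>y"
    by (simp add: a2 power2_eq_square algebra_simps)
  finally show ?thesis using that h d by blast
qed

text \<open>Read y^2 q = a y q + b q - r0 - r1 y in degrees at least 2 in y, where r0 and r1 do not
  occur. As x divides a and b, divisibility of q by x^N improves to x^(N + 1); hence q = 0.\<close>

lemma division_quadratic_unique:
  assumes a: "x_series a" "ps_coeff a 0 0 = 0" and b: "x_series b" "ps_coeff b 0 0 = 0"
    and r: "x_series r0" "x_series r1" and eq: "q * (\<^bold>y\<^sup>2 - a * \<^bold>y - b) + r0 + r1 * \<^bold>y = 0"
  shows "q = 0" "r0 = 0" "r1 = 0"
proof -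
  obtain a' where a': "a = \<^bold>x * a'" "x_series a'" using x_series_split[of a 1] a by auto
  obtain b' where b': "b = \<^bold>x * b'" "x_series b'" using x_series_split[of b 1] b by auto
  have eq': "\<^bold>y ^ 2 * q = \<^bold>y * (a * q) + b * q - r0 - \<^bold>y * r1"
    using eq by (simp add: algebra_simps)
  have "\<^bold>x ^ N dvd q" for N
  proof (induction N)
    case (Suc N)
    then have "\<^bold>x ^ Suc N dvd a * q" "\<^bold>x ^ Suc N dvd b * q"
      unfolding a'(1) b'(1) by (auto intro!: mult_dvd_mono simp: mult.assoc)
    then have z: "ps_coeff (a * q) i j = 0" "ps_coeff (b * q) i j = 0" if "i < Suc N" for i j
      using that unfolding x_power_dvd_iff by auto
    have "ps_coeff q i j = 0" if "i < Suc N" for i j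
    proof -
      have "ps_coeff q i j = ps_coeff (\<^bold>y ^ 2 * q) i (j + 2)"
        by (simp only: ps_coeff_y_power_mult) simp
      also have "\<dots> = 0"
        unfolding eq' using z[OF that] r by (simp add: ps_coeff_y_mult x_series_def)
      finally show ?thesis .
    qed
    then show ?case unfolding x_power_dvd_iff by blast
  qed simp
  then have "ps_coeff q i j = 0" for i j
    unfolding x_power_dvd_iff by blast
  then show q0: "q = 0" by (intro conv_ps_eqI) simp
  have "ps_coeff r0 i j = 0" "ps_coeff r1 i j = 0" for i j
  proof -
    have "ps_coeff r0 i 0 = 0" "ps_coeff r1 i 0 = 0" for i
      using arg_cong[OF eq, of "\<lambda>h. ps_coeff h i 0"] arg_cong[OF eq, of "\<lambda>h. ps_coeff h i 1"] r
      by (simp_all add: q0 mult.commute[of r1] ps_coeff_y_mult x_series_def)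
    then show "ps_coeff r0 i j = 0" "ps_coeff r1 i j = 0"
      using r by (cases "j = 0"; simp add: x_series_def)+
  qed
  then show "r0 = 0" "r1 = 0" by (intro conv_ps_eqI; simp)+
qed

section \<open>Cuspidal curves\<close>

lemma ps_coeff_subst_x_squared:
  assumes "x_series r"
  shows "ps_coeff (subst r (\<^bold>x\<^sup>2) 0) k 0 = (if even k then ps_coeff r (k div 2) 0 else 0)"
proof -
  have c: "ps_coeff ((\<^bold>x\<^sup>2) ^ i * 0 ^ j) k 0 = (if j = 0 then if 2 * i = k then 1 else 0 else 0)" for i j
  proof (cases j)
    case 0
    then show ?thesis unfolding power_mult[symmetric] by (auto simp: ps_coeff_x_power)
  qed simp
  have "ps_coeff (subst r (\<^bold>x\<^sup>2) 0) k 0 =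
      (\<Sum>i\<le>k. \<Sum>j\<le>k. if j = 0 then if 2 * i = k then ps_coeff r i 0 else 0 else 0)"
    by (subst ps_coeff_subst) (auto simp: c if_mult_zero intro!: sum.cong)
  also have "\<dots> = (\<Sum>i\<le>k. if 2 * i = k then ps_coeff r i 0 else 0)"
    by simp
  also have "\<dots> = (if even k then ps_coeff r (k div 2) 0 else 0)"
  proof (cases "even k")
    case True
    then obtain l where l: "k = 2 * l" by blast
    then show ?thesis by (simp add: l)
  next
    case False
    then show ?thesis by (auto intro!: sum.neutral)
  qed
  finally show ?thesis .
qed

text \<open>The right side is the restriction to the parametrized cusp, with x as parameter. Modulo
  the cusp f is r0 + r1 y, which restricts to r0(x^2) + x^n r1(x^2): even exponents against odd
  ones, so nothing cancels.\<close>

lemma cusp_dvd_iff: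
  assumes n: "odd n"
  shows "\<^bold>y\<^sup>2 - \<^bold>x ^ n dvd f \<longleftrightarrow> subst f (\<^bold>x\<^sup>2) (\<^bold>x ^ n) = 0"
proof
  have n0: "n > 0" using n by (cases n) auto
  have [simp]: "ps_coeff (\<^bold>x\<^sup>2) 0 0 = 0" "ps_coeff (\<^bold>x ^ n) 0 0 = 0"
    using n0 by simp_all
  have cusp: "(\<^bold>x\<^sup>2) ^ n = (\<^bold>x ^ n)\<^sup>2"
    by (metis mult.commute power_mult)
  {
    assume "\<^bold>y\<^sup>2 - \<^bold>x ^ n dvd f"
    then show "subst f (\<^bold>x\<^sup>2) (\<^bold>x ^ n) = 0"
      using n0 by (auto simp: dvd_def subst_hom cusp)
  }
  assume 0: "subst f (\<^bold>x\<^sup>2) (\<^bold>x ^ n) = 0"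
  obtain q r0 r1 where d: "f = q * (\<^bold>y\<^sup>2 - \<^bold>x ^ n) + r0 + r1 * \<^bold>y" "x_series r0" "x_series r1"
    by (rule division_pure_quadratic[of "\<^bold>x ^ n" f]) (use n0 in auto)
  define s0 s1 where "s0 = subst r0 (\<^bold>x\<^sup>2) 0" and "s1 = subst r1 (\<^bold>x\<^sup>2) 0"
  have "s0 + \<^bold>x ^ n * s1 = 0"
    using 0 d(2,3) n0
    by (simp add: d(1) subst_hom s0_def s1_def cusp mult.commute
        subst_x_series[of r0 "\<^bold>x\<^sup>2" "\<^bold>x ^ n"] subst_x_series[of r1 "\<^bold>x\<^sup>2" "\<^bold>x ^ n"])
  then have "ps_coeff (s0 + \<^bold>x ^ n * s1) k 0 = 0" for k
    by simp
  then have eq: "ps_coeff s0 k 0 + (if k < n then 0 else ps_coeff s1 (k - n) 0) = 0" for k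
    by (simp only: ps_coeff_add ps_coeff_x_power_mult)
  have "ps_coeff r0 i 0 = 0" for i
    using eq[of "2 * i"] n d(2,3) by (auto simp: s0_def s1_def ps_coeff_subst_x_squared split: if_splits)
  then have "r0 = 0" using d(2) by (intro x_series_eqI) auto
  moreover have "ps_coeff r1 i 0 = 0" for i
    using eq[of "n + 2 * i"] n d(2,3) by (auto simp: s0_def s1_def ps_coeff_subst_x_squared)
  then have "r1 = 0" using d(3) by (intro x_series_eqI) auto
  ultimately show "\<^bold>y\<^sup>2 - \<^bold>x ^ n dvd f" by (simp add: d(1))
qed

lemma shifted_cusp_dvd_iff:
  assumes n: "odd n" and c: "x_series c" "ps_coeff c 0 0 = 0"
  shows "(\<^bold>y - c)\<^sup>2 - \<^bold>x ^ n dvd f \<longleftrightarrow> subst f (\<^bold>x\<^sup>2) (\<^bold>x ^ n + subst c (\<^bold>x\<^sup>2) 0) = 0"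
proof -
  have n0: "n > 0" using n by (cases n) auto
  have [simp]: "ps_coeff (\<^bold>x\<^sup>2) 0 0 = 0" "ps_coeff (\<^bold>x ^ n) 0 0 = 0"
    using n0 by simp_all
  have "(\<^bold>y - c)\<^sup>2 - \<^bold>x ^ n dvd f \<longleftrightarrow> \<^bold>y\<^sup>2 - \<^bold>x ^ n dvd subst f \<^bold>x (\<^bold>y + c)"
  proof
    assume "(\<^bold>y - c)\<^sup>2 - \<^bold>x ^ n dvd f"
    from subst_dvd[OF _ _ this, of "\<^bold>x" "\<^bold>y + c"] show "\<^bold>y\<^sup>2 - \<^bold>x ^ n dvd subst f \<^bold>x (\<^bold>y + c)"
      using c by (simp add: subst_hom subst_x_series_x)
  next
    assume "\<^bold>y\<^sup>2 - \<^bold>x ^ n dvd subst f \<^bold>x (\<^bold>y + c)"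
    from subst_dvd[OF _ _ this, of "\<^bold>x" "\<^bold>y - c"] show "(\<^bold>y - c)\<^sup>2 - \<^bold>x ^ n dvd f"
      using c by (simp add: subst_hom subst_x_series_x subst_subst)
  qed
  also have "\<dots> \<longleftrightarrow> subst f (\<^bold>x\<^sup>2) (\<^bold>x ^ n + subst c (\<^bold>x\<^sup>2) 0) = 0"
    using c n0 by (simp add: cusp_dvd_iff[OF n] subst_subst subst_hom subst_x_series[of c "\<^bold>x\<^sup>2" "\<^bold>x ^ n"])
  finally show ?thesis .
qed

text \<open>Its multiples are the kernel of the restriction to the parametrized branch, a
  homomorphism into an integral domain.\<close>

lemma prime_elem_shifted_cusp:
  assumes n: "odd n" and c: "x_series c" "ps_coeff c 0 0 = 0"
  shows "prime_elem ((\<^bold>y - c)\<^sup>2 - \<^bold>x ^ n)"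
proof (rule prime_elemI)
  have n0: "n > 0" using n by (cases n) auto
  show "\<not> (\<^bold>y - c)\<^sup>2 - \<^bold>x ^ n dvd 1" using c n0 by (simp add: unit_iff)
  show "(\<^bold>y - c)\<^sup>2 - \<^bold>x ^ n \<noteq> 0"
  proof
    assume "(\<^bold>y - c)\<^sup>2 - \<^bold>x ^ n = 0"
    then have "\<^bold>y * (\<^bold>y * 1) - 2 * (\<^bold>y * c) + c\<^sup>2 - \<^bold>x ^ n = 0" by (simp add: power2_eq_square algebra_simps)
    then have "ps_coeff (\<^bold>y * (\<^bold>y * 1) - 2 * (\<^bold>y * c) + c\<^sup>2 - \<^bold>x ^ n) 0 2 = 0" by simp
    moreover have "ps_coeff (c\<^sup>2) 0 2 = 0" "ps_coeff (\<^bold>x ^ n) 0 2 = 0" "ps_coeff c 0 1 = 0"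
      using c(1) x_series_intros(5)[OF c(1)] by (simp_all add: x_series_def ps_coeff_x_power)
    ultimately show False by (simp add: ps_coeff_y_mult ps_coeff_y ps_coeff_one)
  qed
  fix a b assume "(\<^bold>y - c)\<^sup>2 - \<^bold>x ^ n dvd a * b"
  then show "(\<^bold>y - c)\<^sup>2 - \<^bold>x ^ n dvd a \<or> (\<^bold>y - c)\<^sup>2 - \<^bold>x ^ n dvd b"
    using n0 c by (simp add: shifted_cusp_dvd_iff[OF n c] subst_mult)
qed

lemma y_dvd_iff_restrict_x: "\<^bold>y dvd f \<longleftrightarrow> restrict_x f = 0"
proof
  assume "restrict_x f = 0"
  then have "ps_coeff (restrict_x f) i 0 = 0" for i by simp
  then show "\<^bold>y dvd f" by (simp add: y_dvd_iff)
next
  assume "\<^bold>y dvd f"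
  then show "restrict_x f = 0" by (intro conv_ps_eqI) (simp add: y_dvd_iff)
qed

lemma prime_elem_y: "prime_elem \<^bold>y"
  by (rule prime_elemI) (auto simp: unit_iff y_dvd_iff_restrict_x)

section \<open>Codimension of ideals\<close>

lemmas ideal_base = module.span_base[OF module_conv_ps, folded ideal_generated_def]
lemmas ideal_add = module.span_add[OF module_conv_ps, folded ideal_generated_def]
lemmas ideal_diff = module.span_diff[OF module_conv_ps, folded ideal_generated_def]
lemmas ideal_mult = module.span_scale[OF module_conv_ps, folded ideal_generated_def]

lemma ideal_generated_minimal:
  assumes "A \<subseteq> N" "0 \<in> N" "\<And>f g. f \<in> N \<Longrightarrow> g \<in> N \<Longrightarrow> f + g \<in> N" "\<And>f g. g \<in> N \<Longrightarrow> f * g \<in> N"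
  shows "ideal_generated A \<subseteq> N"
  unfolding ideal_generated_def
  by (rule module.span_minimal[OF module_conv_ps])
     (use assms in \<open>auto simp: module.subspace_def[OF module_conv_ps]\<close>)

text \<open>Functionals \<phi> that cut out J, together with a dual system e, give a basis of the
  quotient. Since \<open>codim\<close> takes the size of an arbitrarily chosen basis, all quotient
  bases must also be shown to have d elements.\<close>

lemma codim_eqI:
  fixes \<phi> :: "nat \<Rightarrow> conv_ps \<Rightarrow> complex" and e :: "nat \<Rightarrow> conv_ps"
  assumes add: "\<And>i f g. \<phi> i (f + g) = \<phi> i f + \<phi> i g"
    and scale: "\<And>i c f. \<phi> i (ps_const c * f) = c * \<phi> i f"
    and dual: "\<And>i j. i < d \<Longrightarrow> j < d \<Longrightarrow> \<phi> i (e j) = (if i = j then 1 else 0)"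
    and J: "J = {h. \<forall>i<d. \<phi> i h = 0}"
  shows "codim J = enat d"
proof -
  interpret vs: vector_space "\<lambda>c f. ps_const c * f"
    by unfold_locales (simp_all add: algebra_simps ps_const_add ps_const_mult)
  have zero: "\<phi> i 0 = 0" for i using scale[of i 0 0] by simp
  have diff: "\<phi> i (f - g) = \<phi> i f - \<phi> i g" for i f g
    using add[of i "f - g" g] by simp
  have sum: "\<phi> i (sum F A) = (\<Sum>a\<in>A. \<phi> i (F a))" for i and F :: "nat \<Rightarrow> conv_ps" and A
    by (induction A rule: infinite_finite_induct) (simp_all add: zero add)
  have inj: "inj_on e {..<d}"
    by (rule inj_onI) (metis dual lessThan_iff zero_neq_one)
  define E where "E = e ` {..<d}"
  have comb: "\<phi> i (\<Sum>j<d. ps_const (c j) * e j) = c i" if "i < d" for c i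
  proof -
    have "\<phi> i (\<Sum>j<d. ps_const (c j) * e j) = (\<Sum>j<d. if i = j then c j else 0)"
      unfolding sum scale using that by (intro sum.cong) (auto simp: dual)
    then show ?thesis using that by simp
  qed
  have comb': "\<phi> i (\<Sum>b\<in>E. ps_const (c b) * b) = c (e i)" if "i < d" for c i
    using comb[OF that, of "c \<circ> e"] by (simp add: E_def sum.reindex[OF inj])
  have basis: "quotient_basis J E"
    unfolding quotient_basis_def
  proof (intro conjI allI)
    show "finite E" by (simp add: E_def)
    fix h
    have "h - (\<Sum>b\<in>E. ps_const (c b) * b) \<in> J \<longleftrightarrow> (\<forall>i<d. c (e i) = \<phi> i h)" for c
      using comb' by (auto simp: J diff)
    then have iff: "c \<in> E \<rightarrow>\<^sub>E UNIV \<and> h - (\<Sum>b\<in>E. ps_const (c b) * b) \<in> J \<longleftrightarrow>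
        c = restrict (\<lambda>b. \<phi> (inv_into {..<d} e b) h) E" for c
      unfolding fun_eq_iff by (auto simp: E_def inj restrict_def PiE_def extensional_def)
    show "\<exists>!c. c \<in> E \<rightarrow>\<^sub>E UNIV \<and> h - (\<Sum>b\<in>E. ps_const (c b) * b) \<in> J"
      unfolding iff by simp
  qed
  have finE: "finite E" by (simp add: E_def)
  have cardE: "card E = d" by (simp add: E_def card_image inj)
  have indepE: "vs.independent E"
  proof -
    have False if "(\<Sum>b\<in>E. ps_const (c b) * b) = 0" "b \<in> E" "c b \<noteq> 0" for c b
      using that comb'[of _ c] zero by (auto simp: E_def)
    then show ?thesis by (auto simp: vs.dependent_finite E_def)
  qed
  \<comment> \<open>The projection onto the span of E with kernel J. It replaces the quotient space,
    so that dimension arguments take place inside the ring.\<close>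
  define \<pi> where "\<pi> h = (\<Sum>j<d. ps_const (\<phi> j h) * e j)" for h
  interpret \<pi>: Vector_Spaces.linear "\<lambda>c f. ps_const c * f" "\<lambda>c f. ps_const c * f" \<pi>
  proof unfold_locales
    show "\<pi> (f + g) = \<pi> f + \<pi> g" for f g
      by (simp add: \<pi>_def add ps_const_add distrib_right sum.distrib)
    show "\<pi> (ps_const c * f) = ps_const c * \<pi> f" for c f
      by (simp add: \<pi>_def scale sum_distrib_left)
  qed
  have \<pi>0: "\<pi> h = 0 \<longleftrightarrow> h \<in> J" for h
  proof
    assume "\<pi> h = 0"
    then show "h \<in> J" unfolding J using comb[of _ "\<lambda>j. \<phi> j h"] by (simp add: \<pi>_def zero)
  qed (simp add: \<pi>_def J)
  have unique: "card B = d" if B: "quotient_basis J B" for B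
  proof -
    have fin: "finite B" using B by (simp add: quotient_basis_def)
    have ex: "\<exists>!c. c \<in> B \<rightarrow>\<^sub>E UNIV \<and> h - (\<Sum>b\<in>B. ps_const (c b) * b) \<in> J" for h
      using B by (simp add: quotient_basis_def)
    \<comment> \<open>Uniqueness of coordinates is compared for c and the zero function, both
      restricted to B because coordinates are extensional functions. The result is independence
      modulo J.\<close>
    have null: "\<forall>b\<in>B. c b = 0" if c: "(\<Sum>b\<in>B. ps_const (c b) * b) \<in> J" for c
    proof -
      have "(\<Sum>b\<in>B. ps_const (restrict c B b) * b) = (\<Sum>b\<in>B. ps_const (c b) * b)"
        by (intro sum.cong) auto
      then have "(\<Sum>b\<in>B. ps_const (c b) * b) - (\<Sum>b\<in>B. ps_const (restrict c B b) * b) \<in> J"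
        by (simp add: J zero)
      moreover have "(\<Sum>b\<in>B. ps_const (restrict (\<lambda>_. 0) B b) * b) = 0"
        by (intro sum.neutral) auto
      then have "(\<Sum>b\<in>B. ps_const (c b) * b) - (\<Sum>b\<in>B. ps_const (restrict (\<lambda>_. 0) B b) * b) \<in> J"
        using c by simp
      moreover obtain c0 where "\<And>c'. c' \<in> B \<rightarrow>\<^sub>E UNIV \<Longrightarrow>
          (\<Sum>b\<in>B. ps_const (c b) * b) - (\<Sum>b\<in>B. ps_const (c' b) * b) \<in> J \<Longrightarrow> c' = c0"
        using ex[of "\<Sum>b\<in>B. ps_const (c b) * b"] by blast
      ultimately have "restrict c B = c0" "restrict (\<lambda>_. 0) B = c0"
        by simp_all
      then show ?thesis by (metis (mono_tags) restrict_apply')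
    qed
    have J0: "0 \<in> J" by (simp add: J zero)
    have indepB: "vs.independent B"
      unfolding vs.dependent_finite[OF fin] using null J0 by fastforce
    have inj\<pi>: "inj_on \<pi> (vs.span B)"
    proof (subst \<pi>.inj_on_iff_eq_0[OF vs.subspace_span], intro ballI impI)
      fix v assume v: "v \<in> vs.span B" "\<pi> v = 0"
      then obtain c where c: "v = (\<Sum>b\<in>B. ps_const (c b) * b)"
        using vs.span_finite[OF fin] by auto
      then have "\<forall>b\<in>B. c b = 0" using null v(2) \<pi>0 by blast
      then show "v = 0" by (simp add: c)
    qed
    then have indep': "vs.independent (\<pi> ` B)" and card': "card (\<pi> ` B) = card B"
      using \<pi>.independent_injective_image[OF indepB inj\<pi>]
        card_image[OF inj_on_subset[OF inj\<pi> vs.span_superset]] by simp_all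
    have "\<pi> ` B \<subseteq> vs.span E"
      unfolding \<pi>_def by (intro image_subsetI vs.span_sum vs.span_scale vs.span_base) (simp add: E_def)
    then have le: "card B \<le> d"
      using vs.independent_span_bound[OF _ indep', of E] card' cardE finE by simp
    have "E \<subseteq> vs.span (\<pi> ` B)"
    proof
      fix b assume "b \<in> E"
      then obtain i where i: "i < d" "b = e i" by (auto simp: E_def)
      obtain c where c: "b - (\<Sum>a\<in>B. ps_const (c a) * a) \<in> J" using ex[of b] by blast
      have "\<pi> b = (\<Sum>j<d. if j = i then e j else 0)"
        unfolding \<pi>_def i by (intro sum.cong) (auto simp: dual i)
      then have "b = \<pi> b" using i by simp
      also have "\<dots> = (\<Sum>a\<in>B. ps_const (c a) * \<pi> a)"
        using c unfolding \<pi>0[symmetric] by (simp add: \<pi>.diff \<pi>.sum \<pi>.scale)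
      finally show "b \<in> vs.span (\<pi> ` B)"
        by (simp only:) (intro vs.span_sum vs.span_scale vs.span_base imageI)
    qed
    then have "d \<le> card (\<pi> ` B)"
      using vs.independent_span_bound[OF _ indepE, of "\<pi> ` B"] fin cardE by simp
    with le card' show ?thesis by simp
  qed
  have "card (SOME B. quotient_basis J B) = d"
    by (rule unique, rule someI[of "quotient_basis J", OF basis])
  then show ?thesis unfolding codim_def using basis by auto
qed

section \<open>Saito's criterion\<close>

text \<open>Reducedness is expressed through \<open>deriv_y f\<close>, because this derivative then
  serves as the factor coprime to f in the definition of the Saito module.\<close>

locale two_branches =
  fixes f p\<^sub>1 p\<^sub>2 :: conv_ps
  assumes f: "f = p\<^sub>1 * p\<^sub>2" and prime: "prime_elem p\<^sub>1" "prime_elem p\<^sub>2"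
    and reduced: "\<not> p\<^sub>1 dvd deriv_y f" "\<not> p\<^sub>2 dvd deriv_y f"
begin

lemma coprime_deriv_y: "coprime (deriv_y f) f"
proof (rule coprimeI)
  fix d assume d: "d dvd deriv_y f" "d dvd f"
  then obtain e where e: "p\<^sub>1 * p\<^sub>2 = d * e" by (auto simp: f dvd_def)
  have "p\<^sub>1 dvd d * e" by (metis e dvd_triv_left)
  then have "p\<^sub>1 dvd e" using prime(1) d reduced by (meson dvd_trans prime_elem_dvd_mult_iff)
  then obtain e' where "e = p\<^sub>1 * e'" by blast
  then have e': "p\<^sub>2 = d * e'" using e prime(1) by (auto simp: mult.left_commute prime_elem_def)
  have "p\<^sub>2 dvd d * e'" by (simp flip: e')
  then have "p\<^sub>2 dvd e'" using prime(2) d reduced by (meson dvd_trans prime_elem_dvd_mult_iff)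
  then obtain e'' where "e' = p\<^sub>2 * e''" by blast
  then have "p\<^sub>2 * 1 = p\<^sub>2 * (d * e'')" using e' by (simp add: mult.left_commute)
  then have "d * e'' = 1" using prime(2) by (metis mult_left_cancel not_prime_elem_zero)
  then show "d dvd 1" by (metis dvdI)
qed

text \<open>Euclid's lemma for f, by cancelling the two prime branches one after the other.\<close>

lemma dvd_if_coprime_mult:
  assumes "coprime g f" "f dvd g * w"
  shows "f dvd w"
proof -
  have nd: "\<not> p\<^sub>1 dvd g" "\<not> p\<^sub>2 dvd g"
    using assms(1) prime unfolding f by (meson coprime_common_divisor dvd_triv_left dvd_triv_right prime_elem_not_unit)+
  have "p\<^sub>1 dvd g * w" using assms(2) unfolding f by (meson dvd_mult_left)
  then obtain w' where w': "w = p\<^sub>1 * w'" using nd prime by (metis dvdE prime_elem_dvd_mult_iff)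
  have "p\<^sub>1 * p\<^sub>2 dvd p\<^sub>1 * (g * w')" using assms(2) unfolding f w' by (simp add: mult.left_commute)
  then have "p\<^sub>2 dvd g * w'" using prime(1) by (metis dvd_mult_cancel_left not_prime_elem_zero)
  then have "p\<^sub>2 dvd w'" using nd prime by (simp add: prime_elem_dvd_mult_iff)
  then show ?thesis by (simp add: f w')
qed

text \<open>One direction wedges the defining relation with df and cancels g. Conversely, if
  \<omega> = A dx + B dy and A f_y - B f_x = f c, then f_y \<omega> = B df + f c dx, so f_y is an
  admissible factor.\<close>

lemma saito_module_iff: "\<omega> \<in> saito_module f \<longleftrightarrow> f dvd fst \<omega> * deriv_y f - snd \<omega> * deriv_x f"
proof
  assume "\<omega> \<in> saito_module f"
  then obtain g p \<eta> where g: "coprime g f" and eq: "form_scale g \<omega> = form_scale p (dform f) + form_scale f \<eta>"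
    unfolding saito_module_def F_module_def by blast
  have "g * fst \<omega> = p * deriv_x f + f * fst \<eta>" "g * snd \<omega> = p * deriv_y f + f * snd \<eta>"
    using eq by (auto simp: form_scale_def dform_def prod_eq_iff)
  then have "g * (fst \<omega> * deriv_y f - snd \<omega> * deriv_x f) = f * (fst \<eta> * deriv_y f - snd \<eta> * deriv_x f)"
    by (simp add: right_diff_distrib mult.assoc[symmetric]) (simp add: algebra_simps)
  then show "f dvd fst \<omega> * deriv_y f - snd \<omega> * deriv_x f"
    using dvd_if_coprime_mult[OF g] by (metis dvd_triv_left)
next
  assume "f dvd fst \<omega> * deriv_y f - snd \<omega> * deriv_x f"
  then obtain c where c: "fst \<omega> * deriv_y f - snd \<omega> * deriv_x f = f * c" by blast
  have "form_scale (deriv_y f) \<omega> = form_scale (snd \<omega>) (dform f) + form_scale f (c, 0)"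
    using c by (simp add: form_scale_def dform_def prod_eq_iff algebra_simps)
  then show "\<omega> \<in> saito_module f"
    using coprime_deriv_y unfolding saito_module_def F_module_def by blast
qed

theorem saito_criterion:
  assumes \<omega>: "\<omega>\<^sub>1 \<in> saito_module f" "\<omega>\<^sub>2 \<in> saito_module f"
    and u: "u dvd 1" and wedge: "fst \<omega>\<^sub>1 * snd \<omega>\<^sub>2 - snd \<omega>\<^sub>1 * fst \<omega>\<^sub>2 = u * f"
  shows "saito_basis f \<omega>\<^sub>1 \<omega>\<^sub>2"
proof -
  have f0: "f \<noteq> 0" using prime f by auto
  obtain v where v: "u * v = 1" using u by (metis dvdE)
  have u0: "u \<noteq> 0" using v by auto
  have neq: "\<omega>\<^sub>1 \<noteq> \<omega>\<^sub>2"
    using wedge f0 u0 by (auto simp: mult.commute)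
  \<comment> \<open>Both \<alpha> and \<beta> wedge with df to a multiple of f. Eliminating f_x
    shows that f divides f_y times their wedge product, and f_y is coprime to f.\<close>
  have pair: "f dvd fst \<alpha> * snd \<beta> - snd \<alpha> * fst \<beta>"
    if \<alpha>: "\<alpha> \<in> saito_module f" and \<beta>: "\<beta> \<in> saito_module f" for \<alpha> \<beta>
  proof (rule dvd_if_coprime_mult[OF coprime_deriv_y])
    obtain a where a: "fst \<alpha> * deriv_y f - snd \<alpha> * deriv_x f = f * a"
      using \<alpha> unfolding saito_module_iff by (rule dvdE)
    obtain b where b: "fst \<beta> * deriv_y f - snd \<beta> * deriv_x f = f * b"
      using \<beta> unfolding saito_module_iff by (rule dvdE)
    have "deriv_y f * (fst \<alpha> * snd \<beta> - snd \<alpha> * fst \<beta>) = f * a * snd \<beta> - f * b * snd \<alpha>"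
      unfolding a[symmetric] b[symmetric] by (simp add: algebra_simps)
    also have "\<dots> = f * (a * snd \<beta> - b * snd \<alpha>)"
      by (simp add: algebra_simps)
    finally have "deriv_y f * (fst \<alpha> * snd \<beta> - snd \<alpha> * fst \<beta>) = f * (a * snd \<beta> - b * snd \<alpha>)" .
    then show "f dvd deriv_y f * (fst \<alpha> * snd \<beta> - snd \<alpha> * fst \<beta>)" by simp
  qed
  have "saito_module f \<subseteq> forms.span {\<omega>\<^sub>1, \<omega>\<^sub>2}"
  proof
    fix \<omega> assume "\<omega> \<in> saito_module f"
    then obtain a b where a: "fst \<omega> * snd \<omega>\<^sub>2 - snd \<omega> * fst \<omega>\<^sub>2 = f * a" and b: "fst \<omega>\<^sub>1 * snd \<omega> - snd \<omega>\<^sub>1 * fst \<omega> = f * b"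
      using pair \<omega> by (meson dvdE)
    have "f * (u * fst \<omega>) = f * (a * fst \<omega>\<^sub>1 + b * fst \<omega>\<^sub>2)" "f * (u * snd \<omega>) = f * (a * snd \<omega>\<^sub>1 + b * snd \<omega>\<^sub>2)"
      unfolding distrib_left mult.assoc[symmetric] a[symmetric] b[symmetric] mult.commute[of f u] wedge[symmetric]
      by (simp_all add: algebra_simps)
    then have "u * fst \<omega> = a * fst \<omega>\<^sub>1 + b * fst \<omega>\<^sub>2" "u * snd \<omega> = a * snd \<omega>\<^sub>1 + b * snd \<omega>\<^sub>2"
      using f0 by (metis mult_left_cancel)+
    then have "v * (u * fst \<omega>) = v * (a * fst \<omega>\<^sub>1 + b * fst \<omega>\<^sub>2)" "v * (u * snd \<omega>) = v * (a * snd \<omega>\<^sub>1 + b * snd \<omega>\<^sub>2)"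
      by simp_all
    then have "\<omega> = form_scale (v * a) \<omega>\<^sub>1 + form_scale (v * b) \<omega>\<^sub>2"
      using v by (simp add: form_scale_def prod_eq_iff distrib_left mult.commute[of u v] flip: mult.assoc)
    then show "\<omega> \<in> forms.span {\<omega>\<^sub>1, \<omega>\<^sub>2}"
      by (simp only:) (intro forms.span_add forms.span_scale forms.span_base; simp)
  qed
  moreover have "forms.span {\<omega>\<^sub>1, \<omega>\<^sub>2} \<subseteq> saito_module f"
  proof (rule forms.span_minimal)
    show "forms.subspace (saito_module f)"
      unfolding forms.subspace_def saito_module_iff
    proof (intro conjI ballI allI)
      fix \<alpha> \<beta> c assume "\<alpha> \<in> saito_module f"
      then have \<alpha>: "f dvd fst \<alpha> * deriv_y f - snd \<alpha> * deriv_x f" by (simp add: saito_module_iff)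
      then have "f dvd c * (fst \<alpha> * deriv_y f - snd \<alpha> * deriv_x f)" by (rule dvd_mult)
      then show "f dvd fst (form_scale c \<alpha>) * deriv_y f - snd (form_scale c \<alpha>) * deriv_x f"
        by (simp add: form_scale_def algebra_simps)
      assume "\<beta> \<in> saito_module f"
      then have "f dvd fst \<beta> * deriv_y f - snd \<beta> * deriv_x f" by (simp add: saito_module_iff)
      from dvd_add[OF \<alpha> this] show "f dvd fst (\<alpha> + \<beta>) * deriv_y f - snd (\<alpha> + \<beta>) * deriv_x f"
        by (simp add: algebra_simps)
    qed simp
  qed (use \<omega> in simp)
  moreover have "forms.independent {\<omega>\<^sub>1, \<omega>\<^sub>2}"
  proof -
    have "a = 0 \<and> b = 0" if "form_scale a \<omega>\<^sub>1 + form_scale b \<omega>\<^sub>2 = 0" for a b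
    proof -
      have 1: "a * fst \<omega>\<^sub>1 + b * fst \<omega>\<^sub>2 = 0" "a * snd \<omega>\<^sub>1 + b * snd \<omega>\<^sub>2 = 0"
        using that by (auto simp: form_scale_def prod_eq_iff)
      have "a * (u * f) = (a * fst \<omega>\<^sub>1 + b * fst \<omega>\<^sub>2) * snd \<omega>\<^sub>2 - (a * snd \<omega>\<^sub>1 + b * snd \<omega>\<^sub>2) * fst \<omega>\<^sub>2"
        "b * (u * f) = (a * snd \<omega>\<^sub>1 + b * snd \<omega>\<^sub>2) * fst \<omega>\<^sub>1 - (a * fst \<omega>\<^sub>1 + b * fst \<omega>\<^sub>2) * snd \<omega>\<^sub>1"
        unfolding wedge[symmetric] by (simp_all add: algebra_simps)
      then have "a * (u * f) = 0" "b * (u * f) = 0"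
        by (simp_all only: 1 mult_zero_left diff_self)
      then show ?thesis using u0 f0 by simp
    qed
    then show ?thesis using neq by (auto simp: forms.dependent_finite)
  qed
  ultimately show ?thesis using neq by (simp add: saito_basis_def)
qed

end

section \<open>Ideals described by the remainder modulo a quadratic polynomial\<close>

locale quadratic_division =
  fixes a b :: conv_ps
  assumes a: "x_series a" "ps_coeff a 0 0 = 0" and b: "x_series b" "ps_coeff b 0 0 = 0"
begin

abbreviation W :: conv_ps where "W \<equiv> \<^bold>y\<^sup>2 - a * \<^bold>y - b"

text \<open>The coordinates of the class of h in C{x,y}/(W), a free C{x}-module with basis 1, y;
  uniqueness of the division makes the choice immaterial.\<close>

definition remainder :: "conv_ps \<Rightarrow> conv_ps \<times> conv_ps" where
  "remainder h = (SOME (r0, r1). x_series r0 \<and> x_series r1 \<and> (\<exists>q. h = q * W + r0 + r1 * \<^bold>y))"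

abbreviation "rem0 h \<equiv> fst (remainder h)"
abbreviation "rem1 h \<equiv> snd (remainder h)"

lemma remainder:
  "x_series (rem0 h)" "x_series (rem1 h)" "\<exists>q. h = q * W + rem0 h + rem1 h * \<^bold>y"
proof -
  obtain q r0 r1 where "h = q * W + r0 + r1 * \<^bold>y" "x_series r0" "x_series r1"
    using division_quadratic[OF a b] .
  then have "\<exists>p. case p of (r0, r1) \<Rightarrow> x_series r0 \<and> x_series r1 \<and> (\<exists>q. h = q * W + r0 + r1 * \<^bold>y)"
    by blast
  then have "case remainder h of (r0, r1) \<Rightarrow> x_series r0 \<and> x_series r1 \<and> (\<exists>q. h = q * W + r0 + r1 * \<^bold>y)"
    unfolding remainder_def by (rule someI_ex)
  then show "x_series (rem0 h)" "x_series (rem1 h)" "\<exists>q. h = q * W + rem0 h + rem1 h * \<^bold>y"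
    by (auto simp: case_prod_unfold)
qed

lemma remainder_eqI:
  assumes "h = q * W + r0 + r1 * \<^bold>y" "x_series r0" "x_series r1"
  shows "remainder h = (r0, r1)"
proof -
  obtain q' where q': "h = q' * W + rem0 h + rem1 h * \<^bold>y" using remainder(3) by blast
  have "(q' - q) * W + (rem0 h - r0) + (rem1 h - r1) * \<^bold>y
      = (q' * W + rem0 h + rem1 h * \<^bold>y) - (q * W + r0 + r1 * \<^bold>y)"
    by (simp add: algebra_simps)
  also have "\<dots> = 0" by (simp only: q'[symmetric] assms(1)[symmetric] diff_self)
  finally have "rem0 h - r0 = 0" "rem1 h - r1 = 0"
    using division_quadratic_unique(2,3)[OF a b, of "rem0 h - r0" "rem1 h - r1" "q' - q"] remainder assms
    by simp_all
  then show ?thesis by (simp add: prod_eq_iff)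
qed

lemma remainder_add: "remainder (f + g) = (rem0 f + rem0 g, rem1 f + rem1 g)"
proof -
  obtain q q' where q: "f = q * W + rem0 f + rem1 f * \<^bold>y" "g = q' * W + rem0 g + rem1 g * \<^bold>y"
    using remainder(3) by blast
  have "f + g = (q * W + rem0 f + rem1 f * \<^bold>y) + (q' * W + rem0 g + rem1 g * \<^bold>y)"
    using q by simp
  also have "\<dots> = (q + q') * W + (rem0 f + rem0 g) + (rem1 f + rem1 g) * \<^bold>y"
    by (simp add: algebra_simps)
  finally show ?thesis by (rule remainder_eqI) (simp_all add: remainder)
qed

text \<open>Multiplication in the quotient, where y^2 = a y + b.\<close>

lemma remainder_mult:
  "remainder (f * g) = (rem0 f * rem0 g + b * rem1 f * rem1 g,
     rem0 f * rem1 g + rem1 f * rem0 g + a * rem1 f * rem1 g)"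
proof -
  obtain q q' where q: "f = q * W + rem0 f + rem1 f * \<^bold>y" "g = q' * W + rem0 g + rem1 g * \<^bold>y"
    using remainder(3) by blast
  have "f * g = (q * W + rem0 f + rem1 f * \<^bold>y) * (q' * W + rem0 g + rem1 g * \<^bold>y)"
    using q by simp
  also have "\<dots> = (q * (q' * W + rem0 g + rem1 g * \<^bold>y) + (rem0 f + rem1 f * \<^bold>y) * q' + rem1 f * rem1 g) * W
      + (rem0 f * rem0 g + b * rem1 f * rem1 g) + (rem0 f * rem1 g + rem1 f * rem0 g + a * rem1 f * rem1 g) * \<^bold>y"
    by (simp add: power2_eq_square algebra_simps)
  finally show ?thesis by (rule remainder_eqI) (simp_all add: remainder a b)
qed

lemma remainder_x_series: "x_series r \<Longrightarrow> remainder r = (r, 0)"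
  by (rule remainder_eqI[of _ 0]) auto

lemma remainder_x_series_y: "x_series r \<Longrightarrow> remainder (r * \<^bold>y) = (0, r)"
  by (rule remainder_eqI[of _ 0]) auto

text \<open>The common shape of the Jacobian and Tjurina ideals below: two divisibility conditions
  and one linear relation between the leading coefficients of the remainder. For c = 0 the relation
  just raises the power of x in \<open>rem0\<close> by one.\<close>

definition remainder_ideal :: "nat \<Rightarrow> nat \<Rightarrow> complex \<Rightarrow> conv_ps set" where
  "remainder_ideal p l c = {h. \<exists>s0 s1. x_series s0 \<and> x_series s1 \<and> rem0 h = \<^bold>x ^ l * s0 \<and>
     rem1 h = \<^bold>x ^ p * s1 \<and> ps_coeff s0 0 0 = c * ps_coeff s1 0 0}"

lemma remainder_idealI:
  assumes "h = q * W + \<^bold>x ^ l * s0 + \<^bold>x ^ p * s1 * \<^bold>y" "x_series s0" "x_series s1"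
    "ps_coeff s0 0 0 = c * ps_coeff s1 0 0"
  shows "h \<in> remainder_ideal p l c"
proof -
  have "remainder h = (\<^bold>x ^ l * s0, \<^bold>x ^ p * s1)"
    by (rule remainder_eqI[OF assms(1)]) (use assms in auto)
  then show ?thesis using assms unfolding remainder_ideal_def by auto
qed

lemma remainder_idealE:
  assumes "h \<in> remainder_ideal p l c"
  obtains q s0 s1 where "h = q * W + \<^bold>x ^ l * s0 + \<^bold>x ^ p * s1 * \<^bold>y" "x_series s0" "x_series s1"
    "ps_coeff s0 0 0 = c * ps_coeff s1 0 0"
  using assms remainder(3)[of h] unfolding remainder_ideal_def by auto

text \<open>These conditions make the set stable under y: the pair (x^l s0, x^p s1) is sent to (b
  x^p s1, x^l s0 + a x^p s1), whose new leading coefficients at x^l and x^p both vanish.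
  Multiplication by a series in x scales both sides of the relation equally.\<close>

context
  fixes p l :: nat and c :: complex and b' :: conv_ps
  assumes pl: "p < l" and bp: "b * \<^bold>x ^ p = \<^bold>x ^ Suc l * b'"
begin

lemma remainder_ideal_generated:
  assumes "A \<subseteq> remainder_ideal p l c"
  shows "ideal_generated A \<subseteq> remainder_ideal p l c"
proof (rule ideal_generated_minimal[OF assms])
  obtain a' where a': "a = \<^bold>x * a'" "x_series a'" using x_series_split[of a 1] a by auto
  have "x_series (\<^bold>x ^ Suc l * b')"
    unfolding bp[symmetric] using b by simp
  then have b': "x_series b'"
    unfolding x_series_def by (metis add_diff_cancel_right' not_add_less2 ps_coeff_x_power_mult)
  obtain t where t: "l = Suc (p + t)" using pl less_imp_Suc_add by blast
  show "0 \<in> remainder_ideal p l c"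
    by (rule remainder_idealI[of _ 0 _ 0 _ 0]) auto
  fix f g assume g: "g \<in> remainder_ideal p l c"
  obtain s0 s1 where s: "x_series s0" "x_series s1" "rem0 g = \<^bold>x ^ l * s0" "rem1 g = \<^bold>x ^ p * s1"
      "ps_coeff s0 0 0 = c * ps_coeff s1 0 0"
    using g unfolding remainder_ideal_def by blast
  {
    assume "f \<in> remainder_ideal p l c"
    then obtain t0 t1 where t: "x_series t0" "x_series t1" "rem0 f = \<^bold>x ^ l * t0" "rem1 f = \<^bold>x ^ p * t1"
        "ps_coeff t0 0 0 = c * ps_coeff t1 0 0"
      unfolding remainder_ideal_def by blast
    show "f + g \<in> remainder_ideal p l c"
      unfolding remainder_ideal_def remainder_add mem_Collect_eq
      by (rule exI[of _ "t0 + s0"], rule exI[of _ "t1 + s1"]) (simp add: s t algebra_simps)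
  }
  have "rem0 (f * g) = \<^bold>x ^ l * (rem0 f * s0 + \<^bold>x * b' * rem1 f * s1)"
  proof -
    have "rem0 (f * g) = rem0 f * (\<^bold>x ^ l * s0) + (b * \<^bold>x ^ p) * rem1 f * s1"
      by (simp add: remainder_mult s mult_ac)
    then show ?thesis unfolding bp by (simp add: algebra_simps)
  qed
  moreover have "rem1 (f * g) = \<^bold>x ^ p * (rem0 f * s1 + \<^bold>x * (rem1 f * \<^bold>x ^ t * s0 + a' * rem1 f * s1))"
  proof -
    have "rem1 (f * g) = rem0 f * (\<^bold>x ^ p * s1) + rem1 f * (\<^bold>x ^ l * s0) + (\<^bold>x * a') * rem1 f * (\<^bold>x ^ p * s1)"
      by (simp only: remainder_mult snd_conv s a'(1)[symmetric])
    then show ?thesis by (simp add: t power_add algebra_simps)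
  qed
  ultimately have "x_series (rem0 f * s0 + \<^bold>x * b' * rem1 f * s1) \<and>
      x_series (rem0 f * s1 + \<^bold>x * (rem1 f * \<^bold>x ^ t * s0 + a' * rem1 f * s1)) \<and>
      rem0 (f * g) = \<^bold>x ^ l * (rem0 f * s0 + \<^bold>x * b' * rem1 f * s1) \<and>
      rem1 (f * g) = \<^bold>x ^ p * (rem0 f * s1 + \<^bold>x * (rem1 f * \<^bold>x ^ t * s0 + a' * rem1 f * s1)) \<and>
      ps_coeff (rem0 f * s0 + \<^bold>x * b' * rem1 f * s1) 0 0 =
        c * ps_coeff (rem0 f * s1 + \<^bold>x * (rem1 f * \<^bold>x ^ t * s0 + a' * rem1 f * s1)) 0 0"
    by (simp add: s a'(2) b' remainder)
  then show "f * g \<in> remainder_ideal p l c"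
    unfolding remainder_ideal_def mem_Collect_eq by blast
qed

lemma codim_remainder_ideal: "codim (remainder_ideal p l c) = enat (p + l + 1)"
proof (rule codim_eqI)
  define \<phi> where "\<phi> i h = (if i < p then ps_coeff (rem1 h) i 0
      else if i < p + l then ps_coeff (rem0 h) (i - p) 0
      else ps_coeff (rem0 h) l 0 - c * ps_coeff (rem1 h) p 0)" for i h
  \<comment> \<open>x^j y is dual to the conditions on \<open>rem1\<close>, the powers x^0, ...,
    x^(l - 1) to those on \<open>rem0\<close>, and x^l to the linear relation.\<close>
  define e where "e j = (if j < p then \<^bold>x ^ j * \<^bold>y else \<^bold>x ^ (j - p))" for j
  show "\<phi> i (f + g) = \<phi> i f + \<phi> i g" for i f g
    by (simp add: \<phi>_def remainder_add algebra_simps)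
  show "\<phi> i (ps_const d * f) = d * \<phi> i f" for i d f
    by (simp add: \<phi>_def remainder_mult remainder_x_series algebra_simps)
  show "\<phi> i (e j) = (if i = j then 1 else 0)" if "i < p + l + 1" "j < p + l + 1" for i j
    using that by (auto simp: \<phi>_def e_def remainder_x_series remainder_x_series_y ps_coeff_x_power)
  show "remainder_ideal p l c = {h. \<forall>i<p + l + 1. \<phi> i h = 0}"
  proof (intro set_eqI iffI)
    fix h assume "h \<in> remainder_ideal p l c"
    then obtain s0 s1 where s: "x_series s0" "x_series s1" "rem0 h = \<^bold>x ^ l * s0" "rem1 h = \<^bold>x ^ p * s1"
        "ps_coeff s0 0 0 = c * ps_coeff s1 0 0"
      unfolding remainder_ideal_def by blast
    then show "h \<in> {h. \<forall>i<p + l + 1. \<phi> i h = 0}"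
      by (auto simp: \<phi>_def ps_coeff_x_power_mult)
  next
    fix h assume h: "h \<in> {h. \<forall>i<p + l + 1. \<phi> i h = 0}"
    have "ps_coeff (rem1 h) i 0 = 0" if "i < p" for i
      using h that by (auto simp: \<phi>_def dest!: spec[of _ i])
    then obtain s1 where s1: "rem1 h = \<^bold>x ^ p * s1" "x_series s1" "ps_coeff s1 0 0 = ps_coeff (rem1 h) p 0"
      using x_series_split[OF remainder(2)] by blast
    have "ps_coeff (rem0 h) i 0 = 0" if "i < l" for i
      using h that by (auto simp: \<phi>_def dest!: spec[of _ "p + i"])
    then obtain s0 where s0: "rem0 h = \<^bold>x ^ l * s0" "x_series s0" "ps_coeff s0 0 0 = ps_coeff (rem0 h) l 0"
      using x_series_split[OF remainder(1)] by blast
    have "ps_coeff (rem0 h) l 0 = c * ps_coeff (rem1 h) p 0"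
      using h by (auto simp: \<phi>_def dest!: spec[of _ "p + l"])
    then show "h \<in> remainder_ideal p l c"
      unfolding remainder_ideal_def mem_Collect_eq using s0 s1 by auto
  qed
qed

end

end

lemma ideal_unit_cancel:
  assumes "u dvd 1" "u * h \<in> ideal_generated A"
  shows "h \<in> ideal_generated A"
proof -
  obtain v where "1 = u * v" using assms(1) by blast
  then have "h = v * (u * h)" by (metis mult.assoc mult.commute mult_1)
  then show ?thesis using ideal_mult[OF assms(2), of v] by metis
qed

section \<open>The curves y((y - c)^2 - x^n)\<close>

text \<open>The smooth branch is y = 0, and y = c is the axis of the double branch; c = 0 and c =
  x^k give the two cases of the theorem.\<close>

definition normal_form :: "nat \<Rightarrow> conv_ps \<Rightarrow> conv_ps" where
  "normal_form n c = \<^bold>y * ((\<^bold>y - c)\<^sup>2 - \<^bold>x ^ n)"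

lemma deriv_y_normal_form:
  assumes "x_series c"
  shows "deriv_y (normal_form n c) = ((\<^bold>y - c)\<^sup>2 - \<^bold>x ^ n) + 2 * \<^bold>y * (\<^bold>y - c)"
proof -
  have "deriv_y c = 0" using assms by (intro conv_ps_eqI) (simp add: x_series_def)
  then show ?thesis
    by (simp add: normal_form_def deriv_y_mult deriv_y_power algebra_simps)
qed

text \<open>On y = 0 the derivative in y is c^2 - x^n. On the double branch x = s^2, y = s^n +
  c(s^2) it is 2 (s^n + c(s^2)) s^n. The last two hypotheses say that neither vanishes.\<close>

lemma two_branches_normal_form:
  assumes n: "odd n" and c: "x_series c" "ps_coeff c 0 0 = 0" and c2: "c\<^sup>2 \<noteq> \<^bold>x ^ n" 
    and c3: "subst c (\<^bold>x\<^sup>2) 0 \<noteq> - (\<^bold>x ^ n)"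
  shows "two_branches (normal_form n c) \<^bold>y ((\<^bold>y - c)\<^sup>2 - \<^bold>x ^ n)"
proof
  have n0: "n > 0" using n by (cases n) auto
  show "prime_elem \<^bold>y" "prime_elem ((\<^bold>y - c)\<^sup>2 - \<^bold>x ^ n)"
    by (rule prime_elem_y prime_elem_shifted_cusp[OF n c])+
  show "\<not> \<^bold>y dvd deriv_y (normal_form n c)"
    using c2 c by (simp add: deriv_y_normal_form y_dvd_iff_restrict_x restrict_x_id)
  have [simp]: "ps_coeff (\<^bold>x\<^sup>2) 0 0 = 0" "ps_coeff (\<^bold>x ^ n) 0 0 = 0" using n0 by simp_all
  have "subst (2 * \<^bold>y * (\<^bold>y - c)) (\<^bold>x\<^sup>2) (\<^bold>x ^ n + subst c (\<^bold>x\<^sup>2) 0)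
      = 2 * (\<^bold>x ^ n + subst c (\<^bold>x\<^sup>2) 0) * \<^bold>x ^ n"
    using c n0 by (simp add: subst_hom subst_x_series[of c "\<^bold>x\<^sup>2" "\<^bold>x ^ n + subst c (\<^bold>x\<^sup>2) 0"])
  also have "\<dots> \<noteq> 0"
  proof -
    have "(2 :: conv_ps) \<noteq> 0"
      by (metis ps_coeff_numeral ps_coeff_zero zero_neq_numeral)
    moreover have "\<^bold>x ^ n + subst c (\<^bold>x\<^sup>2) 0 \<noteq> 0" using c3 by (simp add: add_eq_0_iff)
    ultimately show ?thesis by (simp only: mult_eq_0_iff power_eq_0_iff x_neq_0) simp
  qed
  finally have "\<not> (\<^bold>y - c)\<^sup>2 - \<^bold>x ^ n dvd 2 * \<^bold>y * (\<^bold>y - c)"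
    unfolding shifted_cusp_dvd_iff[OF n c] .
  then show "\<not> (\<^bold>y - c)\<^sup>2 - \<^bold>x ^ n dvd deriv_y (normal_form n c)"
    unfolding deriv_y_normal_form[OF c(1)] by (simp add: dvd_add_right_iff)
qed (simp add: normal_form_def)

subsection \<open>The quasi-homogeneous curve\<close>

context
  fixes n :: nat
  assumes n: "odd n" "n \<ge> 3"
begin

lemma two_branches_quasi_homogeneous: "two_branches (normal_form n 0) \<^bold>y (\<^bold>y\<^sup>2 - \<^bold>x ^ n)"
  using two_branches_normal_form[of n 0] n by simp

lemma derivs_quasi_homogeneous:
  "deriv_x (normal_form n 0) = - of_nat n * \<^bold>x ^ (n - 1) * \<^bold>y"
  "deriv_y (normal_form n 0) = 3 * \<^bold>y\<^sup>2 - \<^bold>x ^ n"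
  by (simp_all add: normal_form_def deriv_x_mult deriv_y_mult deriv_x_power deriv_y_power
      power2_eq_square algebra_simps)

text \<open>Euler's relation: f has degree 3n for the weights 2 of x and n of y. It puts f into its
  Jacobian ideal, hence the equality of the Tjurina and Milnor numbers.\<close>

lemma euler_quasi_homogeneous:
  "of_nat n * \<^bold>y * deriv_y (normal_form n 0) + 2 * \<^bold>x * deriv_x (normal_form n 0) = 3 * of_nat n * normal_form n 0"
proof -
  have xn: "\<^bold>x ^ n = \<^bold>x * \<^bold>x ^ (n - 1)" using n by (cases n) auto
  show ?thesis
    unfolding derivs_quasi_homogeneous unfolding normal_form_def xn
    by (simp add: power2_eq_square algebra_simps)
qed

text \<open>The wedge product of the two forms is the left side of Euler's relation, so one identity
  yields both that the first form lies in the module and that the criterion applies.\<close>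

lemma saito_basis_quasi_homogeneous:
  "saito_basis (normal_form n 0) (of_nat n * \<^bold>y, - 2 * \<^bold>x) (dform (normal_form n 0))"
proof -
  interpret two_branches "normal_form n 0" "\<^bold>y" "\<^bold>y\<^sup>2 - \<^bold>x ^ n"
    by (rule two_branches_quasi_homogeneous)
  have e: "of_nat n * \<^bold>y * deriv_y (normal_form n 0) - - 2 * \<^bold>x * deriv_x (normal_form n 0) = 3 * of_nat n * normal_form n 0"
    using euler_quasi_homogeneous by simp
  show ?thesis
  proof (rule saito_criterion)
    show "(of_nat n * \<^bold>y, - 2 * \<^bold>x) \<in> saito_module (normal_form n 0)"
      unfolding saito_module_iff fst_conv snd_conv e by simp
    show "dform (normal_form n 0) \<in> saito_module (normal_form n 0)"
      unfolding saito_module_iff by (simp add: dform_def mult.commute)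
    show "fst (of_nat n * \<^bold>y, - 2 * \<^bold>x) * snd (dform (normal_form n 0)) -
        snd (of_nat n * \<^bold>y, - 2 * \<^bold>x) * fst (dform (normal_form n 0)) = 3 * of_nat n * normal_form n 0"
      unfolding dform_def fst_conv snd_conv by (rule e)
    show "(3 * of_nat n :: conv_ps) dvd 1"
      using n by (simp add: unit_iff ps_coeff_of_nat ps_coeff_numeral)
  qed
qed

lemma codim_quasi_homogeneous:
  "tjurina (normal_form n 0) = enat (3 * n - 2)" "milnor (normal_form n 0) = enat (3 * n - 2)"
proof -
  let ?f = "normal_form n 0" and ?b = "ps_const (1 / 3) * \<^bold>x ^ n"
  interpret quadratic_division 0 ?b
    by unfold_locales (use n in auto)
  have third: "ps_const (1 / 3) * 3 = 1"
    by (simp flip: ps_const_numeral ps_const_mult)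
  have xn: "\<^bold>x ^ n = \<^bold>x * \<^bold>x ^ (n - 1)" using n by (cases n) auto
  have b: "?b * \<^bold>x ^ (n - 1) = \<^bold>x ^ Suc (2 * n - 2) * ps_const (1 / 3)"
  proof -
    have "Suc (2 * n - 2) = n + (n - 1)" using n by simp
    then show ?thesis by (simp only: power_add mult_ac)
  qed
  have pl: "n - 1 < 2 * n - 2" using n by simp
  \<comment> \<open>Here W is a third of f_y, and f_x is x^(n - 1) y up to a constant. Times y, the
    latter becomes x^(2n - 1)/3 modulo W; since c = 0 makes s0 vanish at 0, this power is encoded by
    l = 2n - 2.\<close>
  define N where "N = remainder_ideal (n - 1) (2 * n - 2) 0"
  have fy: "deriv_y ?f = 3 * W"
  proof -
    have "3 * W = 3 * \<^bold>y\<^sup>2 - (ps_const (1 / 3) * 3) * \<^bold>x ^ n" by (simp add: algebra_simps)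
    then show ?thesis unfolding derivs_quasi_homogeneous third by simp
  qed
  have m: "ideal_generated {deriv_x ?f, deriv_y ?f} \<subseteq> ideal_generated {?f, deriv_x ?f, deriv_y ?f}"
    unfolding ideal_generated_def by (rule module.span_mono[OF module_conv_ps]) auto
  have xN: "deriv_x ?f \<in> N"
    unfolding N_def derivs_quasi_homogeneous
    by (rule remainder_idealI[of _ 0 _ 0 _ "- of_nat n"]) (simp_all add: mult_ac)
  have yN: "deriv_y ?f \<in> N"
    unfolding N_def fy by (rule remainder_idealI[of _ 3 _ 0 _ 0]) simp_all
  have n3: "(3 * of_nat n :: conv_ps) dvd 1"
    using n by (simp add: unit_iff ps_coeff_of_nat ps_coeff_numeral)
  have fJ: "?f \<in> ideal_generated {deriv_x ?f, deriv_y ?f}"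
    by (rule ideal_unit_cancel[OF n3], subst euler_quasi_homogeneous[symmetric])
       (intro ideal_add ideal_mult ideal_base; simp)
  have "{deriv_x ?f, deriv_y ?f} \<subseteq> N" using xN yN by simp
  then have JN: "ideal_generated {deriv_x ?f, deriv_y ?f} \<subseteq> N"
    unfolding N_def by (rule remainder_ideal_generated[OF pl b])
  then have "{?f, deriv_x ?f, deriv_y ?f} \<subseteq> N" using xN yN fJ by auto
  then have TN: "ideal_generated {?f, deriv_x ?f, deriv_y ?f} \<subseteq> N"
    unfolding N_def by (rule remainder_ideal_generated[OF pl b])
  have NJ: "N \<subseteq> ideal_generated {deriv_x ?f, deriv_y ?f}"
  proof
    fix h assume "h \<in> N"
    then obtain q s0 s1 where s: "h = q * W + \<^bold>x ^ (2 * n - 2) * s0 + \<^bold>x ^ (n - 1) * s1 * \<^bold>y" "x_series s0" "x_series s1"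
        "ps_coeff s0 0 0 = 0 * ps_coeff s1 0 0"
      unfolding N_def by (rule remainder_idealE)
    \<comment> \<open>The relation with c = 0 supplies the extra factor x, and x^(2n - 1) is a
      combination of x^(n - 1) y and W.\<close>
    then obtain t where t: "s0 = \<^bold>x * t" using x_series_split[of s0 1] by auto
    let ?J = "ideal_generated {deriv_x ?f, deriv_y ?f}"
    have "3 * W \<in> ?J" unfolding fy[symmetric] by (rule ideal_base) simp
    then have W: "W \<in> ?J" by (rule ideal_unit_cancel[rotated]) (simp add: unit_iff ps_coeff_numeral)
    have n': "(- of_nat n :: conv_ps) dvd 1" using n by (simp add: unit_iff ps_coeff_of_nat ps_coeff_numeral)
    have "- of_nat n * (\<^bold>x ^ (n - 1) * \<^bold>y) \<in> ?J"
      unfolding mult.assoc[symmetric] derivs_quasi_homogeneous(1)[symmetric] by (rule ideal_base) simp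
    then have xy: "\<^bold>x ^ (n - 1) * \<^bold>y \<in> ?J" by (rule ideal_unit_cancel[OF n'])
    have "\<^bold>x ^ (2 * n - 2) * s0 = \<^bold>x ^ (n - 1) * \<^bold>x ^ n * t"
    proof -
      have "2 * n - 2 = (n - 1) + (n - 1)" by simp
      then show ?thesis unfolding t xn by (simp add: power_add mult_ac)
    qed
    also have "\<dots> = (ps_const (1 / 3) * 3) * (\<^bold>x ^ (n - 1) * \<^bold>x ^ n * t)"
      by (simp add: third)
    also have "\<dots> = 3 * \<^bold>y * t * (\<^bold>x ^ (n - 1) * \<^bold>y) - 3 * \<^bold>x ^ (n - 1) * t * W"
      by (simp add: power2_eq_square algebra_simps)
    finally have "h = q * W + (3 * \<^bold>y * t * (\<^bold>x ^ (n - 1) * \<^bold>y) - 3 * \<^bold>x ^ (n - 1) * t * W) + s1 * (\<^bold>x ^ (n - 1) * \<^bold>y)"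
      using s(1) by (simp add: mult_ac)
    then show "h \<in> ?J" by (simp only:) (intro ideal_add ideal_diff ideal_mult W xy)
  qed
  have "codim N = enat (n - 1 + (2 * n - 2) + 1)"
    unfolding N_def by (rule codim_remainder_ideal[OF pl b])
  also have "n - 1 + (2 * n - 2) + 1 = 3 * n - 2" using n by simp
  finally have "codim N = enat (3 * n - 2)" .
  moreover have "ideal_generated {?f, deriv_x ?f, deriv_y ?f} = N" "ideal_generated {deriv_x ?f, deriv_y ?f} = N"
    using JN NJ TN m by auto
  ultimately show "tjurina ?f = enat (3 * n - 2)" "milnor ?f = enat (3 * n - 2)"
    by (simp_all add: tjurina_def milnor_def)
qed

end

subsection \<open>The curves that are not quasi-homogeneous\<close>

context
  fixes n k :: nat
  assumes n: "odd n" "n < 2 * k" "k + 2 \<le> n"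
begin

private abbreviation "F \<equiv> normal_form n (\<^bold>x ^ k)"

lemma two_branches_normal_form_power: "two_branches F \<^bold>y ((\<^bold>y - \<^bold>x ^ k)\<^sup>2 - \<^bold>x ^ n)"
proof (rule two_branches_normal_form)
  have neq: "2 * k \<noteq> n" using n by presburger
  have 1: "ps_coeff (\<^bold>x ^ (2 * k)) n 0 \<noteq> ps_coeff (\<^bold>x ^ n) n 0" "ps_coeff (\<^bold>x ^ (2 * k)) n 0 \<noteq> ps_coeff (- (\<^bold>x ^ n)) n 0"
    using neq by (simp_all add: ps_coeff_x_power)
  have "(\<^bold>x ^ k)\<^sup>2 = \<^bold>x ^ (2 * k)" by (metis mult.commute power_mult)
  then show "(\<^bold>x ^ k)\<^sup>2 \<noteq> \<^bold>x ^ n" using 1 by metis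
  have "subst (\<^bold>x ^ k) (\<^bold>x\<^sup>2) 0 = \<^bold>x ^ (2 * k)" by (simp add: power_mult)
  then show "subst (\<^bold>x ^ k) (\<^bold>x\<^sup>2) 0 \<noteq> - (\<^bold>x ^ n)" using 1 by metis
qed (use n in auto)

text \<open>With k' = k - 1, j = n - k - 2 and d = 2k - n - 1 all exponents are sums, and the
  identities below become polynomial identities in x, y and a few powers of x.\<close>

lemma exponents_normal_form_power:
  obtains k' j d where "k = Suc k'" "n = k' + 3 + j" "2 * k = n + Suc d" "k' = j + 2 + d"
proof -
  obtain k' where k': "k = Suc k'" using n by (cases k) auto
  obtain j where j: "n = k' + 3 + j" using n k' le_Suc_ex[of "k' + 3" n] by auto
  obtain d where d: "2 * k = n + Suc d" using n(2) less_imp_Suc_add by force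
  show ?thesis using that[OF k' j d] k' j d by simp
qed

lemma deriv_x_normal_form_power:
  "deriv_x F = \<^bold>y * (- (2 * of_nat k * \<^bold>x ^ (k - 1) * (\<^bold>y - \<^bold>x ^ k)) - of_nat n * \<^bold>x ^ (n - 1))"
  by (simp add: normal_form_def deriv_x_mult deriv_x_power algebra_simps)

lemma deriv_y_normal_form_power:
  "deriv_y F = ((\<^bold>y - \<^bold>x ^ k)\<^sup>2 - \<^bold>x ^ n) + 2 * \<^bold>y * (\<^bold>y - \<^bold>x ^ k)"
  by (rule deriv_y_normal_form) simp

lemma of_nat_difference: "(of_nat (2 * k - n) :: conv_ps) = 2 * of_nat k - of_nat n"
  using n by simp

lemma of_nat_difference_neq_0: "2 * complex_of_nat k - complex_of_nat n \<noteq> 0"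
  using n of_nat_eq_iff[of "2 * k" n, where 'a = complex] by simp

text \<open>The second form is -y (n y dx - 2x dy) - (2k - n) x^k y dx. Wedging the Euler form with
  dF leaves the error -2 (2k - n) x^k y (y - x^k); after multiplication by -y it is cancelled by the
  correction, because y F_y = F + 2 y^2 (y - x^k). The wedge product of both forms is 2n (2k - n) F,
  and 2k - n is nonzero.\<close>

theorem saito_basis_normal_form_power:
  "saito_basis F
     ((of_nat n ^ 2 * \<^bold>x ^ (n - k - 1) - of_nat (2 * k) ^ 2 * \<^bold>x ^ (k - 1)) * \<^bold>y,
      2 * (of_nat (2 * k - n) * \<^bold>y - of_nat n * \<^bold>x ^ (n - k) + of_nat n * \<^bold>x ^ k))
     (- \<^bold>y * (of_nat n * \<^bold>y + of_nat (2 * k - n) * \<^bold>x ^ k), 2 * \<^bold>x * \<^bold>y)"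
    (is "saito_basis F (?A1, ?B1) (?A2, ?B2)")
proof -
  interpret two_branches F "\<^bold>y" "(\<^bold>y - \<^bold>x ^ k)\<^sup>2 - \<^bold>x ^ n"
    by (rule two_branches_normal_form_power)
  obtain k' j d where e: "k = Suc k'" "n = k' + 3 + j" "2 * k = n + Suc d" "k' = j + 2 + d"
    by (rule exponents_normal_form_power)
  \<comment> \<open>P = x^(k - 1) and Q = x^(n - k - 2); the condition k + 2 \<le> n keeps the
    second exponent nonnegative.\<close>
  define P Q where "P = \<^bold>x ^ k'" and "Q = \<^bold>x ^ j"
  have pow: "\<^bold>x ^ (k - 1) = P" "\<^bold>x ^ k = \<^bold>x * P" "\<^bold>x ^ (n - k - 1) = \<^bold>x * Q" "\<^bold>x ^ (n - k) = \<^bold>x * \<^bold>x * Q"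
    "\<^bold>x ^ (n - 1) = \<^bold>x * \<^bold>x * P * Q" "\<^bold>x ^ n = \<^bold>x * \<^bold>x * \<^bold>x * P * Q"
  proof -
    have "n - k - 1 = j + 1" "n - k = j + 2" "n - 1 = k' + j + 2" using e(1,2) by simp_all
    then show "\<^bold>x ^ (k - 1) = P" "\<^bold>x ^ k = \<^bold>x * P" "\<^bold>x ^ (n - k - 1) = \<^bold>x * Q" "\<^bold>x ^ (n - k) = \<^bold>x * \<^bold>x * Q"
      "\<^bold>x ^ (n - 1) = \<^bold>x * \<^bold>x * P * Q" "\<^bold>x ^ n = \<^bold>x * \<^bold>x * \<^bold>x * P * Q"
      by (simp_all only: e(1,2) P_def Q_def)
         (simp_all add: power_add power2_eq_square power3_eq_cube mult_ac)
  qed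
  have nums: "of_nat (2 * k) = (2 * of_nat k :: conv_ps)" by simp
  define N K where "N = (of_nat n :: conv_ps)" and "K = (of_nat k :: conv_ps)"
  show ?thesis
  proof (rule saito_criterion[where u = "2 * N * of_nat (2 * k - n)"])
    have "fst (?A1, ?B1) * deriv_y F - snd (?A1, ?B1) * deriv_x F
       = F * (N\<^sup>2 * \<^bold>x * Q - 4 * K\<^sup>2 * P + 2 * (N\<^sup>2 * Q * \<^bold>x - 2 * K * N * P))"
      unfolding fst_conv snd_conv deriv_x_normal_form_power deriv_y_normal_form_power of_nat_difference nums
      unfolding normal_form_def pow N_def[symmetric] K_def[symmetric]
      by (simp add: power2_eq_square algebra_simps)
    then show "(?A1, ?B1) \<in> saito_module F" unfolding saito_module_iff by simp
    have "fst (?A2, ?B2) * deriv_y F - snd (?A2, ?B2) * deriv_x F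
       = F * - (3 * N * \<^bold>y + (2 * K - N) * \<^bold>x * P)"
      unfolding fst_conv snd_conv deriv_x_normal_form_power deriv_y_normal_form_power of_nat_difference nums
      unfolding normal_form_def pow N_def[symmetric] K_def[symmetric]
      by (simp add: power2_eq_square algebra_simps)
    then show "(?A2, ?B2) \<in> saito_module F" unfolding saito_module_iff by simp
    show "fst (?A1, ?B1) * snd (?A2, ?B2) - snd (?A1, ?B1) * fst (?A2, ?B2) = 2 * N * of_nat (2 * k - n) * F"
      unfolding fst_conv snd_conv of_nat_difference nums
      unfolding normal_form_def pow N_def[symmetric] K_def[symmetric]
      by (simp add: power2_eq_square algebra_simps)
    show "2 * N * of_nat (2 * k - n) dvd 1"
      using n of_nat_difference_neq_0 unfolding N_def of_nat_difference
      by (simp add: unit_iff ps_coeff_of_nat ps_coeff_numeral)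
  qed
qed

theorem tjurina_normal_form_power: "tjurina F = enat (2 * n + k - 1)"
proof -
  obtain k' j d where e: "k = Suc k'" "n = k' + 3 + j" "2 * k = n + Suc d" "k' = j + 2 + d"
    by (rule exponents_normal_form_power)
  let ?t = "ps_const (1 / 3)"
  \<comment> \<open>Modulo W the remainder of \<open>deriv_x F\<close> is x^(n + k - 1) V + x^(n -
    1) U y with V(0, 0) = -2k/3 and U(0, 0) = -n; c is the quotient of these values.\<close>
  define c where "c = (2 * of_nat k / (3 * of_nat n) :: complex)"
  define a b where "a = (1 + ?t) * \<^bold>x ^ k" and "b = ?t * (\<^bold>x ^ n - \<^bold>x ^ (2 * k))"
  interpret quadratic_division a b
    by unfold_locales (use n in \<open>auto simp: a_def b_def power_0_left\<close>)
  have third: "?t * 3 = 1"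
    by (simp flip: ps_const_numeral ps_const_mult)
  have third': "3 * (?t * h) = h" for h
    using third by (simp only: mult.assoc[symmetric] mult.commute[of 3] mult_1)
  define P Z D where "P = \<^bold>x ^ k'" and "Z = \<^bold>x ^ j" and "D = \<^bold>x ^ d"
  \<comment> \<open>Since 2k = n + 1 + d, this expresses x^(2k) as x^n times x D, so terms with
    x^(2k) are corrections of higher order to those with x^n.\<close>
  have P: "P = Z * \<^bold>x * \<^bold>x * D" by (simp add: P_def Z_def D_def e(4) power_add power2_eq_square mult_ac)
  have pow: "\<^bold>x ^ (k - 1) = P" "\<^bold>x ^ k = \<^bold>x * P" "\<^bold>x ^ (n - 1) = \<^bold>x * \<^bold>x * P * Z" "\<^bold>x ^ n = \<^bold>x * \<^bold>x * \<^bold>x * P * Z"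
    "\<^bold>x ^ (2 * k) = \<^bold>x * \<^bold>x * P * P" "\<^bold>x ^ (n + k - 1) = \<^bold>x * \<^bold>x * \<^bold>x * P * P * Z" "\<^bold>x ^ (n + k) = \<^bold>x * \<^bold>x * \<^bold>x * \<^bold>x * P * P * Z"
  proof -
    have *: "n - 1 = k' + j + 2" "n = k' + j + 3" "2 * k = k' + k' + 2" "n + k - 1 = k' + k' + j + 3"
        "n + k = k' + k' + j + 4" "k - 1 = k'"
      using e(1,2) by simp_all
    note simps = P_def Z_def power_add power_Suc power2_eq_square power3_eq_cube power4_eq_xxxx mult_ac
    show "\<^bold>x ^ (k - 1) = P" "\<^bold>x ^ k = \<^bold>x * P"
      by (simp_all only: e(1) simps diff_Suc_1)
    show "\<^bold>x ^ (n - 1) = \<^bold>x * \<^bold>x * P * Z" unfolding *(1) by (simp only: simps)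
    show "\<^bold>x ^ n = \<^bold>x * \<^bold>x * \<^bold>x * P * Z" unfolding *(2) by (simp only: simps)
    show "\<^bold>x ^ (2 * k) = \<^bold>x * \<^bold>x * P * P" unfolding *(3) by (simp only: simps)
    show "\<^bold>x ^ (n + k - 1) = \<^bold>x * \<^bold>x * \<^bold>x * P * P * Z" unfolding *(4) by (simp only: simps)
    show "\<^bold>x ^ (n + k) = \<^bold>x * \<^bold>x * \<^bold>x * \<^bold>x * P * P * Z" unfolding *(5) by (simp only: simps)
  qed
  define N K where "N = (of_nat n :: conv_ps)" and "K = (of_nat k :: conv_ps)"
  have N: "x_series N" "x_series K" "ps_coeff N 0 0 = of_nat n" "ps_coeff K 0 0 = of_nat k"
    by (simp_all add: N_def K_def ps_coeff_of_nat)
  have xs: "x_series P" "x_series Z" "x_series D" by (simp_all add: P_def Z_def D_def)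
  have pl: "n - 1 < n + k - 1" using n by simp
  have bp: "b * \<^bold>x ^ (n - 1) = \<^bold>x ^ Suc (n + k - 1) * (?t * (\<^bold>x * Z - P))"
  proof -
    have "Suc (n + k - 1) = n + k" using n by simp
    then show ?thesis unfolding b_def by (simp only: pow) (simp add: algebra_simps)
  qed
  define R where "R = remainder_ideal (n - 1) (n + k - 1) c"
  define J where "J = ideal_generated {F, deriv_x F, deriv_y F}"
  define U V where "U = - N - 2 * ?t * K * \<^bold>x * D" and "V = - (2 * ?t * K) * (1 - \<^bold>x * D)"
  \<comment> \<open>The error term of Euler's relation. Its coefficient 2 (2k - n) is a unit, as is
    3n, so F and g can replace each other as generators next to the two derivatives.\<close>
  define g where "g = \<^bold>x ^ k * \<^bold>y * (\<^bold>y - \<^bold>x ^ k)"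
  have fy: "deriv_y F = 3 * W"
  proof -
    have "3 * W = 3 * \<^bold>y\<^sup>2 - 3 * (\<^bold>x ^ k * \<^bold>y) - 3 * (?t * (\<^bold>x ^ k * \<^bold>y)) - 3 * (?t * (\<^bold>x ^ n - \<^bold>x ^ (2 * k)))"
      unfolding a_def b_def by (simp add: algebra_simps)
    also have "\<dots> = deriv_y F"
      unfolding third' deriv_y_normal_form_power unfolding pow by (simp add: power2_eq_square algebra_simps)
    finally show ?thesis ..
  qed
  have fx: "deriv_x F = - (2 * K * P) * W + \<^bold>x ^ (n + k - 1) * V + \<^bold>x ^ (n - 1) * U * \<^bold>y"
    unfolding deriv_x_normal_form_power a_def b_def U_def V_def N_def[symmetric] K_def[symmetric]
    unfolding pow by (simp add: P power2_eq_square algebra_simps)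
  have g: "g = \<^bold>x * P * W + \<^bold>x ^ (n + k - 1) * (\<^bold>x * ?t * (1 - \<^bold>x * D)) + \<^bold>x ^ (n - 1) * (\<^bold>x * \<^bold>x * ?t * D) * \<^bold>y"
    unfolding g_def a_def b_def unfolding pow by (simp add: P power2_eq_square algebra_simps)
  have euler: "3 * N * F = N * \<^bold>y * deriv_y F + 2 * \<^bold>x * deriv_x F + 2 * (2 * K - N) * g"
    unfolding deriv_x_normal_form_power deriv_y_normal_form_power g_def N_def[symmetric] K_def[symmetric]
    unfolding normal_form_def pow by (simp add: power2_eq_square algebra_simps)
  have units: "3 * N dvd 1" "2 * (2 * K - N) dvd 1" "U dvd 1" "?t * (U * (1 - \<^bold>x * D) - \<^bold>x * D * V) dvd 1" "3 dvd (1 :: conv_ps)"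
  proof -
    show "2 * (2 * K - N) dvd 1"
      using of_nat_difference_neq_0 by (simp add: unit_iff N ps_coeff_numeral)
  qed (use n in \<open>simp_all add: unit_iff U_def N ps_coeff_numeral ps_coeff_const ps_coeff_one\<close>)
  have generators: "{deriv_y F, deriv_x F, g} \<subseteq> R"
  proof -
    have "deriv_y F \<in> R"
      unfolding R_def fy by (rule remainder_idealI[of _ 3 _ 0 _ 0]) simp_all
    moreover have "deriv_x F \<in> R"
      unfolding R_def by (rule remainder_idealI[OF fx])
        (use n in \<open>auto simp: U_def V_def N xs c_def ps_coeff_const ps_coeff_one ps_coeff_numeral\<close>)
    moreover have "g \<in> R"
      unfolding R_def by (rule remainder_idealI[OF g]) (simp_all add: xs)
    ultimately show ?thesis by simp
  qed
  then have "ideal_generated {deriv_y F, deriv_x F, g} \<subseteq> R"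
    unfolding R_def by (rule remainder_ideal_generated[OF pl bp])
  moreover have "F \<in> ideal_generated {deriv_y F, deriv_x F, g}"
    by (rule ideal_unit_cancel[OF units(1)], subst euler) (intro ideal_add ideal_mult ideal_base; simp)
  ultimately have "{F, deriv_x F, deriv_y F} \<subseteq> R" using generators by auto
  then have JR: "J \<subseteq> R"
    unfolding J_def R_def by (rule remainder_ideal_generated[OF pl bp])
  have RJ: "R \<subseteq> J"
  proof
    have gens: "F \<in> J" "deriv_x F \<in> J" "deriv_y F \<in> J" by (auto simp: J_def intro: ideal_base)
    note ideal = ideal_add[of _ "{F, deriv_x F, deriv_y F}", folded J_def]
      ideal_diff[of _ "{F, deriv_x F, deriv_y F}", folded J_def]
      ideal_mult[of _ "{F, deriv_x F, deriv_y F}", folded J_def]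
    note cancel = ideal_unit_cancel[of _ _ "{F, deriv_x F, deriv_y F}", folded J_def]
    have W: "W \<in> J" by (rule cancel[OF units(5)]) (use gens in \<open>simp add: fy\<close>)
    have "2 * (2 * K - N) * g = 3 * N * F - N * \<^bold>y * deriv_y F - 2 * \<^bold>x * deriv_x F"
      unfolding euler by simp
    also have "\<dots> \<in> J" by (intro ideal gens)
    finally have gJ: "g \<in> J" by (rule cancel[OF units(2)])
    define u1 where "u1 = \<^bold>x ^ (n + k - 1) * V + \<^bold>x ^ (n - 1) * U * \<^bold>y"
    have "u1 = deriv_x F + (2 * K * P) * W" unfolding u1_def fx by simp
    also have "\<dots> \<in> J" by (intro ideal gens W)
    finally have u1: "u1 \<in> J" .
    \<comment> \<open>Eliminating y between the remainders of g and \<open>deriv_x F\<close> leaves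
      x^(n + k) times a unit, whose value at the origin is -n/3.\<close>
    have "?t * (U * (1 - \<^bold>x * D) - \<^bold>x * D * V) * (\<^bold>x ^ (n + k - 1) * \<^bold>x)
        = U * (g - \<^bold>x * P * W) - \<^bold>x * \<^bold>x * ?t * D * u1"
      unfolding g u1_def by (simp add: algebra_simps)
    also have "\<dots> \<in> J" by (intro ideal gJ W u1)
    finally have x: "\<^bold>x ^ (n + k - 1) * \<^bold>x \<in> J" by (rule cancel[OF units(4)])
    fix h assume "h \<in> R"
    then obtain q s0 s1 where h: "h = q * W + \<^bold>x ^ (n + k - 1) * s0 + \<^bold>x ^ (n - 1) * s1 * \<^bold>y"
        "x_series s0" "x_series s1" "ps_coeff s0 0 0 = c * ps_coeff s1 0 0"
      unfolding R_def by (rule remainder_idealE)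
    \<comment> \<open>This is the relation defined by c: subtracting the multiple of u1 with the
      same y-part from the remainder of U h leaves a multiple of x^(n + k).\<close>
    have "ps_coeff (U * s0 - V * s1) 0 0 = 0"
      using n by (simp add: h U_def V_def N c_def ps_coeff_const ps_coeff_one ps_coeff_numeral)
    moreover have "x_series (U * s0 - V * s1)"
      using h by (simp add: U_def V_def N xs)
    ultimately obtain w where w: "U * s0 - V * s1 = \<^bold>x * w"
      using x_series_split[of "U * s0 - V * s1" 1] by auto
    have "U * (h - q * W) = s1 * u1 + \<^bold>x ^ (n + k - 1) * (U * s0 - V * s1)"
      unfolding h(1) u1_def by (simp add: algebra_simps)
    also have "\<dots> = s1 * u1 + w * (\<^bold>x ^ (n + k - 1) * \<^bold>x)"
      unfolding w by (simp add: mult_ac)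
    also have "\<dots> \<in> J" by (intro ideal u1 x)
    finally have "h - q * W \<in> J" by (rule cancel[OF units(3)])
    from ideal(1)[OF this ideal(3)[OF W, of q]] show "h \<in> J" by simp
  qed
  have "tjurina F = codim R"
    using JR RJ by (simp add: tjurina_def J_def)
  also have "\<dots> = enat (n - 1 + (n + k - 1) + 1)"
    unfolding R_def by (rule codim_remainder_ideal[OF pl bp])
  also have "n - 1 + (n + k - 1) + 1 = 2 * n + k - 1" using n by simp
  finally show ?thesis .
qed

end

section \<open>Initial forms\<close>

lemma multiplicity0_eq_enat:
  assumes "multiplicity0 f = enat m"
  shows "ord_ge m f"
  unfolding ord_ge_def
proof (intro allI impI)
  fix i j assume ij: "i + j < m"
  show "ps_coeff f i j = 0"
  proof (rule ccontr)
    assume "ps_coeff f i j \<noteq> 0"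
    then have "multiplicity0 f \<le> enat (i + j)"
      unfolding multiplicity0_def by (intro Inf_lower) blast
    then show False using ij assms by simp
  qed
qed

lemma multiplicity0_eq_enat_ex:
  assumes "multiplicity0 f = enat m"
  shows "\<exists>i j. i + j = m \<and> ps_coeff f i j \<noteq> 0"
proof -
  let ?S = "{enat (i + j) | i j. ps_coeff f i j \<noteq> 0}"
  have "?S \<noteq> {}"
  proof
    assume "?S = {}"
    then have "multiplicity0 f = \<infinity>" unfolding multiplicity0_def by (simp add: Inf_enat_def)
    then show False using assms by simp
  qed
  then have "Inf ?S \<in> ?S" unfolding Inf_enat_def
    by (simp only: if_False) (rule LeastI_ex, blast)
  then show ?thesis using assms unfolding multiplicity0_def by auto
qed

lemma tangent_cone_multiplicity_1:
  assumes "multiplicity0 f = 1"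
  shows "tangent_cone f = {(s, t). ps_coeff f 1 0 * s + ps_coeff f 0 1 * t = 0}"
proof -
  have *: "{(i, j). enat (i + j) = multiplicity0 f} = {(1, 0), (0, 1)}"
    using assms by (auto simp: one_enat_def add_is_1)
  show ?thesis unfolding tangent_cone_def * by simp
qed

lemma tangent_cone_multiplicity_2:
  assumes "multiplicity0 f = 2"
  shows "tangent_cone f =
    {(s, t). ps_coeff f 2 0 * s\<^sup>2 + ps_coeff f 1 1 * s * t + ps_coeff f 0 2 * t\<^sup>2 = 0}"
proof -
  have "(i + j = 2) \<longleftrightarrow> (i = 2 \<and> j = 0) \<or> (i = 1 \<and> j = 1) \<or> (i = 0 \<and> j = 2)" for i j :: nat by auto
  then have *: "{(i, j). enat (i + j) = multiplicity0 f} = {(2, 0), (1, 1), (0, 2)}"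
    using assms by (auto simp: numeral_eq_enat)
  show ?thesis unfolding tangent_cone_def * by (simp add: add.assoc)
qed

text \<open>A quadratic form that vanishes on just one line has a double root there, hence is a
  multiple of the square of the linear form.\<close>

lemma quadratic_form_vanishing_on_line:
  fixes a b c20 c11 c02 :: complex
  assumes nz: "a \<noteq> 0 \<or> b \<noteq> 0"
    and eq: "\<And>s t. c20 * s\<^sup>2 + c11 * s * t + c02 * t\<^sup>2 = 0 \<longleftrightarrow> a * s + b * t = 0"
  shows "\<exists>c. c \<noteq> 0 \<and> c20 = c * a\<^sup>2 \<and> c11 = 2 * c * a * b \<and> c02 = c * b\<^sup>2"
proof (cases "a = 0")
  case True
  then have b: "b \<noteq> 0" using nz by simp
  have "c20 = 0" using eq[of 1 0] True by simp
  moreover have "c02 \<noteq> 0" using eq[of 0 1] b by simp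
  moreover have "c11 = 0" using eq[of c02 "- c11"] True b \<open>c20 = 0\<close>
    by (simp add: power2_eq_square)
  ultimately show ?thesis using True b by (intro exI[of _ "c02 / b\<^sup>2"]) simp
next
  case False
  have c20: "c20 \<noteq> 0" using eq[of 1 0] False by simp
  define r where "r = - b / a"
  have r: "c20 * r\<^sup>2 + c11 * r + c02 = 0" using eq[of r 1] False by (simp add: r_def)
  \<comment> \<open>The second root, by Vieta; it lies on the same line and therefore equals
    r.\<close>
  define r' where "r' = - c11 / c20 - r"
  have "c20 * r'\<^sup>2 + c11 * r' + c02 = c20 * r\<^sup>2 + c11 * r + c02"
    using c20 unfolding r'_def by (simp add: power2_eq_square field_simps)
  then have "a * r' + b * 1 = 0" using eq[of r' 1] r by simp
  then have "r' = r" using False by (simp add: r_def field_simps add_eq_0_iff)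
  then have "- c11 = 2 * c20 * r" using c20 by (simp add: r'_def field_simps)
  then have c11: "c11 = - (2 * c20 * r)" by (metis minus_minus)
  have c02: "c02 = c20 * r\<^sup>2" using r by (simp add: c11 power2_eq_square algebra_simps)
  show ?thesis
    using False c20 by (intro exI[of _ "c20 / a\<^sup>2"]) (simp add: c11 c02 r_def field_simps power2_eq_square)
qed

lemma ord_ge_linear_part:
  assumes "ps_coeff f 0 0 = 0"
  shows "ord_ge 2 (f - (ps_const (ps_coeff f 1 0) * \<^bold>x + ps_const (ps_coeff f 0 1) * \<^bold>y))"
proof -
  have "i + j < 2 \<longleftrightarrow> (i = 0 \<and> j = 0) \<or> (i = 1 \<and> j = 0) \<or> (i = 0 \<and> j = 1)" for i j :: nat by auto
  then show ?thesis using assms by (auto simp: ord_ge_def ps_coeff_x ps_coeff_y)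
qed

text \<open>Tangent cones are zero sets, so they determine the initial form of g from that of f only
  up to the factor c.\<close>

lemma same_tangent_initial_forms:
  assumes f: "multiplicity0 f = 1" and g: "multiplicity0 g = 2" and tc: "tangent_cone f = tangent_cone g"
  obtains a b c where "a \<noteq> 0 \<or> b \<noteq> 0" "c \<noteq> 0"
    "ord_ge 2 (f - (ps_const a * \<^bold>x + ps_const b * \<^bold>y))"
    "ord_ge 3 (g - ps_const c * (ps_const a * \<^bold>x + ps_const b * \<^bold>y)\<^sup>2)"
proof -
  define a b where "a = ps_coeff f 1 0" and "b = ps_coeff f 0 1"
  have f1: "ord_ge 1 f" and g2: "ord_ge 2 g"
    using f g by (auto intro!: multiplicity0_eq_enat simp: one_enat_def numeral_eq_enat)
  have ab: "a \<noteq> 0 \<or> b \<noteq> 0"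
    using multiplicity0_eq_enat_ex[of f 1] f by (auto simp: one_enat_def a_def b_def add_is_1)
  have "ps_coeff g 2 0 * s\<^sup>2 + ps_coeff g 1 1 * s * t + ps_coeff g 0 2 * t\<^sup>2 = 0 \<longleftrightarrow> a * s + b * t = 0" for s t
  proof -
    have "(s, t) \<in> tangent_cone g \<longleftrightarrow> (s, t) \<in> tangent_cone f" by (simp add: tc)
    then show ?thesis
      unfolding tangent_cone_multiplicity_1[OF f] tangent_cone_multiplicity_2[OF g] by (simp add: a_def b_def)
  qed
  from quadratic_form_vanishing_on_line[OF ab this]
  obtain c where c: "c \<noteq> 0" "ps_coeff g 2 0 = c * a\<^sup>2" "ps_coeff g 1 1 = 2 * c * a * b" "ps_coeff g 0 2 = c * b\<^sup>2"
    by blast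
  have "ps_const c * (ps_const a * \<^bold>x + ps_const b * \<^bold>y)\<^sup>2 =
      ps_const (c * a\<^sup>2) * \<^bold>x ^ 2 * \<^bold>y ^ 0 + ps_const (2 * c * a * b) * \<^bold>x ^ 1 * \<^bold>y ^ 1 + ps_const (c * b\<^sup>2) * \<^bold>x ^ 0 * \<^bold>y ^ 2"
    by (simp add: ps_const_mult ps_const_numeral power2_eq_square algebra_simps)
  then have e: "ps_coeff (ps_const c * (ps_const a * \<^bold>x + ps_const b * \<^bold>y)\<^sup>2) i j =
      (if i = 2 \<and> j = 0 then c * a\<^sup>2 else 0) + (if i = 1 \<and> j = 1 then 2 * c * a * b else 0) + (if i = 0 \<and> j = 2 then c * b\<^sup>2 else 0)" for i j
    by (simp only: ps_coeff_add ps_coeff_monomial)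
  have "ord_ge 3 (g - ps_const c * (ps_const a * \<^bold>x + ps_const b * \<^bold>y)\<^sup>2)"
    unfolding ord_ge_def ps_coeff_diff e
  proof (intro allI impI)
    fix i j :: nat assume "i + j < 3"
    then consider "i + j < 2" | "i = 2" "j = 0" | "i = 1" "j = 1" | "i = 0" "j = 2" by force
    then show "ps_coeff g i j - ((if i = 2 \<and> j = 0 then c * a\<^sup>2 else 0) + (if i = 1 \<and> j = 1 then 2 * c * a * b else 0) + (if i = 0 \<and> j = 2 then c * b\<^sup>2 else 0)) = 0"
      using g2 c by cases (auto simp: ord_ge_def)
  qed
  moreover have "ord_ge 2 (f - (ps_const a * \<^bold>x + ps_const b * \<^bold>y))"
    unfolding a_def b_def using f1 by (intro ord_ge_linear_part) (simp only: ord_ge_1_iff)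
  ultimately show ?thesis using that ab c(1) by blast
qed

section \<open>Simultaneous normalization of the two branches\<close>

text \<open>One change of coordinates acts on both branches, and no units are absorbed; the unit of
  the smooth branch is carried along explicitly as u. Properties of g and of the pair can then be
  transported back exactly.\<close>

definition pair_equivalent :: "conv_ps \<times> conv_ps \<Rightarrow> conv_ps \<times> conv_ps \<Rightarrow> bool" where
  "pair_equivalent P Q \<longleftrightarrow> (\<exists>p q. coord_change p q \<and> fst Q = subst (fst P) p q \<and> snd Q = subst (snd P) p q)"

lemma pair_equivalentI: "coord_change p q \<Longrightarrow> pair_equivalent (f, g) (subst f p q, subst g p q)"
  unfolding pair_equivalent_def by auto

lemma pair_equivalent_trans [trans]:
  assumes "pair_equivalent P Q" "pair_equivalent Q R"
  shows "pair_equivalent P R"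
proof -
  obtain p q where 1: "coord_change p q" "fst Q = subst (fst P) p q" "snd Q = subst (snd P) p q"
    using assms(1) unfolding pair_equivalent_def by blast
  obtain p' q' where 2: "coord_change p' q'" "fst R = subst (fst Q) p' q'" "snd R = subst (snd Q) p' q'"
    using assms(2) unfolding pair_equivalent_def by blast
  show ?thesis
    unfolding pair_equivalent_def
    by (rule exI, rule exI, rule conjI[OF coord_change_subst[OF 1(1) 2(1)]])
       (simp add: 1 2 subst_subst coord_change_0[OF 1(1)] coord_change_0[OF 2(1)])
qed

section \<open>Implicit functions and the steps of the simultaneous normalization\<close>

lemma ps_coeff_subst_0_1:
  assumes "ps_coeff p 0 0 = 0" "ps_coeff q 0 0 = 0"
  shows "ps_coeff (subst f p q) 0 1 = ps_coeff f 1 0 * ps_coeff p 0 1 + ps_coeff f 0 1 * ps_coeff q 0 1"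
proof -
  have d: "ps_coeff h 0 1 = ps_coeff (deriv_y h) 0 0" "ps_coeff h 1 0 = ps_coeff (deriv_x h) 0 0" for h
    by simp_all
  show ?thesis
    unfolding d using assms
    by (simp add: deriv_y_subst del: ps_coeff_deriv_y ps_coeff_deriv_x)
qed

lemma implicit_function:
  assumes "ps_coeff h 0 0 = 0" "ps_coeff h 0 1 \<noteq> 0"
  obtains s where "coord_change \<^bold>x s" "subst h \<^bold>x s = \<^bold>y"
proof -
  have "coord_change \<^bold>x h" using assms by (intro coord_changeI) (simp_all add: ps_coeff_x)
  then obtain r s where rs: "coord_change r s" "subst \<^bold>x r s = \<^bold>x" "subst h r s = \<^bold>y"
    by (rule coord_changeE)
  then have "r = \<^bold>x" using coord_change_0[OF rs(1)] by simp
  then show ?thesis using that rs by simp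
qed

lemma implicit_function_root:
  assumes "ps_coeff h 0 0 = 0" "ps_coeff h 0 1 \<noteq> 0"
  obtains b where "x_series b" "ps_coeff b 0 0 = 0" "subst h \<^bold>x b = 0"
proof -
  obtain s where s: "coord_change \<^bold>x s" "subst h \<^bold>x s = \<^bold>y"
    using implicit_function[OF assms] .
  have "subst (subst h \<^bold>x s) \<^bold>x 0 = subst h \<^bold>x (restrict_x s)"
    using coord_change_0[OF s(1)] by (simp add: subst_subst restrict_x_eq_subst)
  then have "subst h \<^bold>x (restrict_x s) = 0" unfolding s by simp
  then show ?thesis using that[of "restrict_x s"] coord_change_0[OF s(1)] by simp
qed

lemma pair_linear_step:
  assumes ab: "a \<noteq> 0 \<or> b \<noteq> 0"
    and f: "ord_ge 2 (f - (ps_const a * \<^bold>x + ps_const b * \<^bold>y))"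
    and g: "ord_ge 3 (g - ps_const c * (ps_const a * \<^bold>x + ps_const b * \<^bold>y)\<^sup>2)"
  obtains f' g' where "pair_equivalent (f, g) (f', g')" "ord_ge 2 (f' - \<^bold>y)" "ord_ge 3 (g' - ps_const c * \<^bold>y\<^sup>2)"
proof -
  obtain p q where pq: "coord_change p q" "ps_const a * p + ps_const b * q = \<^bold>y"
  proof (cases "b = 0")
    case True
    have "coord_change (ps_const (1 / a) * \<^bold>y) \<^bold>x"
      using True ab by (intro coord_changeI) (simp_all add: ps_coeff_x ps_coeff_y)
    moreover have "ps_const a * (ps_const (1 / a) * \<^bold>y) + ps_const b * \<^bold>x = \<^bold>y"
      using True ab by (intro conv_ps_eqI) simp
    ultimately show ?thesis by (rule that)
  next
    case False
    have "coord_change \<^bold>x (ps_const (1 / b) * \<^bold>y - ps_const (a / b) * \<^bold>x)"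
      using False by (intro coord_changeI) (simp_all add: ps_coeff_x ps_coeff_y)
    moreover have "ps_const a * \<^bold>x + ps_const b * (ps_const (1 / b) * \<^bold>y - ps_const (a / b) * \<^bold>x) = \<^bold>y"
      using False by (intro conv_ps_eqI) (simp add: right_diff_distrib)
    ultimately show ?thesis by (rule that)
  qed
  note pq0 = coord_change_0[OF pq(1)]
  show ?thesis
  proof (rule that[OF pair_equivalentI[OF pq(1)]])
    show "ord_ge 2 (subst f p q - \<^bold>y)" "ord_ge 3 (subst g p q - ps_const c * \<^bold>y\<^sup>2)"
      using ord_ge_subst[OF pq0 f] ord_ge_subst[OF pq0 g] by (simp_all add: subst_hom pq0 pq(2))
  qed
qed

lemma pair_morse_step:
  assumes f: "ord_ge 2 (f - \<^bold>y)" and g: "ord_ge 3 (g - ps_const c * \<^bold>y\<^sup>2)" and c: "c \<noteq> 0"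
  obtains f' g0 where "pair_equivalent (f, g) (f', g0 + \<^bold>y\<^sup>2)" "ps_coeff f' 0 0 = 0" "ps_coeff f' 0 1 \<noteq> 0"
    "x_series g0" "ps_coeff g0 0 0 = 0"
proof -
  have y2: "\<^bold>y\<^sup>2 = \<^bold>y * \<^bold>y" by (rule power2_eq_square)
  have f01: "ps_coeff f 0 0 = 0" "ps_coeff f 0 1 = 1"
    using f by (auto simp: ord_ge_def ps_coeff_y dest!: spec[of _ 0]  dest: spec[of _ 1])
  have gc: "ps_coeff g i j = ps_coeff (ps_const c * \<^bold>y\<^sup>2) i j" if "i + j < 3" for i j
    using g that by (simp add: ord_ge_def)
  define h where "h = deriv_y g"
  have "ps_coeff h 0 0 = 0" "ps_coeff h 0 1 \<noteq> 0"
    using c by (simp_all add: h_def gc y2 ps_coeff_y_mult ps_coeff_y)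
  then obtain b where b: "x_series b" "ps_coeff b 0 0 = 0" "subst h \<^bold>x b = 0"
    by (rule implicit_function_root)
  \<comment> \<open>The shift moves the critical point of g in y to y = 0. This removes the terms
    linear in y and leaves g2(x, 0) + y^2 e.\<close>
  define f2 g2 where "f2 = subst f \<^bold>x (\<^bold>y + b)" and "g2 = subst g \<^bold>x (\<^bold>y + b)"
  have [simp]: "ps_coeff (\<^bold>y + b) 0 0 = 0" using b by simp
  have eq1: "pair_equivalent (f, g) (f2, g2)"
    unfolding f2_def g2_def by (rule pair_equivalentI[OF coord_change_shift[OF b(1,2)]])
  have b1: "ps_coeff b i 1 = 0" "ps_coeff b i 2 = 0" for i using b(1) by (simp_all add: x_series_def)
  have f2: "ps_coeff f2 0 0 = 0" "ps_coeff f2 0 1 = 1"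
    using b f01 b1 by (simp_all add: f2_def ps_coeff_subst_0_1[unfolded One_nat_def] ps_coeff_x ps_coeff_y)
  have "deriv_y b = 0" using b(1) by (intro conv_ps_eqI) (simp add: x_series_def)
  then have "deriv_y g2 = subst h \<^bold>x (\<^bold>y + b)"
    using b by (simp add: g2_def deriv_y_subst h_def)
  then have "restrict_x (deriv_y g2) = subst (subst h \<^bold>x (\<^bold>y + b)) \<^bold>x 0"
    by (simp add: restrict_x_eq_subst)
  also have "\<dots> = 0"
    using b by (simp add: subst_subst subst_hom subst_x_series_x)
  finally have "ps_coeff (restrict_x (deriv_y g2)) i 0 = 0" for i by simp
  then have g21: "ps_coeff g2 i 1 = 0" for i by simp
  define e where "e = shift_y (shift_y g2)"
  have g2: "g2 = restrict_x g2 + \<^bold>y\<^sup>2 * e"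
  proof -
    have "g2 = restrict_x g2 + \<^bold>y * (restrict_x (shift_y g2) + \<^bold>y * e)"
      unfolding e_def by (metis restrict_x_plus_shift_y)
    moreover have "restrict_x (shift_y g2) = 0"
      using g21 by (intro x_series_eqI) auto
    ultimately show ?thesis by (simp add: power2_eq_square mult_ac)
  qed
  have "ord_ge 3 (subst (g - ps_const c * \<^bold>y\<^sup>2) \<^bold>x (\<^bold>y + b))"
    by (rule ord_ge_subst[OF _ _ g]) (use b in auto)
  then have "ord_ge 3 (g2 - ps_const c * (\<^bold>y + b)\<^sup>2)"
    using b by (simp add: subst_hom g2_def)
  then have "ps_coeff (g2 - ps_const c * (\<^bold>y + b)\<^sup>2) 0 0 = 0" "ps_coeff (g2 - ps_const c * (\<^bold>y + b)\<^sup>2) 0 2 = 0"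
    by (rule ord_ge_def[THEN iffD1, rule_format]; simp)+
  moreover have "ps_coeff ((\<^bold>y + b)\<^sup>2) 0 2 = 1"
  proof -
    have "(\<^bold>y + b)\<^sup>2 = \<^bold>y * \<^bold>y + 2 * (\<^bold>y * b) + b\<^sup>2" by (simp add: power2_eq_square algebra_simps)
    moreover have "ps_coeff (b\<^sup>2) 0 2 = 0" using x_series_intros(5)[OF b(1)] by (simp add: x_series_def)
    ultimately show ?thesis using b1(1)[of 0] by (simp add: ps_coeff_y_mult ps_coeff_y)
  qed
  ultimately have g20: "ps_coeff g2 0 0 = 0" "ps_coeff g2 0 2 = c"
    using b by simp_all
  have "ps_coeff e 0 0 \<noteq> 0" using g20 c by (simp add: e_def numeral_2_eq_2)
  then obtain w where w: "w ^ 2 = e" using unit_root[of 2 e] by auto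
  have w0: "ps_coeff w 0 0 \<noteq> 0"
    using \<open>ps_coeff e 0 0 \<noteq> 0\<close> by (simp flip: w)
  \<comment> \<open>The new coordinate is y w, whose square is y^2 e; s expresses the old y by
    it.\<close>
  obtain s where s: "coord_change \<^bold>x s" "subst (\<^bold>y * w) \<^bold>x s = \<^bold>y"
    by (rule implicit_function[of "\<^bold>y * w"]) (use w0 in \<open>simp_all add: ps_coeff_y_mult\<close>)
  note s0 = coord_change_0[OF s(1)]
  have s1: "ps_coeff s 0 1 \<noteq> 0"
    using arg_cong[OF s(2), of "\<lambda>h. ps_coeff h 0 1"] ps_coeff_subst_0_1[OF s0, of "\<^bold>y * w"]
    by (auto simp: ps_coeff_x ps_coeff_y ps_coeff_y_mult)
  have "subst g2 \<^bold>x s = subst (restrict_x g2 + (\<^bold>y * w)\<^sup>2) \<^bold>x s"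
    by (subst g2) (simp add: w[symmetric] power_mult_distrib)
  also have "\<dots> = restrict_x g2 + (subst (\<^bold>y * w) \<^bold>x s)\<^sup>2"
    using s0 by (simp add: subst_add subst_x_series_x)
  also have "\<dots> = restrict_x g2 + \<^bold>y\<^sup>2" by (simp only: s(2))
  finally have g3: "subst g2 \<^bold>x s = restrict_x g2 + \<^bold>y\<^sup>2" .
  have "pair_equivalent (f2, g2) (subst f2 \<^bold>x s, restrict_x g2 + \<^bold>y\<^sup>2)"
    unfolding g3[symmetric] by (rule pair_equivalentI[OF s(1)])
  with eq1 have eq2: "pair_equivalent (f, g) (subst f2 \<^bold>x s, restrict_x g2 + \<^bold>y\<^sup>2)"
    by (rule pair_equivalent_trans)
  show ?thesis
  proof (rule that[OF eq2])
    show "ps_coeff (subst f2 \<^bold>x s) 0 0 = 0" "ps_coeff (subst f2 \<^bold>x s) 0 1 \<noteq> 0"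
      using s0 s1 f2 ps_coeff_subst_0_1[OF s0, of f2] by (simp_all add: ps_coeff_x)
  qed (simp_all add: g20)
qed

text \<open>The shift that makes the smooth branch y = 0 costs the symmetric form of the other
  branch: y^2 becomes (y + b)^2, so \<alpha> = -b and \<delta> = -g0.\<close>

lemma pair_straighten_step:
  assumes f: "ps_coeff f 0 0 = 0" "ps_coeff f 0 1 \<noteq> 0" and g0: "x_series g0" "ps_coeff g0 0 0 = 0"
  obtains u \<alpha> \<delta> where "pair_equivalent (f, g0 + \<^bold>y\<^sup>2) (\<^bold>y * u, (\<^bold>y - \<alpha>)\<^sup>2 - \<delta>)" "u dvd 1"
    "x_series \<alpha>" "ps_coeff \<alpha> 0 0 = 0" "x_series \<delta>" "ps_coeff \<delta> 0 0 = 0"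
proof -
  obtain b where b: "x_series b" "ps_coeff b 0 0 = 0" "subst f \<^bold>x b = 0"
    using implicit_function_root[OF f] .
  define f2 where "f2 = subst f \<^bold>x (\<^bold>y + b)"
  have "restrict_x f2 = 0"
    using b by (simp add: f2_def restrict_x_eq_subst subst_subst subst_hom subst_x_series_x)
  then obtain u where u: "f2 = \<^bold>y * u" unfolding y_dvd_iff_restrict_x[symmetric] by blast
  have "ps_coeff u 0 0 = ps_coeff f2 0 1" by (simp add: u ps_coeff_y_mult)
  also have "\<dots> = ps_coeff f 0 1"
    using b ps_coeff_subst_0_1[of "\<^bold>x" "\<^bold>y + b" f] by (simp add: f2_def ps_coeff_x ps_coeff_y x_series_def)
  finally have "u dvd 1" using f by (simp add: unit_iff)
  have "subst (g0 + \<^bold>y\<^sup>2) \<^bold>x (\<^bold>y + b) = (\<^bold>y - (- b))\<^sup>2 - (- g0)"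
    using b g0 by (simp add: subst_hom subst_x_series_x)
  then have "pair_equivalent (f, g0 + \<^bold>y\<^sup>2) (\<^bold>y * u, (\<^bold>y - (- b))\<^sup>2 - (- g0))"
    using pair_equivalentI[OF coord_change_shift[OF b(1,2)], of f "g0 + \<^bold>y\<^sup>2"] by (simp flip: f2_def u)
  then show ?thesis
    by (rule that) (use b g0 \<open>u dvd 1\<close> in auto)
qed

lemma pair_normalization:
  assumes "multiplicity0 f = 1" "multiplicity0 g = 2" "tangent_cone f = tangent_cone g"
  obtains u \<alpha> \<delta> where "pair_equivalent (f, g) (\<^bold>y * u, (\<^bold>y - \<alpha>)\<^sup>2 - \<delta>)" "u dvd 1"
    "x_series \<alpha>" "ps_coeff \<alpha> 0 0 = 0" "x_series \<delta>" "ps_coeff \<delta> 0 0 = 0"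
proof -
  obtain a b c where 0: "a \<noteq> 0 \<or> b \<noteq> 0" "c \<noteq> 0"
    "ord_ge 2 (f - (ps_const a * \<^bold>x + ps_const b * \<^bold>y))"
    "ord_ge 3 (g - ps_const c * (ps_const a * \<^bold>x + ps_const b * \<^bold>y)\<^sup>2)"
    using same_tangent_initial_forms[OF assms] .
  obtain f1 g1 where 1: "pair_equivalent (f, g) (f1, g1)" "ord_ge 2 (f1 - \<^bold>y)" "ord_ge 3 (g1 - ps_const c * \<^bold>y\<^sup>2)"
    using pair_linear_step[OF 0(1,3,4)] .
  obtain f2 g0 where 2: "pair_equivalent (f1, g1) (f2, g0 + \<^bold>y\<^sup>2)" "ps_coeff f2 0 0 = 0" "ps_coeff f2 0 1 \<noteq> 0"
    "x_series g0" "ps_coeff g0 0 0 = 0"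
    using pair_morse_step[OF 1(2,3) 0(2)] .
  obtain u \<alpha> \<delta> where 3: "pair_equivalent (f2, g0 + \<^bold>y\<^sup>2) (\<^bold>y * u, (\<^bold>y - \<alpha>)\<^sup>2 - \<delta>)" "u dvd 1"
    "x_series \<alpha>" "ps_coeff \<alpha> 0 0 = 0" "x_series \<delta>" "ps_coeff \<delta> 0 0 = 0"
    using pair_straighten_step[OF 2(2-5)] .
  show ?thesis
    by (rule that[OF pair_equivalent_trans[OF 1(1) pair_equivalent_trans[OF 2(1) 3(1)]] 3(2-6)])
qed

text \<open>A factorization in the new coordinates transports back to one of g. This excludes that
  \<delta> is a square.\<close>

lemma pair_equivalent_irreducible:
  assumes "pair_equivalent (f, g) (f', a * b)" "irreducible g"
  shows "ps_coeff a 0 0 \<noteq> 0 \<or> ps_coeff b 0 0 \<noteq> 0"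
proof -
  obtain p q where pq: "coord_change p q" "a * b = subst g p q"
    using assms(1) unfolding pair_equivalent_def by auto
  obtain r s where rs: "coord_change r s" "subst p r s = \<^bold>x" "subst q r s = \<^bold>y"
    using pq(1) by (rule coord_changeE)
  note 0 = coord_change_0[OF pq(1)] coord_change_0[OF rs(1)]
  have "g = subst (subst g p q) r s" by (simp add: subst_subst 0 rs)
  also have "\<dots> = subst a r s * subst b r s" by (simp add: subst_mult 0 flip: pq(2))
  finally have "subst a r s dvd 1 \<or> subst b r s dvd 1" using assms(2) by (rule irreducibleD[rotated])
  then show ?thesis by (simp add: unit_iff 0)
qed

text \<open>In the new coordinates the ideal is generated by y and the value x^N v of the second
  equation at y = 0. The functionals are therefore the first N coefficients of the restriction to y
  = 0, pulled back along the coordinate change.\<close>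

lemma intersection_mult_normalized:
  assumes eq: "pair_equivalent (f, g) (\<^bold>y * u, (\<^bold>y - \<alpha>)\<^sup>2 - \<delta>)" and u: "u dvd 1"
    and xs: "x_series \<alpha>" "x_series \<delta>" and v: "\<alpha>\<^sup>2 - \<delta> = \<^bold>x ^ N * v" "v dvd 1"
  shows "intersection_mult f g = enat N"
proof -
  obtain p q where pq: "coord_change p q" "\<^bold>y * u = subst f p q" "(\<^bold>y - \<alpha>)\<^sup>2 - \<delta> = subst g p q"
    using eq unfolding pair_equivalent_def by auto
  obtain r s where rs: "coord_change r s" "subst p r s = \<^bold>x" "subst q r s = \<^bold>y" "subst r p q = \<^bold>x" "subst s p q = \<^bold>y"
    using pq(1) by (rule coord_changeE)
  note 0 = coord_change_0[OF pq(1)] coord_change_0[OF rs(1)]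
  have inv: "subst (subst h p q) r s = h" "subst (subst h r s) p q = h" for h
    by (simp_all add: subst_subst 0 rs)
  define \<phi> where "\<phi> i h = ps_coeff (subst h p q) i 0" for i h
  define e where "e j = subst (\<^bold>x ^ j) r s" for j
  have J: "(\<forall>i<N. \<phi> i h = 0) \<longleftrightarrow> \<^bold>x ^ N dvd restrict_x (subst h p q)" for h
    by (auto simp: \<phi>_def x_power_dvd_iff)
  show ?thesis
    unfolding intersection_mult_def
  proof (rule codim_eqI[of \<phi> N e])
  show "\<phi> i (h + h') = \<phi> i h + \<phi> i h'" "\<phi> i (ps_const c * h) = c * \<phi> i h" for i h h' c
    by (simp_all add: \<phi>_def subst_add subst_mult 0)
  show "\<phi> i (e j) = (if i = j then 1 else 0)" for i j
    unfolding \<phi>_def e_def inv by (simp add: ps_coeff_x_power)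
  show "ideal_generated {f, g} = {h. \<forall>i<N. \<phi> i h = 0}"
    unfolding J
  proof
    show "ideal_generated {f, g} \<subseteq> {h. \<^bold>x ^ N dvd restrict_x (subst h p q)}"
    proof (rule ideal_generated_minimal)
      show "{f, g} \<subseteq> {h. \<^bold>x ^ N dvd restrict_x (subst h p q)}"
        using xs v(1) by (auto simp: restrict_x_id simp flip: pq(2,3))
    qed (auto simp: subst_hom 0)
    show "{h. \<^bold>x ^ N dvd restrict_x (subst h p q)} \<subseteq> ideal_generated {f, g}"
    proof clarify
      fix h assume "\<^bold>x ^ N dvd restrict_x (subst h p q)"
      then obtain t where t: "restrict_x (subst h p q) = \<^bold>x ^ N * t" by blast
      obtain v' where v': "1 = v * v'" using v by blast
      obtain u' where u': "1 = u * u'" using u by blast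
      have "u' * (\<^bold>y * u) = (u * u') * \<^bold>y" by (simp add: mult_ac)
      then have y: "u' * (\<^bold>y * u) = \<^bold>y" by (simp flip: u')
      define h' where "h' = subst h p q"
      have "h' = restrict_x h' + \<^bold>y * shift_y h'" by (rule restrict_x_plus_shift_y)
      also have "restrict_x h' = (\<^bold>x ^ N * v) * (v' * t)"
        using t v' by (simp add: h'_def mult_ac)
      also have "\<dots> = (\<alpha>\<^sup>2 - \<delta>) * (v' * t)" by (simp only: v(1))
      also have "\<dots> + \<^bold>y * shift_y h' = v' * t * ((\<^bold>y - \<alpha>)\<^sup>2 - \<delta>) + (shift_y h' - v' * t * (\<^bold>y - 2 * \<alpha>)) * \<^bold>y"
        by (simp add: power2_eq_square algebra_simps)
      also have "\<dots> = v' * t * ((\<^bold>y - \<alpha>)\<^sup>2 - \<delta>) + (shift_y h' - v' * t * (\<^bold>y - 2 * \<alpha>)) * u' * (\<^bold>y * u)"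
        by (simp only: mult.assoc y)
      also have "\<dots> = v' * t * subst g p q + (shift_y h' - v' * t * (\<^bold>y - 2 * \<alpha>)) * u' * subst f p q"
        by (simp only: pq)
      finally obtain A B where AB: "h' = A * subst g p q + B * subst f p q" by blast
      have "subst h' r s = subst A r s * g + subst B r s * f"
        unfolding AB by (simp add: subst_add subst_mult 0 inv)
      then have "h = subst A r s * g + subst B r s * f"
        unfolding h'_def inv .
      then show "h \<in> ideal_generated {f, g}"
        by (simp only:) (intro ideal_add ideal_mult ideal_base; simp)
    qed
  qed
qed
qed

section \<open>Reduction to the normal forms\<close>

lemma unit_factor: "1 = a * b \<Longrightarrow> b dvd 1" for a b :: conv_ps
  by (metis dvd_triv_right)

text \<open>If \<delta> were zero or of even order, it would be a square w^2 with w vanishing at the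
  origin, and (y - \<alpha> - w)(y - \<alpha> + w) would split the branch into two
  non-units.\<close>

lemma discriminant_order_odd:
  assumes eq: "pair_equivalent (f, g) (f', (\<^bold>y - \<alpha>)\<^sup>2 - \<delta>)" and irr: "irreducible g"
    and \<alpha>: "x_series \<alpha>" "ps_coeff \<alpha> 0 0 = 0" and \<delta>: "x_series \<delta>" "ps_coeff \<delta> 0 0 = 0"
  obtains d e where "\<delta> = \<^bold>x ^ d * e" "x_series e" "ps_coeff e 0 0 \<noteq> 0" "odd d"
proof -
  have square: False if w: "\<delta> = w\<^sup>2" "ps_coeff w 0 0 = 0" for w
  proof -
    have "(\<^bold>y - \<alpha>)\<^sup>2 - \<delta> = (\<^bold>y - \<alpha> - w) * (\<^bold>y - \<alpha> + w)"
      by (simp add: w(1) power2_eq_square algebra_simps)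
    then show False
      using pair_equivalent_irreducible[of f g f' "\<^bold>y - \<alpha> - w" "\<^bold>y - \<alpha> + w"] eq irr \<alpha> w(2) by simp
  qed
  have "\<delta> \<noteq> 0" using square[of 0] by auto
  then obtain d e where de: "\<delta> = \<^bold>x ^ d * e" "x_series e" "ps_coeff e 0 0 \<noteq> 0"
    using x_series_order[OF \<delta>(1)] by blast
  have "odd d"
  proof
    assume "even d"
    then obtain i where i: "d = 2 * i" by blast
    obtain w where w: "w ^ 2 = e" using unit_root[of 2 e] de(3) by auto
    have "i \<noteq> 0" using \<delta>(2) de(3) by (auto simp: de(1) i)
    then show False
      using square[of "\<^bold>x ^ i * w"] by (simp add: de(1) i w power_mult_distrib power_mult[symmetric] mult.commute)
  qed
  then show ?thesis using that de by blast
qed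

text \<open>The order of \<alpha>^2 is even and that of \<delta> odd, so leading terms cannot cancel
  in \<alpha>^2 - \<delta>: its order is the smaller of the two. Being equal to the odd number n, it
  must be the order of \<delta>.\<close>

lemma normalized_orders:
  assumes n: "odd n" and eq: "pair_equivalent (f, g) (\<^bold>y * u, (\<^bold>y - \<alpha>)\<^sup>2 - \<delta>)" and irr: "irreducible g"
    and im: "intersection_mult f g = enat n" and u: "u dvd 1"
    and \<alpha>: "x_series \<alpha>" "ps_coeff \<alpha> 0 0 = 0" and \<delta>: "x_series \<delta>" "ps_coeff \<delta> 0 0 = 0"
  obtains e where "\<delta> = \<^bold>x ^ n * e" "x_series e" "ps_coeff e 0 0 \<noteq> 0"
    "\<alpha> = 0 \<or> (\<exists>k a. \<alpha> = \<^bold>x ^ k * a \<and> n < 2 * k \<and> x_series a \<and> ps_coeff a 0 0 \<noteq> 0)"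
proof -
  obtain d e where de: "\<delta> = \<^bold>x ^ d * e" "x_series e" "ps_coeff e 0 0 \<noteq> 0" "odd d"
    using discriminant_order_odd[OF eq irr \<alpha> \<delta>] .
  have order: "N = n" if "\<alpha>\<^sup>2 - \<delta> = \<^bold>x ^ N * v" "ps_coeff v 0 0 \<noteq> 0" for N v
    using intersection_mult_normalized[OF eq u \<alpha>(1) \<delta>(1) that(1)] that(2) im by (simp add: unit_iff)
  show ?thesis
  proof (cases "\<alpha> = 0")
    case True
    have "d = n" by (rule order[of d "- e"]) (use de True in simp_all)
    then show ?thesis using that de True by blast
  next
    case False
    then obtain k a where ka: "\<alpha> = \<^bold>x ^ k * a" "x_series a" "ps_coeff a 0 0 \<noteq> 0"
      using x_series_order[OF \<alpha>(1)] by blast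
    have sq: "\<alpha>\<^sup>2 = \<^bold>x ^ (2 * k) * a\<^sup>2"
      unfolding ka(1) power_mult_distrib by (metis mult.commute power_mult)
    have "d \<noteq> 2 * k" using de(4) by auto
    then consider "2 * k < d" | "d < 2 * k" by linarith
    then show ?thesis
    proof cases
      case 1
      then obtain t where t: "d = 2 * k + Suc t" using less_imp_Suc_add by fastforce
      have "\<alpha>\<^sup>2 - \<delta> = \<^bold>x ^ (2 * k) * (a\<^sup>2 - \<^bold>x * \<^bold>x ^ t * e)"
        unfolding sq de(1) t power_add by (simp add: algebra_simps)
      then have "2 * k = n" by (rule order) (use ka in simp)
      then show ?thesis using n by auto
    next
      case 2
      then obtain t where t: "2 * k = d + Suc t" using less_imp_Suc_add by fastforce
      have "\<alpha>\<^sup>2 - \<delta> = \<^bold>x ^ d * (\<^bold>x * \<^bold>x ^ t * a\<^sup>2 - e)"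
        unfolding sq de(1) t power_add by (simp add: algebra_simps)
      then have "d = n" by (rule order) (use de in simp)
      then show ?thesis using that[OF _ de(2,3)] de(1) ka 2 by blast
    qed
  qed
qed

text \<open>The normal form is pulled back along (x A, y B), where it becomes B^3 times the given
  equation. In this direction A and B are constrained only by equations between series in x;
  symmetry of the equivalence turns the result around.\<close>

lemma normal_form_rescale:
  assumes AB: "x_series A" "ps_coeff A 0 0 \<noteq> 0" "x_series B" "ps_coeff B 0 0 \<noteq> 0"
    and c: "subst c (\<^bold>x * A) 0 = \<alpha> * B" "x_series c" and \<delta>: "(\<^bold>x * A) ^ n = \<delta> * B\<^sup>2"
  shows "analytically_equivalent (\<^bold>y * ((\<^bold>y - \<alpha>)\<^sup>2 - \<delta>)) (normal_form n c)"
proof (rule analytically_equivalent_sym)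
  have c0: "ps_coeff (\<^bold>x * A) 0 0 = 0" "ps_coeff (\<^bold>y * B) 0 0 = 0" by simp_all
  have cc: "coord_change (\<^bold>x * A) (\<^bold>y * B)"
    using AB by (intro coord_changeI) (simp_all add: ps_coeff_x_mult ps_coeff_y_mult x_series_def)
  obtain v where v: "v * B = 1" "ps_coeff v 0 0 \<noteq> 0" using x_series_inverse[OF AB(4,3)] .
  have "subst (normal_form n c) (\<^bold>x * A) (\<^bold>y * B) = \<^bold>y * B * ((\<^bold>y * B - \<alpha> * B)\<^sup>2 - \<delta> * B\<^sup>2)"
    unfolding normal_form_def using subst_x_series[OF c(2) c0]
    by (simp add: subst_hom[OF c0] subst_power[OF c0] subst_x[OF c0] subst_y[OF c0] c(1) \<delta> del: subst_x subst_y subst_power)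
  also have "\<dots> = B ^ 3 * (\<^bold>y * ((\<^bold>y - \<alpha>)\<^sup>2 - \<delta>))"
    by (simp add: power2_eq_square power3_eq_cube algebra_simps)
  finally have "v ^ 3 * subst (normal_form n c) (\<^bold>x * A) (\<^bold>y * B) = (v * B) ^ 3 * (\<^bold>y * ((\<^bold>y - \<alpha>)\<^sup>2 - \<delta>))"
    by (simp add: power_mult_distrib mult.assoc)
  then have "\<^bold>y * ((\<^bold>y - \<alpha>)\<^sup>2 - \<delta>) = v ^ 3 * subst (normal_form n c) (\<^bold>x * A) (\<^bold>y * B)"
    unfolding v(1) by simp
  then show "analytically_equivalent (normal_form n c) (\<^bold>y * ((\<^bold>y - \<alpha>)\<^sup>2 - \<delta>))"
    by (rule analytically_equivalentI[OF cc, rotated]) (use v(2) in \<open>simp add: unit_iff\<close>)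
qed

lemma normal_form_no_alpha:
  assumes "n > 0" "x_series e" "ps_coeff e 0 0 \<noteq> 0"
  shows "analytically_equivalent (\<^bold>y * (\<^bold>y\<^sup>2 - \<^bold>x ^ n * e)) (normal_form n 0)"
proof -
  obtain A where A: "A ^ n = e" "x_series A" "ps_coeff A 0 0 \<noteq> 0"
    using x_series_root[OF assms(1,3,2)] .
  show ?thesis
    using normal_form_rescale[of A 1 0 0 n "\<^bold>x ^ n * e"] A
    by (simp add: power_mult_distrib ps_coeff_one)
qed

text \<open>
  With X = xA and Y = yB the equations \<open>\<alpha> B = X^k\<close> and \<open>\<delta> B^2 = X^n\<close> determine A and B
  explicitly, because 2k - n is positive.
\<close>

lemma normal_form_alpha:
  assumes n: "n < 2 * k" and a: "x_series a" "ps_coeff a 0 0 \<noteq> 0" and e: "x_series e" "ps_coeff e 0 0 \<noteq> 0"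
  shows "analytically_equivalent (\<^bold>y * ((\<^bold>y - \<^bold>x ^ k * a)\<^sup>2 - \<^bold>x ^ n * e)) (normal_form n (\<^bold>x ^ k))"
proof -
  obtain e' where e': "e' * e = 1" "x_series e'" "ps_coeff e' 0 0 \<noteq> 0" using x_series_inverse[OF e(2,1)] .
  obtain a' where a': "a' * a = 1" "x_series a'" "ps_coeff a' 0 0 \<noteq> 0" using x_series_inverse[OF a(2,1)] .
  \<comment> \<open>The first equation gives B = A^k / a; inserted into the second it leaves A^(2k -
    n) = a^2 / e.\<close>
  obtain A where A: "A ^ (2 * k - n) = a\<^sup>2 * e'" "x_series A" "ps_coeff A 0 0 \<noteq> 0"
    by (rule x_series_root[of "2 * k - n" "a\<^sup>2 * e'"]) (use n a e' in auto)
  define B where "B = A ^ k * a'"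
  have c: "subst (\<^bold>x ^ k) (\<^bold>x * A) 0 = (\<^bold>x ^ k * a) * B"
  proof -
    have "(\<^bold>x ^ k * a) * B = (a' * a) * (\<^bold>x * A) ^ k"
      by (simp add: B_def power_mult_distrib mult_ac)
    then show ?thesis using a' by simp
  qed
  have d: "(\<^bold>x * A) ^ n = (\<^bold>x ^ n * e) * B\<^sup>2"
  proof -
    have "(A ^ k)\<^sup>2 = A ^ n * A ^ (2 * k - n)"
      using n by (simp flip: power_mult power_add add: mult.commute)
    then have "(\<^bold>x ^ n * e) * B\<^sup>2 = \<^bold>x ^ n * e * (A ^ n * (a\<^sup>2 * e')) * a'\<^sup>2"
      by (simp add: B_def power_mult_distrib A mult.assoc)
    also have "\<dots> = (e' * e) * (a' * a)\<^sup>2 * (\<^bold>x * A) ^ n"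
      by (simp add: power_mult_distrib mult_ac)
    finally show ?thesis by (simp add: e' a')
  qed
  show ?thesis
    by (rule normal_form_rescale[OF A(2,3) _ _ c _ d]) (use A a' in \<open>auto simp: B_def\<close>)
qed

text \<open>For z = x^(k - n), adding z y^2 to y turns y - x^k into y + z (y^2 - x^n), which agrees
  with y modulo the cusp. So y^2 - x^n divides the transformed equation of the double branch, while
  y = 0 is preserved.\<close>

lemma normal_form_high_order:
  assumes n: "n \<ge> 2" "n \<le> k"
  shows "analytically_equivalent (normal_form n (\<^bold>x ^ k)) (normal_form n 0)"
proof -
  define z where "z = \<^bold>x ^ (k - n)"
  have xk: "\<^bold>x ^ k = z * \<^bold>x ^ n" unfolding z_def using n by (simp flip: power_add)
  have q: "coord_change \<^bold>x (\<^bold>y + \<^bold>y * (\<^bold>y * z))"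
    by (intro coord_changeI) (simp_all add: ps_coeff_x ps_coeff_y ps_coeff_y_mult)
  have c0: "ps_coeff \<^bold>x 0 0 = 0" "ps_coeff (\<^bold>y + \<^bold>y * (\<^bold>y * z)) 0 0 = 0" by simp_all
  define w where "w = (1 + \<^bold>y * z) * (1 + 2 * (\<^bold>y * z) + z\<^sup>2 * (\<^bold>y\<^sup>2 - \<^bold>x ^ n))"
  have w: "w dvd 1" using n by (simp add: w_def unit_iff ps_coeff_one ps_coeff_numeral power_0_left)
  have "subst (normal_form n (\<^bold>x ^ k)) \<^bold>x (\<^bold>y + \<^bold>y * (\<^bold>y * z)) = w * normal_form n 0"
    unfolding normal_form_def w_def using c0
    by (simp add: subst_hom[OF c0] subst_power[OF c0] subst_x[OF c0] subst_y[OF c0] del: subst_x subst_y subst_power)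
       (simp add: xk power2_eq_square algebra_simps)
  moreover obtain w' where w': "1 = w * w'" using w by blast
  ultimately have "normal_form n 0 = w' * subst (normal_form n (\<^bold>x ^ k)) \<^bold>x (\<^bold>y + \<^bold>y * (\<^bold>y * z))"
    by (simp only: mult.assoc[symmetric] mult.commute[of w'] w'[symmetric] mult_1)
  moreover have "w' dvd 1" using w' by (rule unit_factor)
  ultimately show "analytically_equivalent (normal_form n (\<^bold>x ^ k)) (normal_form n 0)"
    using analytically_equivalentI[OF q] by blast
qed

text \<open>
  On the cusp x = s^2, y = s^n put T = s(1 + cs^(n-2)). The coefficient of s^(2n-2) in
  T^n + T^(2n-2) vanishes for c = -1/n; then T^2 and T^n + T^(2n-2) are functions of x and y that
  reparametrize the cusp as a branch of the curve with k = n - 1.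
\<close>

lemma normal_form_order_pred:
  assumes n: "odd n" "n \<ge> 3"
  shows "analytically_equivalent (normal_form n (\<^bold>x ^ (n - 1))) (normal_form n 0)"
proof -
  obtain l where l: "n = l + 3" using n le_Suc_ex[of 3 n] by (auto simp: add.commute)
  define c where "c = ps_const (- 1 / of_nat n)"
  have nc: "of_nat n * c = - 1"
    using n by (simp add: c_def flip: ps_const_of_nat ps_const_mult) (simp add: ps_const_uminus)
  have c: "x_series c" by (simp add: c_def)
  \<comment> \<open>With y standing for s^(n - 2), this is (T^n + T^(2n - 2)) / s^n. The term linear
    in y, which has coefficient n c + 1 = 0, must vanish because s^(n - 2) is not a function of s^2
    and s^n.\<close>
  define \<Phi> where "\<Phi> = (1 + c * \<^bold>y) ^ n + \<^bold>y * (1 + c * \<^bold>y) ^ (2 * n - 2)"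
  define \<Psi> where "\<Psi> = shift_y (shift_y \<Phi>)"
  have \<Phi>: "\<Phi> = 1 + \<^bold>y\<^sup>2 * \<Psi>"
  proof -
    have "restrict_x \<Phi> = 1" using c by (simp add: \<Phi>_def)
    moreover have "restrict_x (shift_y \<Phi>) = 0"
    proof (rule x_series_eqI)
      have "deriv_y c = 0" using c by (intro conv_ps_eqI) (simp add: x_series_def)
      then have "restrict_x (deriv_y \<Phi>) = of_nat n * c + 1"
        using c by (simp add: \<Phi>_def deriv_y_mult deriv_y_power restrict_x_id)
      then have "restrict_x (deriv_y \<Phi>) = 0" by (simp add: nc)
      then have "ps_coeff (restrict_x (deriv_y \<Phi>)) i 0 = 0" for i by simp
      then show "ps_coeff (restrict_x (shift_y \<Phi>)) i 0 = ps_coeff 0 i 0" for i by simp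
    qed auto
    ultimately have "\<Phi> = 1 + \<^bold>y * (0 + \<^bold>y * \<Psi>)"
      unfolding \<Psi>_def by (metis restrict_x_plus_shift_y)
    then show ?thesis by (simp add: power2_eq_square mult.assoc)
  qed
  define E O' where "E = even_y \<Psi>" and "O' = even_y (shift_y \<Psi>)"
  define X where "X = \<^bold>x ^ Suc l"
  \<comment> \<open>V restricts on the cusp to \<Phi> at s^(n - 2). If Y = s^(n - 2), then Y^2 =
    x^(n - 2) and Y^3 = y x^(n - 3), so all powers of Y from the second on are functions of x and y:
    even ones go through E, odd ones through O'.\<close>
  define V where "V = 1 + X * subst E 0 X + \<^bold>y * (\<^bold>x ^ l * subst O' 0 X)"
  \<comment> \<open>The expression for p is T^2 = s^2 + 2 c s^n + c^2 s^(2n - 2) rewritten with x =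
    s^2, y = s^n. Having y as a factor of q preserves the smooth branch.\<close>
  define p q where "p = \<^bold>x + 2 * c * \<^bold>y + c\<^sup>2 * \<^bold>x ^ (l + 2)" and "q = \<^bold>y * V"
  have X0: "ps_coeff X 0 0 = 0" by (simp add: X_def)
  have V0: "ps_coeff V 0 0 = 1" by (simp add: V_def X0 ps_coeff_one)
  have p0: "ps_coeff p 0 0 = 0" and q0: "ps_coeff q 0 0 = 0" by (simp_all add: p_def q_def)
  have pq: "coord_change p q"
  proof (rule coord_changeI[OF p0 q0])
    have "ps_coeff p 1 0 = 1"
    proof -
      have "p = \<^bold>x + \<^bold>y * (2 * c) + \<^bold>x ^ (l + 2) * c\<^sup>2" by (simp add: p_def mult_ac)
      then show ?thesis by (simp only: ps_coeff_add ps_coeff_x ps_coeff_y_mult ps_coeff_x_power_mult) simp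
    qed
    then show "ps_coeff p 1 0 * ps_coeff q 0 1 - ps_coeff p 0 1 * ps_coeff q 1 0 \<noteq> 0"
      by (simp add: q_def ps_coeff_y_mult V0)
  qed
  define T where "T = \<^bold>x * (1 + c * X)"
  have s0: "ps_coeff (\<^bold>x\<^sup>2) 0 0 = 0" "ps_coeff (\<^bold>x ^ n) 0 0 = 0" using n by simp_all
  have xl: "(\<^bold>x\<^sup>2) ^ l = \<^bold>x ^ l * \<^bold>x ^ l" by (simp add: power2_eq_square power_mult_distrib)
  have sX: "subst X (\<^bold>x\<^sup>2) (\<^bold>x ^ n) = X\<^sup>2"
  proof -
    have "subst X (\<^bold>x\<^sup>2) (\<^bold>x ^ n) = (\<^bold>x\<^sup>2) ^ Suc l"
      unfolding X_def using s0 by (simp only: subst_power subst_x)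
    then show ?thesis unfolding X_def by (metis mult.commute power_mult)
  qed
  have sp: "subst p (\<^bold>x\<^sup>2) (\<^bold>x ^ n) = T\<^sup>2"
  proof -
    have "subst c (\<^bold>x\<^sup>2) (\<^bold>x ^ n) = c" unfolding c_def using s0 by simp
    then have "subst p (\<^bold>x\<^sup>2) (\<^bold>x ^ n) = \<^bold>x\<^sup>2 + 2 * c * \<^bold>x ^ n + c\<^sup>2 * (\<^bold>x\<^sup>2) ^ (l + 2)"
      unfolding p_def using s0 by (simp add: subst_hom)
    also have "\<dots> = T\<^sup>2"
      unfolding T_def X_def l power_add xl by (simp add: power2_eq_square power3_eq_cube algebra_simps)
    finally show ?thesis .
  qed
  have sq: "subst q (\<^bold>x\<^sup>2) (\<^bold>x ^ n) = T ^ n + T ^ (2 * n - 2)"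
  proof -
    have "subst V (\<^bold>x\<^sup>2) (\<^bold>x ^ n) = 1 + X\<^sup>2 * subst E 0 (X\<^sup>2) + \<^bold>x ^ n * ((\<^bold>x\<^sup>2) ^ l * subst O' 0 (X\<^sup>2))"
      unfolding V_def using s0 X0 by (simp add: subst_hom subst_subst sX)
    also have "\<^bold>x ^ n * ((\<^bold>x\<^sup>2) ^ l * subst O' 0 (X\<^sup>2)) = X\<^sup>2 * (X * subst O' 0 (X\<^sup>2))"
      unfolding X_def l power_add xl by (simp add: power2_eq_square power3_eq_cube mult_ac)
    also have "1 + X\<^sup>2 * subst E 0 (X\<^sup>2) + X\<^sup>2 * (X * subst O' 0 (X\<^sup>2)) = 1 + X\<^sup>2 * (subst E 0 (X\<^sup>2) + X * subst O' 0 (X\<^sup>2))"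
      by (simp add: algebra_simps)
    also have "subst E 0 (X\<^sup>2) + X * subst O' 0 (X\<^sup>2) = subst (subst E \<^bold>x (\<^bold>y\<^sup>2) + \<^bold>y * subst O' \<^bold>x (\<^bold>y\<^sup>2)) 0 X"
      using X0 by (simp add: subst_hom subst_subst)
    also have "\<dots> = subst \<Psi> 0 X"
      unfolding E_def O'_def by (simp flip: even_odd_decomposition)
    also have "1 + X\<^sup>2 * \<dots> = subst \<Phi> 0 X"
      unfolding \<Phi> using X0 by (simp add: subst_hom)
    also have "\<dots> = (1 + c * X) ^ n + X * (1 + c * X) ^ (2 * n - 2)"
      unfolding \<Phi>_def c_def using X0 by (simp add: subst_hom)
    finally have "subst q (\<^bold>x\<^sup>2) (\<^bold>x ^ n) = \<^bold>x ^ n * ((1 + c * X) ^ n + X * (1 + c * X) ^ (2 * n - 2))"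
      unfolding q_def using s0 by (simp add: subst_hom)
    also have "\<dots> = T ^ n + T ^ (2 * n - 2)"
    proof -
      have "2 * n - 2 = n + Suc l" by (simp add: l)
      then have "\<^bold>x ^ n * X = \<^bold>x ^ (2 * n - 2)" by (simp only: X_def power_add)
      moreover have "T ^ n = \<^bold>x ^ n * (1 + c * X) ^ n"
        "T ^ (2 * n - 2) = \<^bold>x ^ (2 * n - 2) * (1 + c * X) ^ (2 * n - 2)"
        by (simp_all only: T_def power_mult_distrib)
      ultimately show ?thesis by (simp only: distrib_left mult.assoc[symmetric])
    qed
    finally show ?thesis .
  qed
  \<comment> \<open>On the cusp q - p^(n - 1) becomes T^n, whose square is the value of p^n; hence
    the cusp equation divides G.\<close>
  define G where "G = (q - p ^ (n - 1))\<^sup>2 - p ^ n"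
  have "(T\<^sup>2) ^ (n - 1) = T ^ (2 * n - 2)"
  proof -
    have "2 * (n - 1) = 2 * n - 2" by simp
    then show ?thesis by (metis power_mult)
  qed
  moreover have "(T\<^sup>2) ^ n = (T ^ n)\<^sup>2" by (metis mult.commute power_mult)
  moreover have "subst G (\<^bold>x\<^sup>2) (\<^bold>x ^ n) = (T ^ n + T ^ (2 * n - 2) - (T\<^sup>2) ^ (n - 1))\<^sup>2 - (T\<^sup>2) ^ n"
    unfolding G_def using s0 by (simp add: subst_hom sp sq)
  ultimately have "subst G (\<^bold>x\<^sup>2) (\<^bold>x ^ n) = 0" by simp
  then have "\<^bold>y\<^sup>2 - \<^bold>x ^ n dvd G" unfolding cusp_dvd_iff[OF n(1)] .
  then obtain H where H: "G = (\<^bold>y\<^sup>2 - \<^bold>x ^ n) * H" by blast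
  \<comment> \<open>Since n \<ge> 3, the powers of p only contribute to order 3 and higher, so G is
    y^2 up to order 3. Comparing coefficients of y^2 shows that the cofactor is a unit, so nothing
    but the cusp is pulled back.\<close>
  have "ps_coeff H 0 0 = 1"
  proof -
    have pn: "ord_ge 2 (p ^ (n - 1))" "ord_ge 3 (p ^ n)"
      using p0 n ord_ge_mono[OF ord_ge_power[of p "n - 1"], of 2] ord_ge_mono[OF ord_ge_power[of p n], of 3]
      by (simp_all add: ord_ge_1_iff[unfolded One_nat_def])
    have "ord_ge 1 (V - 1)" by (simp add: ord_ge_1_iff[unfolded One_nat_def] V0 ps_coeff_one)
    moreover have y1: "ord_ge 1 \<^bold>y" by (simp add: ord_ge_1_iff[unfolded One_nat_def])
    ultimately have "ord_ge 2 (\<^bold>y * (V - 1))" using ord_ge_mult[of 1 "\<^bold>y" 1 "V - 1"] by (simp add: numeral_2_eq_2)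
    then have r: "ord_ge 2 (\<^bold>y * (V - 1) - p ^ (n - 1))" using pn(1) by (rule ord_ge_diff)
    define r where "r = \<^bold>y * (V - 1) - p ^ (n - 1)"
    have "q - p ^ (n - 1) = \<^bold>y + r" by (simp add: q_def r_def algebra_simps)
    then have G: "G - \<^bold>y\<^sup>2 = (\<^bold>y * r + \<^bold>y * r + r * r) - p ^ n"
      unfolding G_def by (simp add: power2_eq_square algebra_simps)
    have "ord_ge 3 (\<^bold>y * r)" "ord_ge 4 (r * r)"
      using ord_ge_mult[OF y1 r, folded r_def] ord_ge_mult[OF r r, folded r_def]
      by (simp_all add: numeral_eq_Suc)
    moreover from this(2) have "ord_ge 3 (r * r)" by (rule ord_ge_mono) simp
    ultimately have "ord_ge 3 (G - \<^bold>y\<^sup>2)"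
      unfolding G by (intro ord_ge_diff ord_ge_add pn)
    then have "ps_coeff (G - \<^bold>y\<^sup>2) 0 2 = 0" by (simp add: ord_ge_def)
    moreover have "ps_coeff G 0 2 = ps_coeff H 0 0"
      using n unfolding H left_diff_distrib ps_coeff_diff by (simp add: ps_coeff_y_power_mult ps_coeff_x_power_mult)
    moreover have "ps_coeff (\<^bold>y\<^sup>2) 0 2 = 1"
      by (simp add: power2_eq_square ps_coeff_y_mult ps_coeff_y)
    ultimately show ?thesis by simp
  qed
  then have unit: "V * H dvd 1" by (simp add: unit_iff V0)
  have "subst (normal_form n (\<^bold>x ^ (n - 1))) p q = q * G"
    unfolding normal_form_def G_def using p0 q0 by (simp add: subst_hom)
  also have "\<dots> = (V * H) * normal_form n 0"
    unfolding H q_def normal_form_def by (simp add: mult_ac)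
  finally have e: "subst (normal_form n (\<^bold>x ^ (n - 1))) p q = (V * H) * normal_form n 0" .
  obtain w where w: "1 = V * H * w" using unit by blast
  show ?thesis
  proof (rule analytically_equivalentI[OF pq])
    have "w * subst (normal_form n (\<^bold>x ^ (n - 1))) p q = (V * H * w) * normal_form n 0"
      unfolding e by (simp only: mult_ac)
    then show "normal_form n 0 = w * subst (normal_form n (\<^bold>x ^ (n - 1))) p q"
      unfolding w[symmetric] by simp
    show "w dvd 1" using w by (rule unit_factor)
  qed
qed

lemma classification:
  assumes n: "odd n" "n \<ge> 3" and f: "multiplicity0 f\<^sub>1 = 1" and g: "irreducible g" "multiplicity0 g = 2"
    and tc: "tangent_cone f\<^sub>1 = tangent_cone g" and im: "intersection_mult f\<^sub>1 g = enat n"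
  shows "analytically_equivalent (f\<^sub>1 * g) (normal_form n 0) \<or>
    (\<exists>k. n < 2 * k \<and> k + 2 \<le> n \<and> analytically_equivalent (f\<^sub>1 * g) (normal_form n (\<^bold>x ^ k)))"
proof -
  obtain u \<alpha> \<delta> where eq: "pair_equivalent (f\<^sub>1, g) (\<^bold>y * u, (\<^bold>y - \<alpha>)\<^sup>2 - \<delta>)" and u: "u dvd 1"
    and \<alpha>: "x_series \<alpha>" "ps_coeff \<alpha> 0 0 = 0" and \<delta>: "x_series \<delta>" "ps_coeff \<delta> 0 0 = 0"
    using pair_normalization[OF f g(2) tc] .
  obtain p q where pq: "coord_change p q" "\<^bold>y * u = subst f\<^sub>1 p q" "(\<^bold>y - \<alpha>)\<^sup>2 - \<delta> = subst g p q"
    using eq unfolding pair_equivalent_def by auto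
  obtain u' where u': "1 = u * u'" using u by blast
  have "subst (f\<^sub>1 * g) p q = \<^bold>y * u * ((\<^bold>y - \<alpha>)\<^sup>2 - \<delta>)"
    unfolding pq(2,3) by (rule subst_mult[OF coord_change_0[OF pq(1)]])
  then have "u' * subst (f\<^sub>1 * g) p q = (u * u') * (\<^bold>y * ((\<^bold>y - \<alpha>)\<^sup>2 - \<delta>))"
    by (simp only: mult_ac)
  then have "\<^bold>y * ((\<^bold>y - \<alpha>)\<^sup>2 - \<delta>) = u' * subst (f\<^sub>1 * g) p q" unfolding u'[symmetric] by simp
  moreover have "u' dvd 1" using u' by (rule unit_factor)
  ultimately have E: "analytically_equivalent (f\<^sub>1 * g) (\<^bold>y * ((\<^bold>y - \<alpha>)\<^sup>2 - \<delta>))"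
    using analytically_equivalentI[OF pq(1)] by blast
  obtain e where e: "\<delta> = \<^bold>x ^ n * e" "x_series e" "ps_coeff e 0 0 \<noteq> 0" and
    cases: "\<alpha> = 0 \<or> (\<exists>k a. \<alpha> = \<^bold>x ^ k * a \<and> n < 2 * k \<and> x_series a \<and> ps_coeff a 0 0 \<noteq> 0)"
    using normalized_orders[OF n(1) eq g(1) im u \<alpha> \<delta>] .
  from cases show ?thesis
  proof
    assume "\<alpha> = 0"
    then have "analytically_equivalent (\<^bold>y * ((\<^bold>y - \<alpha>)\<^sup>2 - \<delta>)) (normal_form n 0)"
      using normal_form_no_alpha[OF _ e(2,3), of n] n by (simp add: e(1))
    then show ?thesis using analytically_equivalent_trans[OF E] by blast
  next
    assume "\<exists>k a. \<alpha> = \<^bold>x ^ k * a \<and> n < 2 * k \<and> x_series a \<and> ps_coeff a 0 0 \<noteq> 0"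
    then obtain k a where ka: "\<alpha> = \<^bold>x ^ k * a" "n < 2 * k" "x_series a" "ps_coeff a 0 0 \<noteq> 0" by blast
    have E2: "analytically_equivalent (f\<^sub>1 * g) (normal_form n (\<^bold>x ^ k))"
      using analytically_equivalent_trans[OF E[unfolded ka(1) e(1)] normal_form_alpha[OF ka(2-4) e(2,3)]] .
    consider "k + 2 \<le> n" | "k = n - 1" | "n \<le> k" by linarith
    then show ?thesis
    proof cases
      case 1
      then show ?thesis using E2 ka(2) by blast
    next
      case 2
      then show ?thesis using analytically_equivalent_trans[OF E2] normal_form_order_pred[OF n] by blast
    next
      case 3
      then show ?thesis using analytically_equivalent_trans[OF E2] normal_form_high_order[of n k] n by auto
    qed
  qed
qed

theorem mainTheorem4:
  fixes n :: nat and f f\<^sub>1 g :: conv_ps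
  assumes "n \<ge> 3" and "odd n"
    and "f = f\<^sub>1 * g"
    and "multiplicity0 f\<^sub>1 = 1"
    and "irreducible g" and "multiplicity0 g = 2"
    and "value_semigroup g = {2 * a + n * b | a b. True}"
    and "tangent_cone f\<^sub>1 = tangent_cone g"
    and "intersection_mult f\<^sub>1 g = enat n"
  shows "\<exists>f'. analytically_equivalent f f' \<and>
    ((f' = \<^bold>y * (\<^bold>y ^ 2 - \<^bold>x ^ n) \<and>
      saito_basis f' (of_nat n * \<^bold>y, - 2 * \<^bold>x) (dform f') \<and>
      tjurina f' = enat (3 * n - 2) \<and> milnor f' = enat (3 * n - 2))
    \<or>
     (\<exists>m::nat. 1 \<le> m \<and> m \<le> (n - 3) div 2 \<and>
      f' = \<^bold>y * (\<^bold>y ^ 2 - 2 * \<^bold>x ^ ((n + 2 * m - 1) div 2) * \<^bold>y - \<^bold>x ^ n + \<^bold>x ^ (n + 2 * m - 1)) \<and>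
      saito_basis f'
        ((of_nat n ^ 2 * \<^bold>x ^ ((n - 2 * m - 1) div 2)
            - of_nat (n + 2 * m - 1) ^ 2 * \<^bold>x ^ ((n + 2 * m - 3) div 2)) * \<^bold>y,
         2 * (of_nat (2 * m - 1) * \<^bold>y - of_nat n * \<^bold>x ^ ((n - 2 * m + 1) div 2)
            + of_nat n * \<^bold>x ^ ((n + 2 * m - 1) div 2)))
        (- \<^bold>y * (of_nat n * \<^bold>y + of_nat (2 * m - 1) * \<^bold>x ^ ((n + 2 * m - 1) div 2)),
         2 * \<^bold>x * \<^bold>y) \<and>
      tjurina f' = enat ((5 * n + 2 * m - 3) div 2)))"
proof -
  consider "analytically_equivalent f (normal_form n 0)"
    | k where "n < 2 * k" "k + 2 \<le> n" "analytically_equivalent f (normal_form n (\<^bold>x ^ k))"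
    using classification[OF assms(2,1,4,5,6,8,9)] assms(3) by blast
  then show ?thesis
  proof cases
    case 1
    have nf: "normal_form n 0 = \<^bold>y * (\<^bold>y ^ 2 - \<^bold>x ^ n)" by (simp add: normal_form_def)
    show ?thesis
      using 1 nf saito_basis_quasi_homogeneous[OF assms(2,1)] codim_quasi_homogeneous[OF assms(2,1)] by blast
  next
    case (2 k)
    obtain h where h: "n = 2 * h + 1" using assms(2) by (rule oddE)
    \<comment> \<open>For n = 2h + 1 the exponent (n + 2m - 1)/2 is h + m, and n < 2k, k + 2 \<le> n
      turn into 1 \<le> m \<le> h - 1 = (n - 3)/2.\<close>
    define m where "m = k - h"
    have m: "1 \<le> m" "m \<le> (n - 3) div 2" using 2(1,2) by (auto simp: m_def h)
    have e: "(n + 2 * m - 1) div 2 = k" "n + 2 * m - 1 = 2 * k" "(n - 2 * m - 1) div 2 = n - k - 1"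
      "(n + 2 * m - 3) div 2 = k - 1" "2 * m - 1 = 2 * k - n" "(n - 2 * m + 1) div 2 = n - k"
      "(5 * n + 2 * m - 3) div 2 = 2 * n + k - 1"
      using 2(1,2) by (auto simp: m_def h)
    have nf: "normal_form n (\<^bold>x ^ k) =
        \<^bold>y * (\<^bold>y ^ 2 - 2 * \<^bold>x ^ k * \<^bold>y - \<^bold>x ^ n + \<^bold>x ^ (2 * k))"
    proof -
      have "\<^bold>x ^ (2 * k) = \<^bold>x ^ k * \<^bold>x ^ k" by (metis mult_2 power_add)
      then show ?thesis by (simp add: normal_form_def power2_eq_square algebra_simps)
    qed
    have k: "2 * k div 2 = k" by simp
    show ?thesis
      by (rule exI[of _ "normal_form n (\<^bold>x ^ k)"], rule conjI[OF 2(3)], rule disjI2, rule exI[of _ m],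
          simp only: e k)
        (use m nf saito_basis_normal_form_power[OF assms(2) 2(1,2)]
           tjurina_normal_form_power[OF assms(2) 2(1,2)] in blast)
  qed
qed

end
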